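(* Let $G$ be an infinite, connected, (simple) bipartite graph whose two vertex classes are coloured black and white, such that the coloured graph is quasi-transitive and every black vertex has degree 3. Let $\widetilde G$ be obtained from $G$ by applying the Fisher transformation at each black vertex. (a) The connective constants $\mu$ of $G$ and $\widetilde\mu$ of $\widetilde G$ satisfy $\mu^{-2}=h(\widetilde\mu^{-1})$, where $h(x)=x^3+x^4$. (b) If $|\gamma(G)|<\infty$ and $\eta(\widetilde G)$ exists, then $\gamma(G)=\gamma(\widetilde G)$ and $\eta(G)=\eta(\widetilde G)$. If moreover, with $W$ a fundamental domain of the coloured graph $G$, $\widetilde W$ the set of vertices of $\widetilde G$ that are white vertices of $W$ or vertices of triangles replacing black vertices of $W$, $X,\widetilde X$ the sets of edges incident to $W,\widetilde W$ respectively, and $\sigma_n,\widetilde\sigma_n$ the numbers of $n$-step SAWs on $G,\widetilde G$ starting at mid-edges of $X,\widetilde X$, there exist constants $C_1,C_2,\widetilde C_1,\widetilde C_2\in(0,\infty)$ and a common slowly varying function $L$ with $C_1L(n)n^{\gamma-1}\mu^n\le\sigma_n\le C_2L(n)n^{\gamma-1}\mu^n$ and $\widetilde C_1L(n)n^{\gamma-1}\widetilde\mu^n\le\widetilde\sigma_n\le\widetilde C_2L(n)n^{\gamma-1}\widetilde\mu^n$ for $n\ge1$ (where $\gamma=\gamma(G)$), then $\nu(G)=\nu(\widetilde G)$.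
   Context: A coloured-automorphism of a bipartite graph with vertex classes coloured black and white is a graph automorphism preserving colours. The coloured graph is quasi-transitive if there is a finite vertex set $W$ (a fundamental domain) such that every vertex $v$ is mapped into $W$ by some coloured-automorphism. The Fisher transformation at a degree-3 vertex $v$ with incident edges $\langle v,u_i\rangle$ ($i=1,2,3$) replaces $v$ by three new vertices $v_1,v_2,v_3$ pairwise joined by edges (a triangle) and replaces each $\langle v,u_i\rangle$ by $\langle v_i,u_i\rangle$. The connective constant of a quasi-transitive graph is $\mu=\lim_n\sigma_n(v)^{1/n}$, $\sigma_n(v)$ the number of $n$-step self-avoiding walks (SAWs) from vertex $v$; it exists and is independent of $v$. Mid-edge walks: each edge is identified with its midpoint; walks start and end at mid-edges, are self-avoiding if they visit no vertex or mid-edge twice, and have length $|\pi|$ equal to the number of vertices visited. For a graph $H$ with connective constant $\mu_H$, fundamental domain $W$, $X$ the edges incident to $W$, and $\Sigma$ the SAWs starting at mid-edges in $X$ ($\Sigma_n$ those of length $n$), define: $\gamma(H)$ by $Y(\mu_H^{-1},y)=\infty$ for $y<\gamma$ and $<\infty$ for $y>\gamma$, where $Y(x,y)=\sum_{\pi\in\Sigma}x^{|\pi|}/|\pi|^y$ (denominator $1$ if $|\pi|=0$); $\nu(H)$ by $V(z)=\infty$ for $z<\nu$ and $<\infty$ for $z>\nu$, where $V(z)=\sum_{n\ge1}n^{-(2z+1)}\langle\|\pi\|^2\rangle_n$, $\|\pi\|$ the graph-distance between endpoints of $\pi$ and $\langle\cdot\rangle_n$ the uniform average over $\Sigma_n$;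 and $\eta(H)$ exists if for every sequence of (coloured-)automorphisms $\alpha$ with $d_H(W,\alpha W)\to\infty$, $Z_\alpha(\mu_H^{-1})d_H(W,\alpha W)^w\to0$ for $w<\eta$ and $\to\infty$ for $w>\eta$, where $Z_\alpha(x)=\sum x^{|\pi|}$ over SAWs in $\Sigma$ ending at mid-edges of $\alpha X$. These exponents do not depend on the choice of fundamental domain. *)

theory Defs
  imports "HOL-Analysis.Analysis"
begin

section \<open>Simple graphs\<close>

record 'a ugraph =
  verts :: "'a set"
  edges :: "'a set set"

definition simple_graph :: "'a ugraph \<Rightarrow> bool" where
  "simple_graph G \<longleftrightarrow> (\<forall>e\<in>edges G. e \<subseteq> verts G \<and> card e = 2)"

definition incident_edges :: "'a ugraph \<Rightarrow> 'a set \<Rightarrow> 'a set set" where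
  "incident_edges G W = {e \<in> edges G. e \<inter> W \<noteq> {}}"

definition vertex_degree :: "'a ugraph \<Rightarrow> 'a \<Rightarrow> nat" where
  "vertex_degree G v = card (incident_edges G {v})"

definition locally_finite :: "'a ugraph \<Rightarrow> bool" where
  "locally_finite G \<longleftrightarrow> (\<forall>v\<in>verts G. finite (incident_edges G {v}))"

definition walk :: "'a ugraph \<Rightarrow> 'a list \<Rightarrow> bool" where
  "walk G p \<longleftrightarrow> p \<noteq> [] \<and> set p \<subseteq> verts G \<and> successively (\<lambda>u v. {u, v} \<in> edges G) p"

definition graph_connected :: "'a ugraph \<Rightarrow> bool" where
  "graph_connected G \<longleftrightarrow>
     (\<forall>u\<in>verts G. \<forall>v\<in>verts G. \<exists>p. walk G p \<and> hd p = u \<and> last p = v)"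

definition graph_dist :: "'a ugraph \<Rightarrow> 'a \<Rightarrow> 'a \<Rightarrow> nat" where
  "graph_dist G u v = (LEAST n. \<exists>p. walk G p \<and> hd p = u \<and> last p = v \<and> length p = Suc n)"

definition graph_set_dist :: "'a ugraph \<Rightarrow> 'a set \<Rightarrow> 'a set \<Rightarrow> nat" where
  "graph_set_dist G A B = (LEAST n. \<exists>a\<in>A. \<exists>b\<in>B. graph_dist G a b = n)"

definition bipartite_colouring :: "'a ugraph \<Rightarrow> 'a set \<Rightarrow> bool" where
  \<comment> \<open>\<open>B\<close> is the set of black vertices; the remaining vertices are white.\<close>
  "bipartite_colouring G B \<longleftrightarrow>
     B \<subseteq> verts G \<and> (\<forall>u v. {u, v} \<in> edges G \<longrightarrow> (u \<in> B \<longleftrightarrow> v \<notin> B))"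


section \<open>Automorphisms and quasi-transitivity\<close>

definition automorphisms :: "'a ugraph \<Rightarrow> ('a \<Rightarrow> 'a) set" where
  "automorphisms G = {\<phi>. bij_betw \<phi> (verts G) (verts G) \<and>
     (\<forall>u\<in>verts G. \<forall>v\<in>verts G. {\<phi> u, \<phi> v} \<in> edges G \<longleftrightarrow> {u, v} \<in> edges G)}"

definition coloured_automorphisms :: "'a ugraph \<Rightarrow> 'a set \<Rightarrow> ('a \<Rightarrow> 'a) set" where
  "coloured_automorphisms G B = {\<phi> \<in> automorphisms G. \<forall>v\<in>verts G. \<phi> v \<in> B \<longleftrightarrow> v \<in> B}"

text \<open>Below, \<open>\<Gamma>\<close> is the set of automorphisms under consideration: the coloured ones for a
  coloured graph, all of them for an uncoloured graph.\<close>

definition fundamental_domain :: "'a ugraph \<Rightarrow> ('a \<Rightarrow> 'a) set \<Rightarrow> 'a set \<Rightarrow> bool" where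
  "fundamental_domain G \<Gamma> W \<longleftrightarrow>
     finite W \<and> W \<subseteq> verts G \<and> (\<forall>v\<in>verts G. \<exists>\<phi>\<in>\<Gamma>. \<phi> v \<in> W)"

definition quasi_transitive :: "'a ugraph \<Rightarrow> ('a \<Rightarrow> 'a) set \<Rightarrow> bool" where
  "quasi_transitive G \<Gamma> \<longleftrightarrow> (\<exists>W. fundamental_domain G \<Gamma> W)"


section \<open>Connective constant\<close>

definition saws_from :: "'a ugraph \<Rightarrow> 'a \<Rightarrow> nat \<Rightarrow> 'a list set" where
  "saws_from G v n = {p. walk G p \<and> distinct p \<and> hd p = v \<and> length p = Suc n}"

definition connective_constant :: "'a ugraph \<Rightarrow> real" where
  "connective_constant G =
     (THE \<mu>. \<forall>v\<in>verts G. (\<lambda>n. root n (real (card (saws_from G v n)))) \<longlonglongrightarrow> \<mu>)"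


section \<open>Mid-edge walks\<close>

text \<open>The pair \<open>([v\<^sub>1, \<dots>, v\<^sub>n], [e\<^sub>0, \<dots>, e\<^sub>n])\<close> stands for the walk that starts at the midpoint of
  \<open>e\<^sub>0\<close>, visits \<open>v\<^sub>1\<close>, the midpoint of \<open>e\<^sub>1\<close>, \<open>v\<^sub>2\<close>, and so on, and stops at the midpoint of \<open>e\<^sub>n\<close>.\<close>

type_synonym 'a mwalk = "'a list \<times> 'a set list"

definition mid_saw :: "'a ugraph \<Rightarrow> 'a mwalk \<Rightarrow> bool" where
  "mid_saw G \<pi> \<longleftrightarrow> (case \<pi> of (vs, es) \<Rightarrow>
     length es = Suc (length vs) \<and> set vs \<subseteq> verts G \<and> set es \<subseteq> edges G \<and>
     (\<forall>i<length vs. vs ! i \<in> es ! i \<and> vs ! i \<in> es ! Suc i) \<and>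
     distinct vs \<and> distinct es)"

definition mlength :: "'a mwalk \<Rightarrow> nat" where
  "mlength \<pi> = length (fst \<pi>)"

definition mstart :: "'a mwalk \<Rightarrow> 'a set" where
  "mstart \<pi> = hd (snd \<pi>)"

definition mend :: "'a mwalk \<Rightarrow> 'a set" where
  "mend \<pi> = last (snd \<pi>)"

text \<open>Distance between the midpoints of two edges: every edge has length 1, so the two
  half-edges at the ends together contribute 1.\<close>

definition mid_dist :: "'a ugraph \<Rightarrow> 'a set \<Rightarrow> 'a set \<Rightarrow> nat" where
  "mid_dist G e f = (if e = f then 0 else Suc (graph_set_dist G e f))"

definition mdisp :: "'a ugraph \<Rightarrow> 'a mwalk \<Rightarrow> nat" where
  "mdisp G \<pi> = mid_dist G (mstart \<pi>) (mend \<pi>)"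

definition mid_saws :: "'a ugraph \<Rightarrow> 'a set \<Rightarrow> 'a mwalk set" where
  "mid_saws G W = {\<pi>. mid_saw G \<pi> \<and> mstart \<pi> \<in> incident_edges G W}"

definition mid_saws_n :: "'a ugraph \<Rightarrow> 'a set \<Rightarrow> nat \<Rightarrow> 'a mwalk set" where
  "mid_saws_n G W n = {\<pi> \<in> mid_saws G W. mlength \<pi> = n}"


section \<open>Critical exponents\<close>

text \<open>An exponent belongs to the graph and not to one particular fundamental domain, so the
  defining property is required for every fundamental domain.\<close>

definition saw_Y :: "'a ugraph \<Rightarrow> 'a set \<Rightarrow> real \<Rightarrow> real \<Rightarrow> ennreal" where
  "saw_Y G W x y = (\<Sum>\<^sub>\<infinity>\<pi>\<in>mid_saws G W.
     ennreal (x ^ mlength \<pi> / (if mlength \<pi> = 0 then 1 else real (mlength \<pi>) powr y)))"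

definition is_gamma :: "'a ugraph \<Rightarrow> ('a \<Rightarrow> 'a) set \<Rightarrow> ereal \<Rightarrow> bool" where
  "is_gamma G \<Gamma> g \<longleftrightarrow> (\<forall>W. fundamental_domain G \<Gamma> W \<longrightarrow> (\<forall>y::real.
     (ereal y < g \<longrightarrow> saw_Y G W (1 / connective_constant G) y = \<infinity>) \<and>
     (g < ereal y \<longrightarrow> saw_Y G W (1 / connective_constant G) y < \<infinity>)))"

definition saw_gamma :: "'a ugraph \<Rightarrow> ('a \<Rightarrow> 'a) set \<Rightarrow> ereal" where
  "saw_gamma G \<Gamma> = (THE g. is_gamma G \<Gamma> g)"

definition saw_V :: "'a ugraph \<Rightarrow> 'a set \<Rightarrow> real \<Rightarrow> ennreal" where
  "saw_V G W z = (\<Sum>\<^sub>\<infinity>n\<in>{1::nat..}. ennreal (real n powr (- (2 * z + 1)) *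
     ((\<Sum>\<pi>\<in>mid_saws_n G W n. (real (mdisp G \<pi>))\<^sup>2) / real (card (mid_saws_n G W n)))))"

definition is_nu :: "'a ugraph \<Rightarrow> ('a \<Rightarrow> 'a) set \<Rightarrow> ereal \<Rightarrow> bool" where
  "is_nu G \<Gamma> v \<longleftrightarrow> (\<forall>W. fundamental_domain G \<Gamma> W \<longrightarrow> (\<forall>z::real.
     (ereal z < v \<longrightarrow> saw_V G W z = \<infinity>) \<and> (v < ereal z \<longrightarrow> saw_V G W z < \<infinity>)))"

definition saw_nu :: "'a ugraph \<Rightarrow> ('a \<Rightarrow> 'a) set \<Rightarrow> ereal" where
  "saw_nu G \<Gamma> = (THE v. is_nu G \<Gamma> v)"

definition saw_Z :: "'a ugraph \<Rightarrow> 'a set \<Rightarrow> ('a \<Rightarrow> 'a) \<Rightarrow> real \<Rightarrow> ennreal" where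
  "saw_Z G W \<alpha> x = (\<Sum>\<^sub>\<infinity>\<pi>\<in>{\<pi> \<in> mid_saws G W. mend \<pi> \<in> (\<lambda>e. \<alpha> ` e) ` incident_edges G W}.
     ennreal (x ^ mlength \<pi>))"

definition is_eta :: "'a ugraph \<Rightarrow> ('a \<Rightarrow> 'a) set \<Rightarrow> ereal \<Rightarrow> bool" where
  "is_eta G \<Gamma> h \<longleftrightarrow> (\<forall>W. fundamental_domain G \<Gamma> W \<longrightarrow>
     (\<forall>\<alpha> :: nat \<Rightarrow> 'a \<Rightarrow> 'a. (\<forall>k. \<alpha> k \<in> \<Gamma>) \<longrightarrow>
        filterlim (\<lambda>k. graph_set_dist G W (\<alpha> k ` W)) at_top sequentially \<longrightarrow>
        (\<forall>w::real.
          (ereal w < h \<longrightarrow>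
             (\<lambda>k. saw_Z G W (\<alpha> k) (1 / connective_constant G) *
                  ennreal (real (graph_set_dist G W (\<alpha> k ` W)) powr w)) \<longlonglongrightarrow> 0) \<and>
          (h < ereal w \<longrightarrow>
             (\<lambda>k. saw_Z G W (\<alpha> k) (1 / connective_constant G) *
                  ennreal (real (graph_set_dist G W (\<alpha> k ` W)) powr w)) \<longlonglongrightarrow> \<infinity>))))"

definition eta_exists :: "'a ugraph \<Rightarrow> ('a \<Rightarrow> 'a) set \<Rightarrow> bool" where
  "eta_exists G \<Gamma> \<longleftrightarrow> (\<exists>h. is_eta G \<Gamma> h)"

definition saw_eta :: "'a ugraph \<Rightarrow> ('a \<Rightarrow> 'a) set \<Rightarrow> ereal" where
  "saw_eta G \<Gamma> = (THE h. is_eta G \<Gamma> h)"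


section \<open>Slowly varying functions\<close>

text \<open>Karamata's notion: positive and measurable near infinity, with the ratio condition.\<close>

definition slowly_varying :: "(real \<Rightarrow> real) \<Rightarrow> bool" where
  "slowly_varying L \<longleftrightarrow>
     (\<exists>a>0. (\<forall>x\<ge>a. L x > 0) \<and> L \<in> borel_measurable (restrict_space borel {a..})) \<and>
     (\<forall>c>0. ((\<lambda>x. L (c * x) / L x) \<longlongrightarrow> 1) at_top)"


section \<open>The Fisher transformation at all black vertices\<close>

text \<open>\<open>Tri v u\<close> is the triangle vertex that replaces the black vertex \<open>v\<close> at the end of its
  edge to \<open>u\<close>. As neighbours of black vertices are white, the transformations at different
  black vertices do not interfere with each other.\<close>

datatype 'a fisher_vertex = Keep 'a | Tri 'a 'a

definition fisher_verts :: "'a ugraph \<Rightarrow> 'a set \<Rightarrow> 'a set \<Rightarrow> 'a fisher_vertex set" where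
  "fisher_verts G B W = Keep ` (W - B) \<union> {Tri v u | v u. v \<in> W \<inter> B \<and> {v, u} \<in> edges G}"

definition fisher :: "'a ugraph \<Rightarrow> 'a set \<Rightarrow> 'a fisher_vertex ugraph" where
  "fisher G B = \<lparr>
     verts = fisher_verts G B (verts G),
     edges = {{Tri v u, Keep u} | v u. v \<in> B \<and> {v, u} \<in> edges G} \<union>
             {{Tri v u, Tri v u'} | v u u'.
                v \<in> B \<and> {v, u} \<in> edges G \<and> {v, u'} \<in> edges G \<and> u \<noteq> u'}\<rparr>"

end

theory Submission imports Defs begin

text \<open>
  A mid-edge walk on \<open>G\<close> passes a black vertex along two of its three edges. In the Fisher graph it
  then crosses the corresponding triangle in one of two ways, visiting two or three vertices, while
  white vertices stay as they are. Hence the lifts of a walk of length \<open>n\<close>, weighted by \<open>x\<close> per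
  vertex, have total weight \<open>r\<^sup>n\<close> up to a bounded factor, where \<open>r\<^sup>2 = x \<cdot> (x\<^sup>2 + x\<^sup>3) = x\<^sup>3 + x\<^sup>4\<close>.
  Conversely every walk on the Fisher graph that leaves its first triangle is such a lift, extended by
  at most three vertices at each end. Lengths and displacements change by bounded factors only.
  Comparing radii of convergence gives the relation of the connective constants, and comparing the
  sums at criticality gives the equality of the exponents. For \<open>\<nu>\<close> the averages become weighted sums
  by the assumed asymptotics, and the slowly varying factor is controlled by the boundedness of
  \<open>L (c x) / L x\<close> uniformly in \<open>c\<close> in a compact interval.
\<close>

section \<open>Sums of nonnegative terms and walks as vertex lists\<close>

text \<open>The obstacle that precedes any comparison is the existence of the limit behind
  \<open>connective_constant\<close> at every vertex: only the maximal count over all vertices is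
  submultiplicative, and the maximizing vertex varies with the length. All generating functions are
  sums of extended nonnegative reals, so divergence is a value like any other and two sums can be
  compared fibre by fibre before anything is known about convergence. For \<gamma> and \<nu> the
  defining predicates of the two graphs are shown to be equivalent, which identifies the two
  definite descriptions. For \<eta> the situation is asymmetric: its definition on the Fisher graph
  ranges over all automorphisms there, while only those induced by coloured automorphisms of
  \<open>G\<close> are under control. Hence the exponent is carried from the Fisher graph to
  \<open>G\<close>, and its uniqueness is proved on \<open>G\<close>, where automorphisms that move
  a fundamental domain arbitrarily far away are constructed.\<close>

lemma ennreal_summable_on [simp]: "(f :: 'b \<Rightarrow> ennreal) summable_on A"
  by (simp add: nonneg_summable_on_complete)

lemma sum_le_infsum_ennreal:
  fixes f :: "'b \<Rightarrow> ennreal"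
  assumes "finite F" "F \<subseteq> A"
  shows "sum f F \<le> infsum f A"
proof -
  have "infsum f F \<le> infsum f A"
    by (rule infsum_mono_neutral) (use assms in auto)
  thus ?thesis using assms by simp
qed

lemma infsum_subset_le_ennreal:
  fixes f :: "'b \<Rightarrow> ennreal"
  assumes "A \<subseteq> B"
  shows "infsum f A \<le> infsum f B"
  by (rule infsum_mono_neutral) (use assms in auto)

text \<open>Fibres of \<open>p\<close> may be infinite, so the hypothesis bounds only their finite
  subsets. A finite subset of \<open>A\<close> meets finitely many fibres, and its sum is grouped by
  fibre.\<close>

lemma infsum_le_fibrewise:
  fixes f :: "'b \<Rightarrow> ennreal" and g :: "'c \<Rightarrow> ennreal"
  assumes "p ` A \<subseteq> B"
    and le: "\<And>b F. b \<in> B \<Longrightarrow> finite F \<Longrightarrow> F \<subseteq> {a \<in> A. p a = b} \<Longrightarrow> sum f F \<le> c * g b"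
  shows "infsum f A \<le> c * infsum g B"
proof (rule infsum_le_finite_sums)
  fix F assume F: "finite F" "F \<subseteq> A"
  have "sum f F = (\<Sum>b\<in>p ` F. sum f {a \<in> F. p a = b})"
    by (rule sum.group[symmetric]) (use F in auto)
  also have "\<dots> \<le> (\<Sum>b\<in>p ` F. c * g b)"
    by (rule sum_mono, rule le) (use F assms(1) in auto)
  also have "\<dots> = c * sum g (p ` F)" by (simp add: sum_distrib_left)
  also have "\<dots> \<le> c * infsum g B"
    by (intro mult_left_mono sum_le_infsum_ennreal) (use F assms(1) in auto)
  finally show "sum f F \<le> c * infsum g B" .
qed simp

text \<open>A finite part \<open>S b\<close> of each fibre is enough for a lower bound on the sum
  over \<open>A\<close>; parts over different \<open>b\<close> are disjoint because \<open>p\<close>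
  separates them.\<close>

lemma infsum_ge_fibrewise:
  fixes f :: "'b \<Rightarrow> ennreal" and g :: "'c \<Rightarrow> ennreal"
  assumes S: "\<And>b. b \<in> B \<Longrightarrow> finite (S b)" "\<And>b. b \<in> B \<Longrightarrow> S b \<subseteq> {a \<in> A. p a = b}"
    and le: "\<And>b. b \<in> B \<Longrightarrow> g b \<le> c * sum f (S b)"
  shows "infsum g B \<le> c * infsum f A"
proof (rule infsum_le_finite_sums)
  fix F assume F: "finite F" "F \<subseteq> B"
  have "sum g F \<le> (\<Sum>b\<in>F. c * sum f (S b))"
    by (rule sum_mono, rule le) (use F in auto)
  also have "\<dots> = c * (\<Sum>b\<in>F. sum f (S b))" by (simp add: sum_distrib_left)
  also have "(\<Sum>b\<in>F. sum f (S b)) = sum f (\<Union>b\<in>F. S b)"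
  proof (rule sum.UNION_disjoint[symmetric])
    show "\<forall>i\<in>F. finite (S i)" using F S(1) by auto
    show "\<forall>i\<in>F. \<forall>j\<in>F. i \<noteq> j \<longrightarrow> S i \<inter> S j = {}" using F S(2) by blast
  qed (use F in auto)
  also have "c * \<dots> \<le> c * infsum f A"
  proof (intro mult_left_mono sum_le_infsum_ennreal)
    show "finite (\<Union>b\<in>F. S b)" using F S(1) by auto
    show "(\<Union>b\<in>F. S b) \<subseteq> A" using F S(2) by blast
  qed simp
  finally show "sum g F \<le> c * infsum f A" .
qed simp

lemma infsum_mult_left_le_ennreal:
  fixes f g :: "'b \<Rightarrow> ennreal"
  assumes "\<And>a. a \<in> A \<Longrightarrow> f a \<le> c * g a"
  shows "infsum f A \<le> c * infsum g A"
  by (rule infsum_ge_fibrewise[where S = "\<lambda>b. {b}" and p = "\<lambda>b. b"]) (use assms in auto)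

text \<open>Lets finitely many exceptional walks be dropped: those of length 0, and those so short
  that their projection may fail to have positive length.\<close>

lemma infsum_less_top_finite_part:
  fixes f :: "'b \<Rightarrow> ennreal"
  assumes "finite F" and "\<And>a. a \<in> F \<Longrightarrow> f a < \<infinity>" and "infsum f (A - F) < \<infinity>"
  shows "infsum f A < \<infinity>"
proof -
  have "infsum f A \<le> infsum f ((A - F) \<union> F)" by (rule infsum_subset_le_ennreal) auto
  also have "\<dots> = infsum f (A - F) + infsum f F" by (rule infsum_Un_disjoint) auto
  also have "\<dots> < \<infinity>" using assms by (simp add: less_top)
  finally show ?thesis .
qed

section \<open>Vertex lists and the edges they traverse\<close>

fun path_edges :: "'a list \<Rightarrow> 'a set list" where
  "path_edges [] = []"
| "path_edges [a] = []"
| "path_edges (a # b # p) = {a, b} # path_edges (b # p)"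

lemma length_path_edges [simp]: "length (path_edges p) = length p - 1"
  by (induction p rule: path_edges.induct) auto

lemma path_edges_map: "path_edges (map f p) = map ((`) f) (path_edges p)"
  by (induction p rule: path_edges.induct) auto

lemma path_edges_append:
  "p \<noteq> [] \<Longrightarrow> q \<noteq> [] \<Longrightarrow> path_edges (p @ q) = path_edges p @ {last p, hd q} # path_edges q"
proof (induction p rule: path_edges.induct)
  case (2 a) thus ?case by (cases q) auto
qed auto

lemma path_edges_rev: "path_edges (rev p) = rev (path_edges p)"
proof (induction p rule: path_edges.induct)
  case (3 a b p)
  have "path_edges (rev (b # p) @ [a]) = path_edges (rev (b # p)) @ [{b, a}]"
    by (subst path_edges_append) auto
  thus ?case using 3 by (simp add: insert_commute)
qed auto

lemma path_edges_nth: "Suc i < length p \<Longrightarrow> path_edges p ! i = {p ! i, p ! Suc i}"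
  by (induction p arbitrary: i rule: path_edges.induct) (auto simp: nth_Cons split: nat.split)

lemma hd_path_edges: "length p \<ge> 2 \<Longrightarrow> hd (path_edges p) = {hd p, hd (tl p)}"
  by (cases p rule: path_edges.cases) auto

lemma path_edges_eq_Nil_iff [simp]: "path_edges p = [] \<longleftrightarrow> length p \<le> 1"
  by (cases p rule: path_edges.cases) auto

lemma set_path_edges_subset_iff:
  "set (path_edges p) \<subseteq> E \<longleftrightarrow> successively (\<lambda>u v. {u, v} \<in> E) p"
  by (induction p rule: path_edges.induct) auto

lemma Union_path_edges: "\<Union> (set (path_edges p)) \<subseteq> set p"
  by (induction p rule: path_edges.induct) auto

lemma simple_graphD:
  assumes "simple_graph H" "{u, v} \<in> edges H"
  shows "u \<noteq> v" "u \<in> verts H" "v \<in> verts H"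
  using assms by (auto simp: simple_graph_def card_2_iff)

lemma simple_graph_other_end:
  assumes "simple_graph H" "e \<in> edges H" "v \<in> e"
  obtains u where "e = {v, u}" "u \<noteq> v"
proof -
  from assms obtain a b where "e = {a, b}" "a \<noteq> b" by (auto simp: simple_graph_def card_2_iff)
  with assms(3) that show ?thesis by (auto simp: doubleton_eq_iff)
qed

text \<open>A mid-edge walk of length \<open>n \<ge> 1\<close> is determined by the list of its \<open>n\<close> vertices preceded by
  the other end of its first edge and followed by the other end of its last edge; neither of these
  two outer vertices has to be distinct from the inner ones.\<close>

definition mid_path :: "'a ugraph \<Rightarrow> 'a list \<Rightarrow> bool" where
  "mid_path H p \<longleftrightarrow> length p \<ge> 2 \<and> walk H p \<and> distinct (butlast (tl p)) \<and> distinct (path_edges p)"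

definition mid_walk_of :: "'a list \<Rightarrow> 'a mwalk" where
  "mid_walk_of p = (butlast (tl p), path_edges p)"

lemma mid_path_edges: "mid_path H p \<Longrightarrow> set (path_edges p) \<subseteq> edges H"
  by (simp add: mid_path_def walk_def set_path_edges_subset_iff)

lemma mid_saw_mid_walk_of:
  assumes "mid_path H p"
  shows "mid_saw H (mid_walk_of p)"
proof -
  have "set (butlast (tl p)) \<subseteq> set p"
    by (cases p) (auto dest: in_set_butlastD)
  moreover have "butlast (tl p) ! i \<in> path_edges p ! i \<and> butlast (tl p) ! i \<in> path_edges p ! Suc i"
    if "i < length p - 2" for i
    using that by (simp add: nth_butlast nth_tl path_edges_nth)
  ultimately show ?thesis
    using assms mid_path_edges[OF assms]
    by (auto simp: mid_saw_def mid_walk_of_def mid_path_def walk_def)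
qed

text \<open>Peels off the first vertex, for induction. For \<open>es = []\<close> the value of
  \<open>hd es\<close> is harmless: both sides fail by the length condition.\<close>

lemma mid_saw_Cons:
  "mid_saw H (v # vs, e # es) \<longleftrightarrow>
     v \<in> verts H \<and> e \<in> edges H \<and> v \<in> e \<and> v \<in> hd es \<and> v \<notin> set vs \<and> e \<notin> set es \<and> mid_saw H (vs, es)"
proof (cases es)
  case (Cons f fs)
  have *: "(\<forall>i<length (v # vs). (v # vs) ! i \<in> (e # es) ! i \<and> (v # vs) ! i \<in> (e # es) ! Suc i) \<longleftrightarrow>
      v \<in> e \<and> v \<in> hd es \<and> (\<forall>i<length vs. vs ! i \<in> es ! i \<and> vs ! i \<in> es ! Suc i)"
    unfolding length_Cons All_less_Suc2 using Cons by simp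
  show ?thesis unfolding mid_saw_def prod.case * by simp blast
qed (simp add: mid_saw_def)

text \<open>The outer vertices of the list are the other ends of the first and the last edge. In
  between, an edge containing two distinct consecutive vertices is the pair of them.\<close>

lemma mid_saw_exists_path:
  assumes "simple_graph H"
  shows "mid_saw H (vs, es) \<Longrightarrow> vs \<noteq> [] \<Longrightarrow> \<exists>a b. path_edges (a # vs @ [b]) = es"
proof (induction vs arbitrary: es)
  case (Cons v vs)
  obtain e es' where es: "es = e # es'" using Cons.prems by (cases es) (auto simp: mid_saw_def)
  note m = Cons.prems(1)[unfolded es mid_saw_Cons]
  obtain a' where a': "e = {v, a'}" using simple_graph_other_end[OF assms] m by blast
  show ?case
  proof (cases vs)
    case Nil
    with m obtain f where f: "es' = [f]" by (auto simp: mid_saw_def length_Suc_conv)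
    with m Nil have "f \<in> edges H" "v \<in> f" by (auto simp: mid_saw_def)
    then obtain b where "f = {v, b}" using simple_graph_other_end[OF assms] by blast
    hence "path_edges (a' # (v # vs) @ [b]) = es" using Nil es f a' by (simp add: insert_commute)
    thus ?thesis by blast
  next
    case vs: (Cons w ws)
    from Cons.IH[of es'] m vs obtain a b where ab: "path_edges (a # vs @ [b]) = es'" by auto
    hence "hd es' = {a, w}" using vs by auto
    \<comment> \<open>\<open>v\<close> lies on \<open>hd es' = {a, w}\<close> and differs from
      \<open>w\<close>, since the inner vertices are distinct.\<close>
    hence "a = v" using m vs by auto
    hence "path_edges (a' # (v # vs) @ [b]) = es" using es ab a' by (simp add: insert_commute)
    thus ?thesis by blast
  qed
qed simp

text \<open>Injectivity rests on having at least three vertices: \<open>[a, b]\<close> and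
  \<open>[b, a]\<close> give the same walk of length 0. From length 1 on, each outer vertex can be
  read off from its end edge, because the adjacent inner vertex is known.\<close>

lemma bij_betw_mid_walk_of:
  assumes "simple_graph H"
  shows "bij_betw mid_walk_of {p. mid_path H p \<and> length p \<ge> 3} {\<pi>. mid_saw H \<pi> \<and> mlength \<pi> \<ge> 1}"
  unfolding bij_betw_def
proof (intro conjI set_eqI iffI inj_onI)
  fix p q assume p: "p \<in> {p. mid_path H p \<and> length p \<ge> 3}" and q: "q \<in> {p. mid_path H p \<and> length p \<ge> 3}"
    and eq: "mid_walk_of p = mid_walk_of q"
  have form: "\<exists>a v vs b. p = a # (v # vs) @ [b]" if len: "length p \<ge> 3" for p :: "'a list"
  proof -
    obtain a p' where 1: "p = a # p'" "length p' \<ge> 2" using len by (cases p) auto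
    then obtain v p'' where 2: "p' = v # p''" "1 \<le> length p''" by (cases p') auto
    hence "p'' = butlast p'' @ [last p'']" by (cases p'' rule: rev_cases) auto
    thus ?thesis using 1 2 by (metis append_Cons)
  qed
  from p q form obtain a v vs b a' v' vs' b' where
    pq: "p = a # (v # vs) @ [b]" "q = a' # (v' # vs') @ [b']" by (metis (no_types, lifting) mem_Collect_eq)
  with eq have vs: "v' = v" "vs' = vs" by (auto simp: mid_walk_of_def)
  from eq have e: "path_edges p = path_edges q" by (simp add: mid_walk_of_def)
  have "{a, v} = {a', v}" using e pq vs by simp
  hence "a = a'" by (auto simp: doubleton_eq_iff)
  have "last (path_edges (a # (v # vs) @ [b])) = {last (v # vs), b}" for a v :: 'a and vs b
    using path_edges_append[of "a # v # vs" "[b]"] by simp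
  from this[of a v vs b] this[of a' v' vs' b'] have "{last (v # vs), b} = {last (v # vs), b'}"
    using e pq vs by simp
  hence "b = b'" by (auto simp: doubleton_eq_iff)
  show "p = q" using pq vs \<open>a = a'\<close> \<open>b = b'\<close> by simp
next
  fix \<pi> assume "\<pi> \<in> mid_walk_of ` {p. mid_path H p \<and> length p \<ge> 3}"
  thus "\<pi> \<in> {\<pi>. mid_saw H \<pi> \<and> mlength \<pi> \<ge> 1}"
    using mid_saw_mid_walk_of by (auto simp: mlength_def mid_walk_of_def)
next
  fix \<pi> assume "\<pi> \<in> {\<pi>. mid_saw H \<pi> \<and> mlength \<pi> \<ge> 1}"
  then obtain vs es where \<pi>: "\<pi> = (vs, es)" "mid_saw H (vs, es)" "vs \<noteq> []"
    by (cases \<pi>) (fastforce simp: mlength_def)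
  from mid_saw_exists_path[OF assms this(2,3)] obtain a b where ab: "path_edges (a # vs @ [b]) = es"
    by blast
  have s: "successively (\<lambda>u v. {u, v} \<in> edges H) (a # vs @ [b])"
    unfolding set_path_edges_subset_iff[symmetric] ab using \<pi> by (auto simp: mid_saw_def)
  obtain v vs' where vs: "vs = v # vs'" using \<pi> by (cases vs) auto
  have "{a, v} \<in> edges H" using s vs by simp
  moreover have "{last vs, b} \<in> edges H"
    using s \<pi>(3) by (auto simp: successively_append_iff successively_Cons split: if_splits)
  ultimately have "a \<in> verts H" "b \<in> verts H" using simple_graphD[OF assms] by blast+
  hence "mid_path H (a # vs @ [b])"
    using s \<pi> ab by (auto simp: mid_path_def walk_def mid_saw_def)
  moreover have "mid_walk_of (a # vs @ [b]) = \<pi>" using \<pi> ab by (simp add: mid_walk_of_def)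
  ultimately show "\<pi> \<in> mid_walk_of ` {p. mid_path H p \<and> length p \<ge> 3}"
    using vs by (intro image_eqI[of _ _ "a # vs @ [b]"]) auto
qed


section \<open>Connective constants of quasi-transitive graphs\<close>

definition nbrs :: "'a ugraph \<Rightarrow> 'a \<Rightarrow> 'a set" where
  "nbrs H v = {u. {v, u} \<in> edges H}"

lemma incident_edges_singleton:
  assumes "simple_graph H"
  shows "incident_edges H {v} = (\<lambda>u. {v, u}) ` nbrs H v"
proof (intro set_eqI iffI)
  fix e assume "e \<in> incident_edges H {v}"
  hence e: "e \<in> edges H" "v \<in> e" by (auto simp: incident_edges_def)
  then obtain u where "e = {v, u}" using simple_graph_other_end[OF assms] by blast
  thus "e \<in> (\<lambda>u. {v, u}) ` nbrs H v" using e by (auto simp: nbrs_def)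
qed (auto simp: incident_edges_def nbrs_def)

lemma inj_on_doubleton: "inj_on (\<lambda>u. {v, u}) A"
  by (auto simp: inj_on_def doubleton_eq_iff)

lemma card_nbrs: "simple_graph H \<Longrightarrow> card (nbrs H v) = vertex_degree H v"
  by (simp add: vertex_degree_def incident_edges_singleton card_image inj_on_doubleton)

section \<open>Walks and graph distance\<close>

lemma walk_Cons_iff:
  "walk H (a # p) \<longleftrightarrow> a \<in> verts H \<and> (p = [] \<or> {a, hd p} \<in> edges H \<and> walk H p)"
  by (auto simp: walk_def successively_Cons)

lemma walk_append_iff:
  "p \<noteq> [] \<Longrightarrow> q \<noteq> [] \<Longrightarrow> walk H (p @ q) \<longleftrightarrow> walk H p \<and> walk H q \<and> {last p, hd q} \<in> edges H"
  by (auto simp: walk_def successively_append_iff)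

lemma walk_rev: "walk H (rev p) \<longleftrightarrow> walk H p"
  unfolding walk_def set_path_edges_subset_iff[symmetric] path_edges_rev by simp

lemma walk_take: "walk H p \<Longrightarrow> 0 < n \<Longrightarrow> walk H (take n p)"
  using walk_append_iff[of "take n p" "drop n p" H] by (cases "drop n p = []") (auto simp: walk_def)

lemma walk_drop: "walk H p \<Longrightarrow> n < length p \<Longrightarrow> walk H (drop n p)"
  using walk_append_iff[of "take n p" "drop n p" H] by (cases "n = 0") (auto simp: walk_def)

lemma hd_in_verts: "walk H p \<Longrightarrow> hd p \<in> verts H" and last_in_verts: "walk H p \<Longrightarrow> last p \<in> verts H"
  by (auto simp: walk_def)

lemma graph_dist_le:
  assumes "walk H p" "hd p = u" "last p = v"
  shows "graph_dist H u v \<le> length p - 1"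
  unfolding graph_dist_def by (rule Least_le, rule exI[of _ p]) (use assms in \<open>auto simp: walk_def\<close>)

lemma graph_dist_walk:
  assumes "graph_connected H" "u \<in> verts H" "v \<in> verts H"
  obtains p where "walk H p" "hd p = u" "last p = v" "length p = Suc (graph_dist H u v)"
proof -
  from assms obtain p where "walk H p" "hd p = u" "last p = v" by (auto simp: graph_connected_def)
  hence "\<exists>n p. walk H p \<and> hd p = u \<and> last p = v \<and> length p = Suc n"
    by (intro exI[of _ "length p - 1"] exI[of _ p]) (auto simp: walk_def)
  from LeastI_ex[OF this] show ?thesis using that unfolding graph_dist_def by blast
qed

lemma graph_dist_triangle:
  assumes "graph_connected H" "u \<in> verts H" "v \<in> verts H" "w \<in> verts H"
  shows "graph_dist H u w \<le> graph_dist H u v + graph_dist H v w"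
proof -
  obtain p where p: "walk H p" "hd p = u" "last p = v" "length p = Suc (graph_dist H u v)"
    using graph_dist_walk[OF assms(1,2,3)] .
  obtain q where q: "walk H q" "hd q = v" "last q = w" "length q = Suc (graph_dist H v w)"
    using graph_dist_walk[OF assms(1,3,4)] .
  obtain q' where q': "q = v # q'" using q by (cases q) (auto simp: walk_def)
  show ?thesis
  proof (cases "q' = []")
    case True
    thus ?thesis using q q' by simp
  next
    case False
    have "p \<noteq> []" using p(1) by (auto simp: walk_def)
    hence "walk H (p @ q')"
      using p q q' False by (subst walk_append_iff) (auto simp: walk_Cons_iff)
    from graph_dist_le[OF this, of u w] p q q' False show ?thesis by (auto simp: walk_def hd_append)
  qed
qed

text \<open>A repeated vertex would allow the closed part between its two occurrences to be cut out,
  leaving a shorter walk with the same ends.\<close>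

lemma graph_dist_distinct:
  assumes "walk H p" "hd p = u" "last p = v" "length p = Suc (graph_dist H u v)"
  shows "distinct p"
proof (rule ccontr)
  assume "\<not> distinct p"
  then obtain xs y ys zs where p: "p = xs @ [y] @ ys @ [y] @ zs" using not_distinct_decomp by blast
  have s: "successively (\<lambda>u v. {u, v} \<in> edges H) (xs @ [y] @ zs)"
    using assms(1) unfolding p walk_def by (auto simp: successively_append_iff successively_Cons)
  have "walk H (xs @ [y] @ zs)" using assms(1) s unfolding p walk_def by auto
  moreover have "hd (xs @ [y] @ zs) = u" "last (xs @ [y] @ zs) = v"
    using assms unfolding p by (auto simp: hd_append split: if_splits)
  ultimately have "graph_dist H u v \<le> length (xs @ [y] @ zs) - 1" by (rule graph_dist_le)
  thus False using assms(4) p by simp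
qed

lemma graph_set_dist_le: "a \<in> A \<Longrightarrow> b \<in> C \<Longrightarrow> graph_set_dist H A C \<le> graph_dist H a b"
  unfolding graph_set_dist_def by (rule Least_le) auto

lemma graph_set_dist_attained:
  assumes "A \<noteq> {}" "C \<noteq> {}"
  obtains a b where "a \<in> A" "b \<in> C" "graph_dist H a b = graph_set_dist H A C"
proof -
  from assms have "\<exists>n. \<exists>a\<in>A. \<exists>b\<in>C. graph_dist H a b = n" by blast
  from LeastI_ex[OF this] show ?thesis using that unfolding graph_set_dist_def by blast
qed

section \<open>Automorphisms acting on walks and distances\<close>

lemma automorphismsD:
  assumes "\<phi> \<in> automorphisms H"
  shows "inj_on \<phi> (verts H)" "\<phi> ` verts H = verts H" "v \<in> verts H \<Longrightarrow> \<phi> v \<in> verts H"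
    "u \<in> verts H \<Longrightarrow> v \<in> verts H \<Longrightarrow> {\<phi> u, \<phi> v} \<in> edges H \<longleftrightarrow> {u, v} \<in> edges H"
  using assms by (auto simp: automorphisms_def bij_betw_def)

lemma walk_map_automorphism:
  assumes "\<phi> \<in> automorphisms H" "walk H p"
  shows "walk H (map \<phi> p)"
proof -
  have "set p \<subseteq> verts H" "successively (\<lambda>u v. {u, v} \<in> edges H) p" using assms by (auto simp: walk_def)
  hence "successively (\<lambda>u v. {\<phi> u, \<phi> v} \<in> edges H) p"
    by (induction p rule: path_edges.induct) (auto simp: automorphismsD[OF assms(1)])
  thus ?thesis using assms automorphismsD(3)[OF assms(1)]
    by (auto simp: walk_def successively_map)
qed

lemma inv_automorphism:
  assumes "\<phi> \<in> automorphisms H"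
  shows "inv_into (verts H) \<phi> \<in> automorphisms H"
proof -
  let ?\<psi> = "inv_into (verts H) \<phi>"
  have b: "bij_betw \<phi> (verts H) (verts H)" using assms by (simp add: automorphisms_def)
  hence b': "bij_betw ?\<psi> (verts H) (verts H)" by (rule bij_betw_inv_into)
  have "{?\<psi> u, ?\<psi> v} \<in> edges H \<longleftrightarrow> {u, v} \<in> edges H" if "u \<in> verts H" "v \<in> verts H" for u v
    using automorphismsD(4)[OF assms, of "?\<psi> u" "?\<psi> v"] that b b'
    by (simp add: bij_betw_inv_into_right bij_betw_apply)
  thus ?thesis using b' by (simp add: automorphisms_def)
qed

text \<open>Mapping a geodesic gives one inequality for every automorphism; the inverse automorphism
  gives the other.\<close>

lemma graph_dist_automorphism:
  assumes "graph_connected H" "\<phi> \<in> automorphisms H" "u \<in> verts H" "v \<in> verts H"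
  shows "graph_dist H (\<phi> u) (\<phi> v) = graph_dist H u v"
proof -
  have le: "graph_dist H (\<psi> u) (\<psi> v) \<le> graph_dist H u v"
    if \<psi>: "\<psi> \<in> automorphisms H" and u: "u \<in> verts H" and v: "v \<in> verts H" for \<psi> u v
  proof -
    obtain p where p: "walk H p" "hd p = u" "last p = v" "length p = Suc (graph_dist H u v)"
      using graph_dist_walk[OF assms(1) u v] .
    from graph_dist_le[OF walk_map_automorphism[OF \<psi> p(1)], of "\<psi> u" "\<psi> v"] p
    show ?thesis by (auto simp: walk_def hd_map last_map)
  qed
  have "inv_into (verts H) \<phi> (\<phi> w) = w" if "w \<in> verts H" for w
    using automorphismsD(1)[OF assms(2)] that by simp
  with le[OF inv_automorphism[OF assms(2)], of "\<phi> u" "\<phi> v"] le[OF assms(2-4)] assms(3,4)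
  show ?thesis by (simp add: automorphismsD[OF assms(2)])
qed

text \<open>A walk cut at its \<open>k\<close>-th vertex keeps that vertex in both parts; this form
  makes cutting injective in the counting arguments below.\<close>

lemma eq_if_take_Suc_drop_eq:
  assumes "take (Suc k) p = take (Suc k) q" "drop k p = drop k q"
  shows "p = q"
proof -
  have "take k p = take k q" using arg_cong[OF assms(1), of "take k"] by simp
  thus ?thesis using assms(2) by (metis append_take_drop_id)
qed

text \<open>Fekete's argument: \<mu> is the infimum of the roots \<open>root n (M n)\<close>. The
  upper bound comes from writing \<open>n = q * k + i\<close> for one good \<open>k\<close>. It
  carries a constant uniform in \<open>n\<close>, since it is later applied to several lengths at
  once.\<close>

lemma submultiplicative_growth:
  fixes M :: "nat \<Rightarrow> real"
  assumes M1: "\<And>n. M n \<ge> 1" and sub: "\<And>m n. M (m + n) \<le> M m * M n"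
  obtains \<mu> where "\<mu> \<ge> 1" "\<And>n. \<mu> ^ n \<le> M n"
    "\<And>\<delta>. \<delta> > 0 \<Longrightarrow> \<exists>C\<ge>1. \<forall>n. M n \<le> C * ((1 + \<delta>) * \<mu>) ^ n"
proof -
  define R where "R = (\<lambda>n. root n (M n)) ` {1..}"
  define \<mu> where "\<mu> = Inf R"
  have R1: "x \<ge> 1" if "x \<in> R" for x using that M1 by (auto simp: R_def)
  have bdd: "bdd_below R" using R1 by (rule bdd_belowI)
  have ne: "R \<noteq> {}" by (auto simp: R_def)
  have \<mu>1: "\<mu> \<ge> 1" unfolding \<mu>_def by (rule cInf_greatest[OF ne R1])
  have 1: "\<mu> ^ n \<le> M n" for n
  proof (cases "n = 0")
    case True thus ?thesis using M1[of 0] by simp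
  next
    case False
    hence "\<mu> \<le> root n (M n)" unfolding \<mu>_def by (intro cInf_lower bdd) (auto simp: R_def)
    hence "\<mu> ^ n \<le> root n (M n) ^ n" using \<mu>1 by (intro power_mono) auto
    thus ?thesis using False M1[of n] by simp
  qed
  have 2: "\<exists>C\<ge>1. \<forall>n. M n \<le> C * ((1 + \<delta>) * \<mu>) ^ n" if "\<delta> > 0" for \<delta>
  proof -
    define l where "l = (1 + \<delta>) * \<mu>"
    have l: "\<mu> < l" "l \<ge> 1" using that \<mu>1 by (auto simp: l_def distrib_right intro: order_trans)
    then obtain x where "x \<in> R" "x < l" using cInf_lessD[OF ne, of l] by (auto simp: \<mu>_def)
    then obtain k where k: "k \<ge> 1" "root k (M k) < l" by (auto simp: R_def)
    have "M k = root k (M k) ^ k" using k M1[of k] by simp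
    also have "\<dots> \<le> l ^ k" using k M1[of k] by (intro power_mono) auto
    finally have Mk: "M k \<le> l ^ k" .
    \<comment> \<open>The constant absorbs the remainders \<open>i < k\<close>; the remainder 0
      gives \<open>C \<ge> 1\<close>.\<close>
    define C where "C = Max (M ` {..<k})"
    have C: "M i \<le> C" if "i < k" for i unfolding C_def using that by (intro Max_ge) auto
    have C1: "C \<ge> 1" using C[of 0] M1[of 0] k by simp
    have q: "M (q * k + i) \<le> l ^ (q * k) * M i" for q i
    proof (induction q)
      case (Suc q)
      have "M (Suc q * k + i) \<le> M k * M (q * k + i)" using sub[of k "q * k + i"] by (simp add: add_ac)
      also have "\<dots> \<le> l ^ k * (l ^ (q * k) * M i)"
        using Mk Suc M1[of "q * k + i"] l by (intro mult_mono) auto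
      finally show ?case by (simp add: power_add algebra_simps)
    qed simp
    have "M n \<le> C * l ^ n" for n
    proof -
      have "M n \<le> l ^ (n div k * k) * M (n mod k)" using q[of "n div k" "n mod k"] by simp
      also have "\<dots> \<le> l ^ n * C"
        using l C[of "n mod k"] k C1 M1[of "n mod k"] by (intro mult_mono power_increasing) auto
      finally show ?thesis by (simp add: mult.commute)
    qed
    thus ?thesis using C1 by (auto simp: l_def)
  qed
  show ?thesis using that[OF \<mu>1 1 2] by blast
qed

text \<open>One locale serves both graphs: \<open>G\<close> with its coloured automorphisms and the
  Fisher graph with all its automorphisms.\<close>

locale qt_graph =
  fixes H :: "'a ugraph" and \<Gamma> :: "('a \<Rightarrow> 'a) set"
  assumes simple: "simple_graph H" and inf: "infinite (verts H)" and conn: "graph_connected H"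
    and lf: "locally_finite H" and \<Gamma>: "\<Gamma> \<subseteq> automorphisms H" and qt: "quasi_transitive H \<Gamma>"
begin

section \<open>Finite balls and long self-avoiding walks\<close>

lemma finite_nbrs: "finite (nbrs H v)"
proof (cases "v \<in> verts H")
  case True
  hence "finite ((\<lambda>u. {v, u}) ` nbrs H v)"
    using lf by (simp add: locally_finite_def incident_edges_singleton[OF simple])
  thus ?thesis by (rule finite_imageD[OF _ inj_on_doubleton])
next
  case False
  hence "nbrs H v = {}" using simple_graphD[OF simple] by (auto simp: nbrs_def)
  thus ?thesis by simp
qed

lemma verts_nonempty: "verts H \<noteq> {}" using inf by auto

lemma finite_walks_from: "finite {p. walk H p \<and> hd p = v \<and> length p = Suc n}"
proof (induction n arbitrary: v)
  case 0
  have "{p. walk H p \<and> hd p = v \<and> length p = Suc 0} \<subseteq> {[v]}" by (auto simp: length_Suc_conv)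
  thus ?case by (rule finite_subset) simp
next
  case (Suc n)
  let ?A = "\<lambda>u n. {p. walk H p \<and> hd p = u \<and> length p = Suc n}"
  have "?A v (Suc n) \<subseteq> (\<Union>u\<in>nbrs H v. (#) v ` ?A u n)"
  proof
    fix p assume "p \<in> ?A v (Suc n)"
    then obtain q where p: "p = v # q" "length q = Suc n" "walk H p" by (auto simp: length_Suc_conv)
    hence "{v, hd q} \<in> edges H" "walk H q" by (auto simp: walk_Cons_iff)
    hence "hd q \<in> nbrs H v" "q \<in> ?A (hd q) n" using p by (auto simp: nbrs_def)
    thus "p \<in> (\<Union>u\<in>nbrs H v. (#) v ` ?A u n)" using p by blast
  qed
  thus ?case by (rule finite_subset) (use Suc finite_nbrs in auto)
qed

lemma finite_saws: "finite (saws_from H v n)"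
  by (rule finite_subset[OF _ finite_walks_from[of v n]]) (auto simp: saws_from_def)

lemma finite_ball:
  assumes v: "v \<in> verts H"
  shows "finite {u \<in> verts H. graph_dist H v u \<le> n}"
proof -
  have "{u \<in> verts H. graph_dist H v u \<le> n} \<subseteq> (\<Union>k\<le>n. last ` saws_from H v k)"
  proof
    fix u assume "u \<in> {u \<in> verts H. graph_dist H v u \<le> n}"
    hence u: "u \<in> verts H" "graph_dist H v u \<le> n" by auto
    obtain p where p: "walk H p" "hd p = v" "last p = u" "length p = Suc (graph_dist H v u)"
      using graph_dist_walk[OF conn v u(1)] .
    hence "p \<in> saws_from H v (graph_dist H v u)"
      using graph_dist_distinct[OF p] by (simp add: saws_from_def)
    thus "u \<in> (\<Union>k\<le>n. last ` saws_from H v k)" using u p by blast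
  qed
  thus ?thesis by (rule finite_subset) (use finite_saws in auto)
qed

lemma exists_far:
  assumes "finite W" "W \<subseteq> verts H"
  obtains v where "v \<in> verts H" "\<And>w. w \<in> W \<Longrightarrow> graph_dist H w v > n"
proof -
  have "finite (\<Union>w\<in>W. {u \<in> verts H. graph_dist H w u \<le> n})" using assms finite_ball by auto
  from ex_new_if_finite[OF _ this] have "\<not> verts H \<subseteq> (\<Union>w\<in>W. {u \<in> verts H. graph_dist H w u \<le> n})"
    using inf \<open>finite (\<Union>w\<in>W. _)\<close> finite_subset by blast
  then obtain v where "v \<in> verts H" "v \<notin> (\<Union>w\<in>W. {u \<in> verts H. graph_dist H w u \<le> n})" by blast
  thus ?thesis using that by force
qed

lemma saws_take:
  assumes "p \<in> saws_from H v n" "k \<le> n"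
  shows "take (Suc k) p \<in> saws_from H v k"
  using assms walk_take[of H p "Suc k"] by (auto simp: saws_from_def)

lemma saws_drop:
  assumes "p \<in> saws_from H v n" "k \<le> n"
  shows "drop k p \<in> saws_from H (p ! k) (n - k)"
  using assms walk_drop[of H p k] by (auto simp: saws_from_def hd_drop_conv_nth)

text \<open>Balls are finite and the graph is infinite, so some vertex is farther away than
  \<open>n\<close>; a geodesic to it is self-avoiding, and so is its initial segment.\<close>

lemma saws_nonempty:
  assumes "v \<in> verts H"
  shows "saws_from H v n \<noteq> {}"
proof -
  obtain u where u: "u \<in> verts H" "graph_dist H v u > n" using exists_far[of "{v}" n] assms by auto
  obtain p where p: "walk H p" "hd p = v" "last p = u" "length p = Suc (graph_dist H v u)"
    using graph_dist_walk[OF conn assms u(1)] .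
  hence "p \<in> saws_from H v (graph_dist H v u)"
    using graph_dist_distinct[OF p] by (simp add: saws_from_def)
  from saws_take[OF this, of n] u show ?thesis by auto
qed

section \<open>Counting self-avoiding walks from a vertex\<close>

definition saw_count :: "'a \<Rightarrow> nat \<Rightarrow> real" where
  "saw_count v n = real (card (saws_from H v n))"

lemma saw_count_ge_1: "v \<in> verts H \<Longrightarrow> saw_count v n \<ge> 1"
  using saws_nonempty finite_saws unfolding saw_count_def
  by (simp add: Suc_le_eq card_gt_0_iff)

lemma saw_count_automorphism_le:
  assumes "\<phi> \<in> automorphisms H"
  shows "saw_count v n \<le> saw_count (\<phi> v) n"
proof -
  have "map \<phi> ` saws_from H v n \<subseteq> saws_from H (\<phi> v) n"
  proof
    fix q assume "q \<in> map \<phi> ` saws_from H v n"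
    then obtain p where p: "q = map \<phi> p" "walk H p" "distinct p" "hd p = v" "length p = Suc n"
      by (auto simp: saws_from_def)
    have "inj_on \<phi> (set p)"
      using automorphismsD(1)[OF assms] p(2) by (auto simp: walk_def intro: inj_on_subset)
    thus "q \<in> saws_from H (\<phi> v) n"
      using p walk_map_automorphism[OF assms p(2)]
      by (auto simp: saws_from_def distinct_map hd_map walk_def)
  qed
  moreover have "inj_on (map \<phi>) (saws_from H v n)"
    using automorphismsD(1)[OF assms]
    by (intro inj_on_mapI) (auto simp: saws_from_def walk_def intro: inj_on_subset)
  ultimately show ?thesis
    unfolding saw_count_def by (simp add: card_inj_on_le finite_saws)
qed

text \<open>The maximum runs over an infinite vertex set. It is genuine because the counts are
  natural numbers bounded by the largest count on a fundamental domain.\<close>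

definition max_saw_count :: "nat \<Rightarrow> real" where
  "max_saw_count n = Max ((\<lambda>v. saw_count v n) ` verts H)"

lemma max_saw_count_attained:
  assumes "fundamental_domain H \<Gamma> W"
  shows "\<exists>w\<in>W. saw_count w n = max_saw_count n" and "v \<in> verts H \<Longrightarrow> saw_count v n \<le> max_saw_count n"
proof -
  let ?m = "Max ((\<lambda>v. saw_count v n) ` W)"
  have W: "finite W" "W \<subseteq> verts H" using assms by (auto simp: fundamental_domain_def)
  have le: "\<exists>w\<in>W. saw_count v n \<le> saw_count w n" if "v \<in> verts H" for v
    using assms that saw_count_automorphism_le \<Gamma> unfolding fundamental_domain_def by blast
  hence "W \<noteq> {}" using verts_nonempty by auto
  have m: "saw_count v n \<le> ?m" if v: "v \<in> verts H" for v
  proof -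
    obtain w where "w \<in> W" "saw_count v n \<le> saw_count w n" using le[OF v] by blast
    moreover have "saw_count w n \<le> ?m" using W \<open>w \<in> W\<close> by (intro Max_ge) auto
    ultimately show ?thesis by simp
  qed
  have "(\<lambda>v. saw_count v n) ` verts H \<subseteq> real ` {..nat \<lfloor>?m\<rfloor>}"
    using m by (auto simp: saw_count_def le_nat_floor)
  hence fin: "finite ((\<lambda>v. saw_count v n) ` verts H)" by (rule finite_subset) simp
  thus "v \<in> verts H \<Longrightarrow> saw_count v n \<le> max_saw_count n"
    unfolding max_saw_count_def by (intro Max_ge) auto
  have "max_saw_count n \<in> (\<lambda>v. saw_count v n) ` verts H"
    unfolding max_saw_count_def using fin verts_nonempty by (intro Max_in) auto
  then obtain v where v: "v \<in> verts H" "saw_count v n = max_saw_count n" by auto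
  from le[OF v(1)] obtain w where w: "w \<in> W" "saw_count v n \<le> saw_count w n" by blast
  have "saw_count w n \<le> max_saw_count n"
    unfolding max_saw_count_def using fin w W by (intro Max_ge) auto
  with w v show "\<exists>w\<in>W. saw_count w n = max_saw_count n" by force
qed

lemma saw_count_le_max: "v \<in> verts H \<Longrightarrow> saw_count v n \<le> max_saw_count n"
  using max_saw_count_attained(2) qt unfolding quasi_transitive_def by blast

lemma max_saw_count_in_verts: "\<exists>v\<in>verts H. saw_count v n = max_saw_count n"
  using max_saw_count_attained(1) qt unfolding quasi_transitive_def fundamental_domain_def by blast

lemma max_saw_count_ge_1: "max_saw_count n \<ge> 1"
  using max_saw_count_in_verts[of n] saw_count_ge_1[of _ n] by force

text \<open>Cut after \<open>m\<close> steps. The second part starts at an uncontrolled vertex,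
  hence the maximum in the second factor.\<close>

lemma saw_count_add_le: "saw_count v (m + n) \<le> saw_count v m * max_saw_count n"
proof -
  let ?S = "SIGMA q : saws_from H v m. saws_from H (last q) n"
  have "(\<lambda>p. (take (Suc m) p, drop m p)) ` saws_from H v (m + n) \<subseteq> ?S"
  proof
    fix z assume "z \<in> (\<lambda>p. (take (Suc m) p, drop m p)) ` saws_from H v (m + n)"
    then obtain p where p: "z = (take (Suc m) p, drop m p)" "p \<in> saws_from H v (m + n)" by auto
    have "last (take (Suc m) p) = p ! m"
      using p(2) by (simp add: saws_from_def take_Suc_conv_app_nth)
    thus "z \<in> ?S" using p saws_take[OF p(2), of m] saws_drop[OF p(2), of m] by simp
  qed
  moreover have "inj_on (\<lambda>p. (take (Suc m) p, drop m p)) (saws_from H v (m + n))"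
    by (intro inj_onI) (auto dest: eq_if_take_Suc_drop_eq)
  ultimately have "card (saws_from H v (m + n)) \<le> card ?S"
    by (intro card_inj_on_le) (use finite_saws in auto)
  hence "saw_count v (m + n) \<le> (\<Sum>q\<in>saws_from H v m. saw_count (last q) n)"
    unfolding saw_count_def by (simp add: card_SigmaI finite_saws flip: of_nat_sum)
  also have "\<dots> \<le> (\<Sum>q\<in>saws_from H v m. max_saw_count n)"
    by (intro sum_mono saw_count_le_max) (auto simp: saws_from_def last_in_verts)
  finally show ?thesis by (simp add: saw_count_def)
qed

text \<open>A walk from \<open>u\<close> either avoids \<open>v\<close>, and then \<open>v\<close>
  can be put in front of it, or it meets \<open>v\<close> at some step \<open>k\<close>, and
  reversing its first part turns it into two walks from \<open>v\<close>.\<close>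

lemma saw_count_neighbour_le:
  assumes uv: "{u, v} \<in> edges H"
  shows "saw_count u n \<le> saw_count v (Suc n) + (\<Sum>k\<le>n. saw_count v k * saw_count v (n - k))"
proof -
  define A where "A = {p \<in> saws_from H u n. v \<notin> set p}"
  define B where "B k = {p \<in> saws_from H u n. p ! k = v}" for k
  have "saws_from H u n = A \<union> (\<Union>k\<le>n. B k)"
    by (auto simp: A_def B_def in_set_conv_nth saws_from_def less_Suc_eq_le)
  moreover have "card A \<le> card (saws_from H v (Suc n))"
  proof (rule card_inj_on_le[of "(#) v"])
    show "(#) v ` A \<subseteq> saws_from H v (Suc n)"
      using uv simple_graphD[OF simple uv]
      by (auto simp: A_def saws_from_def walk_Cons_iff insert_commute)
  qed (auto simp: finite_saws)
  moreover have "card (B k) \<le> card (saws_from H v k) * card (saws_from H v (n - k))" if k: "k \<le> n" for k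
    unfolding card_cartesian_product[symmetric]
  proof (rule card_inj_on_le[of "\<lambda>p. (rev (take (Suc k) p), drop k p)"])
    show "(\<lambda>p. (rev (take (Suc k) p), drop k p)) ` B k \<subseteq> saws_from H v k \<times> saws_from H v (n - k)"
    proof
      fix z assume "z \<in> (\<lambda>p. (rev (take (Suc k) p), drop k p)) ` B k"
      then obtain p where p: "z = (rev (take (Suc k) p), drop k p)" "p \<in> saws_from H u n" "p ! k = v"
        by (auto simp: B_def)
      have "last (take (Suc k) p) = v"
        using p k by (simp add: saws_from_def take_Suc_conv_app_nth)
      hence "rev (take (Suc k) p) \<in> saws_from H v k"
        using saws_take[OF p(2) k] by (simp add: saws_from_def walk_rev hd_rev)
      thus "z \<in> saws_from H v k \<times> saws_from H v (n - k)" using p saws_drop[OF p(2) k] by simp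
    qed
    show "inj_on (\<lambda>p. (rev (take (Suc k) p), drop k p)) (B k)"
      by (intro inj_onI) (auto dest: eq_if_take_Suc_drop_eq)
  qed (simp add: finite_saws)
  ultimately have "card (saws_from H u n) \<le>
      card (saws_from H v (Suc n)) + (\<Sum>k\<le>n. card (saws_from H v k) * card (saws_from H v (n - k)))"
    using card_Un_le[of A "\<Union>k\<le>n. B k"] card_UN_le[of "{..n}" B]
      sum_mono[of "{..n}" "\<lambda>k. card (B k)" "\<lambda>k. card (saws_from H v k) * card (saws_from H v (n - k))"]
    by simp
  hence "real (card (saws_from H u n)) \<le>
      real (card (saws_from H v (Suc n)) + (\<Sum>k\<le>n. card (saws_from H v k) * card (saws_from H v (n - k))))"
    by (rule of_nat_mono)
  thus ?thesis by (simp add: saw_count_def)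
qed


text \<open>The walks are counted from a vertex \<open>f n\<close> that may depend on the length scale \<open>n\<close>, because
  the vertex with the largest number of walks does.\<close>

definition grows_at_rate :: "real \<Rightarrow> (nat \<Rightarrow> 'a) \<Rightarrow> nat \<Rightarrow> bool" where
  "grows_at_rate \<mu> f c \<longleftrightarrow> (\<forall>\<delta>>0. \<exists>K>0. \<forall>n m. m * c \<le> n \<longrightarrow> \<mu> ^ m \<le> K * (1 + \<delta>) ^ n * saw_count (f n) m)"

text \<open>Cutting a walk at its visit to a neighbour \<open>v\<close> of its start gives two walks from \<open>v\<close>; the
  longer one has at least half the length, so growth passes to \<open>v\<close> at half the length scale.\<close>

lemma grows_at_rate_neighbour:
  assumes \<mu>: "\<mu> \<ge> 1" and up: "\<And>\<delta>. \<delta> > 0 \<Longrightarrow> \<exists>C\<ge>1. \<forall>n. max_saw_count n \<le> C * ((1 + \<delta>) * \<mu>) ^ n"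
    and f: "grows_at_rate \<mu> f c" and c: "c \<ge> 1" and fg: "\<And>n. f n = g n \<or> {f n, g n} \<in> edges H"
    and g: "\<And>n. g n \<in> verts H"
  shows "grows_at_rate \<mu> g (2 * c)"
  unfolding grows_at_rate_def
proof (intro allI impI)
  fix \<delta> :: real assume \<delta>: "\<delta> > 0"
  \<comment> \<open>Three factors \<open>(1 + \<epsilon>) ^ n\<close> will be lost: one in the
    growth at \<open>f n\<close>, one in passing from \<open>l\<close> to \<mu>, one in bounding the
    number of terms.\<close>
  define \<epsilon> where "\<epsilon> = root 3 (1 + \<delta>) - 1"
  have \<epsilon>: "\<epsilon> > 0" "(1 + \<epsilon>) ^ 3 = 1 + \<delta>" using \<delta> by (simp_all add: \<epsilon>_def)
  obtain C where C: "C \<ge> 1" "\<And>n. max_saw_count n \<le> C * ((1 + \<epsilon>) * \<mu>) ^ n" using up[OF \<epsilon>(1)] by blast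
  obtain K where K: "K > 0" "\<And>n m. m * c \<le> n \<Longrightarrow> \<mu> ^ m \<le> K * (1 + \<epsilon>) ^ n * saw_count (f n) m"
    using f \<epsilon>(1) unfolding grows_at_rate_def by blast
  define l where "l = (1 + \<epsilon>) * \<mu>"
  have l: "l \<ge> 1" using \<epsilon> \<mu> by (auto simp: l_def distrib_right intro: order_trans)
  \<comment> \<open>Collects the constants of the final estimate; the cube of
    \<open>1 + \<epsilon>\<close> comes from the exponents \<open>n + 2\<close> and
    \<open>n + 1\<close> there.\<close>
  define K' where "K' = K * C\<^sup>2 * \<mu> * (1 + \<epsilon>) ^ 3 / \<epsilon>"
  have "K' > 0" unfolding K'_def using K C \<mu> \<epsilon> \<delta> by (intro divide_pos_pos mult_pos_pos) auto
  have "\<mu> ^ m \<le> (K + K') * (1 + \<delta>) ^ n * saw_count (g n) m" if mn: "m * (2 * c) \<le> n" for n m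
  proof -
    let ?v = "g n" and ?u = "f n"
    have s1: "saw_count ?v m \<ge> 1" using saw_count_ge_1[OF g] .
    have "1 + \<epsilon> \<le> (1 + \<epsilon>) ^ 3" using \<epsilon>(1) power_increasing[of 1 3 "1 + \<epsilon>"] by simp
    hence pw: "(1 + \<epsilon>) ^ n \<le> (1 + \<delta>) ^ n" using \<epsilon> by (intro power_mono) auto
    show ?thesis
    proof (cases "?u = ?v")
      case True
      have "\<mu> ^ m \<le> K * (1 + \<epsilon>) ^ n * saw_count ?v m" using K(2)[of m n] mn True by simp
      also have "\<dots> \<le> (K + K') * (1 + \<delta>) ^ n * saw_count ?v m"
        using pw s1 K(1) \<open>K' > 0\<close> \<epsilon> by (intro mult_right_mono mult_mono) auto
      finally show ?thesis .
    next
      case False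
      \<comment> \<open>The largest length at which the growth at \<open>f n\<close> is available on
        the scale \<open>n\<close>. It is at least \<open>2 * m\<close>, so cutting such a walk in
        two leaves a part with at least \<open>m\<close> steps.\<close>
      define N where "N = n div c"
      have N: "N * c \<le> n" "2 * m \<le> N" "N \<le> n"
        using mn c by (auto simp: N_def less_eq_div_iff_mult_less_eq algebra_simps)
      \<comment> \<open>A common bound for all \<open>N + 2\<close> terms of the neighbour estimate:
        the part with at least \<open>m\<close> steps is cut once more after \<open>m\<close> steps,
        and everything else is bounded by powers of \<open>l\<close>.\<close>
      define T where "T = saw_count ?v m * C\<^sup>2 * l ^ (Suc N - m)"
      have split: "saw_count ?v k \<le> saw_count ?v m * (C * l ^ (k - m))" if "m \<le> k" for k
      proof -
        have "saw_count ?v k \<le> saw_count ?v m * max_saw_count (k - m)"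
          using saw_count_add_le[of ?v m "k - m"] that by simp
        also have "\<dots> \<le> saw_count ?v m * (C * l ^ (k - m))"
          using C(2)[of "k - m"] s1 by (intro mult_left_mono) (auto simp: l_def)
        finally show ?thesis .
      qed
      have bound: "saw_count ?v k \<le> C * l ^ k" for k
        using saw_count_le_max[OF g, of n k] C(2)[of k] by (simp add: l_def)
      have prod: "saw_count ?v k * saw_count ?v (N - k) \<le> T" if "m \<le> k" "k \<le> N" for k
      proof -
        have "saw_count ?v k * saw_count ?v (N - k) \<le> saw_count ?v m * (C * l ^ (k - m)) * (C * l ^ (N - k))"
          using split[OF that(1)] bound[of "N - k"] s1 C l by (intro mult_mono) (auto simp: saw_count_def)
        also have "\<dots> = saw_count ?v m * C\<^sup>2 * l ^ (N - m)"
          using that by (simp add: power2_eq_square power_add[symmetric])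
        also have "\<dots> \<le> T" unfolding T_def
          using l s1 C by (intro mult_left_mono power_increasing) auto
        finally show ?thesis .
      qed
      have "saw_count ?v k * saw_count ?v (N - k) \<le> T" if "k \<le> N" for k
      proof (cases "m \<le> k")
        case False
        hence "m \<le> N - k" "N - (N - k) = k" using N that by auto
        thus ?thesis using prod[of "N - k"] by (simp add: mult.commute)
      qed (use prod that in auto)
      hence "(\<Sum>k\<le>N. saw_count ?v k * saw_count ?v (N - k)) \<le> (\<Sum>k\<le>N. T)" by (intro sum_mono) auto
      moreover have "saw_count ?v (Suc N) \<le> T"
      proof -
        have "saw_count ?v (Suc N) \<le> saw_count ?v m * (C * l ^ (Suc N - m))" using split[of "Suc N"] N by simp
        also have "\<dots> \<le> T" unfolding T_def power2_eq_square
          using C l s1 by (simp add: mult_left_mono mult_right_mono mult.assoc)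
        finally show ?thesis .
      qed
      moreover have "saw_count ?u N \<le> saw_count ?v (Suc N) + (\<Sum>k\<le>N. saw_count ?v k * saw_count ?v (N - k))"
        using saw_count_neighbour_le fg[of n] False by blast
      ultimately have sT: "saw_count ?u N \<le> real (N + 2) * T" by (simp add: algebra_simps)
      have "\<mu> ^ m * \<mu> ^ (Suc N - m) = \<mu> * \<mu> ^ N" using N by (simp flip: power_add)
      also have "\<mu> ^ N \<le> K * (1 + \<epsilon>) ^ n * (real (N + 2) * T)"
        using K(2)[OF N(1)] sT K(1) \<epsilon> by (auto elim!: order_trans intro!: mult_left_mono)
      finally have "\<mu> ^ m * \<mu> ^ (Suc N - m) \<le> \<mu> * (K * (1 + \<epsilon>) ^ n * (real (N + 2) * T))"
        using \<mu> by simp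
      also have "T = saw_count ?v m * C\<^sup>2 * (1 + \<epsilon>) ^ (Suc N - m) * \<mu> ^ (Suc N - m)"
        by (simp add: T_def l_def power_mult_distrib)
      finally have "\<mu> ^ m \<le> \<mu> * (K * (1 + \<epsilon>) ^ n * (real (N + 2) * (saw_count ?v m * C\<^sup>2 * (1 + \<epsilon>) ^ (Suc N - m))))"
        (is "_ \<le> ?R") using \<mu> mult_le_cancel_right_pos[of "\<mu> ^ (Suc N - m)" "\<mu> ^ m" ?R]
        by (simp add: mult.assoc)
      also have "\<dots> \<le> \<mu> * (K * (1 + \<epsilon>) ^ n * ((1 + \<epsilon>) ^ (n + 2) / \<epsilon> * (saw_count ?v m * C\<^sup>2 * (1 + \<epsilon>) ^ Suc n)))"
      proof -
        \<comment> \<open>Bernoulli's inequality turns the linear number of terms into one more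
          factor that is exponential with a rate close to 1.\<close>
        have "1 + real (n + 2) * \<epsilon> \<le> (1 + \<epsilon>) ^ (n + 2)" using \<epsilon> by (intro Bernoulli_inequality) auto
        hence "real (n + 2) \<le> (1 + \<epsilon>) ^ (n + 2) / \<epsilon>" using \<epsilon> by (simp add: pos_le_divide_eq)
        moreover have "real (N + 2) \<le> real (n + 2)" using N by simp
        ultimately have "real (N + 2) \<le> (1 + \<epsilon>) ^ (n + 2) / \<epsilon>" by linarith
        moreover have "(1 + \<epsilon>) ^ (Suc N - m) \<le> (1 + \<epsilon>) ^ Suc n" using \<epsilon> N by (intro power_increasing) auto
        ultimately show ?thesis using \<mu> K C \<epsilon> s1
          by (intro mult_left_mono[of _ _ \<mu>] mult_left_mono[of _ _ "K * (1 + \<epsilon>) ^ n"] mult_mono mult_nonneg_nonneg) auto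
      qed
      also have "\<dots> = K' * ((1 + \<epsilon>) ^ n) ^ 3 * saw_count ?v m"
        unfolding K'_def by (simp add: power_add power2_eq_square power3_eq_cube mult_ac)
      also have "((1 + \<epsilon>) ^ n) ^ 3 = (1 + \<delta>) ^ n" using \<epsilon>(2) by (metis mult.commute power_mult)
      also have "K' * (1 + \<delta>) ^ n * saw_count ?v m \<le> (K + K') * (1 + \<delta>) ^ n * saw_count ?v m"
        using K(1) \<delta> s1 by (intro mult_right_mono) auto
      finally show ?thesis .
    qed
  qed
  thus "\<exists>K>0. \<forall>n m. m * (2 * c) \<le> n \<longrightarrow> \<mu> ^ m \<le> K * (1 + \<delta>) ^ n * saw_count (g n) m"
    using K(1) \<open>K' > 0\<close> by (intro exI[of _ "K + K'"]) auto
qed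

text \<open>Fekete's argument for the maximal counts gives the upper bound at every vertex. For the
  lower bound, the maximizing vertex lies in the finite set \<open>W\<close>, so a path from it to
  \<open>v\<close> has bounded length, and each edge of that path halves the usable length scale. As
  growth is estimated up to \<open>(1 + \<delta>) ^ n\<close> with arbitrary \<delta>, a fixed scale
  factor \<open>c\<close> does not affect the limit.\<close>

theorem saw_count_root_tendsto:
  obtains \<mu> where "\<mu> \<ge> 1" "\<And>v. v \<in> verts H \<Longrightarrow> (\<lambda>n. root n (saw_count v n)) \<longlonglongrightarrow> \<mu>"
proof -
  have "max_saw_count (m + n) \<le> max_saw_count m * max_saw_count n" for m n
  proof -
    obtain v where v: "v \<in> verts H" "saw_count v (m + n) = max_saw_count (m + n)"
      using max_saw_count_in_verts by blast
    have "saw_count v m * max_saw_count n \<le> max_saw_count m * max_saw_count n"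
      using saw_count_le_max[OF v(1), of m] max_saw_count_ge_1[of n] by (intro mult_right_mono) auto
    thus ?thesis using saw_count_add_le[of v m n] v by simp
  qed
  then obtain \<mu> where \<mu>: "\<mu> \<ge> 1" "\<And>n. \<mu> ^ n \<le> max_saw_count n"
    and up: "\<And>\<delta>. \<delta> > 0 \<Longrightarrow> \<exists>C\<ge>1. \<forall>n. max_saw_count n \<le> C * ((1 + \<delta>) * \<mu>) ^ n"
    using submultiplicative_growth[of max_saw_count] max_saw_count_ge_1 by metis
  obtain W where W: "fundamental_domain H \<Gamma> W" using qt by (auto simp: quasi_transitive_def)
  hence W': "finite W" "W \<subseteq> verts H" by (auto simp: fundamental_domain_def)
  obtain w where w: "\<And>n. w n \<in> W" "\<And>n. saw_count (w n) n = max_saw_count n"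
    using max_saw_count_attained(1)[OF W] by metis
  \<comment> \<open>If \<open>w n\<close> had few walks of length \<open>m \<le> n\<close>, the
    upper bound for the remaining \<open>n - m\<close> steps would leave too few walks of length
    \<open>n\<close>.\<close>
  have grow0: "grows_at_rate \<mu> w 1"
    unfolding grows_at_rate_def
  proof (intro allI impI)
    fix \<delta> :: real assume \<delta>: "\<delta> > 0"
    obtain C where C: "C \<ge> 1" "\<And>n. max_saw_count n \<le> C * ((1 + \<delta>) * \<mu>) ^ n" using up[OF \<delta>] by blast
    have "\<mu> ^ m \<le> C * (1 + \<delta>) ^ n * saw_count (w n) m" if "m \<le> n" for m n
    proof -
      have s1: "saw_count (w n) m \<ge> 1" using saw_count_ge_1 w W' by blast
      have "\<mu> ^ m * \<mu> ^ (n - m) = \<mu> ^ n" using that by (simp flip: power_add)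
      also have "\<dots> \<le> saw_count (w n) n" using \<mu> w by simp
      also have "\<dots> \<le> saw_count (w n) m * max_saw_count (n - m)"
        using saw_count_add_le[of "w n" m "n - m"] that by simp
      also have "\<dots> \<le> saw_count (w n) m * (C * ((1 + \<delta>) ^ n * \<mu> ^ (n - m)))"
      proof -
        have "C * ((1 + \<delta>) * \<mu>) ^ (n - m) \<le> C * ((1 + \<delta>) ^ n * \<mu> ^ (n - m))"
          unfolding power_mult_distrib using \<delta> C \<mu>
          by (intro mult_left_mono mult_right_mono power_increasing) auto
        thus ?thesis using C(2)[of "n - m"] s1 by (intro mult_left_mono) auto
      qed
      finally have "\<mu> ^ m * \<mu> ^ (n - m) \<le> (C * (1 + \<delta>) ^ n * saw_count (w n) m) * \<mu> ^ (n - m)"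
        by (simp add: mult_ac)
      thus ?thesis using \<mu>(1) by (simp add: mult_le_cancel_right_pos)
    qed
    thus "\<exists>K>0. \<forall>n m. m * 1 \<le> n \<longrightarrow> \<mu> ^ m \<le> K * (1 + \<delta>) ^ n * saw_count (w n) m"
      using C(1) by (intro exI[of _ C]) auto
  qed
  have grow: "\<exists>c\<ge>1. grows_at_rate \<mu> (\<lambda>_. v) c" if v: "v \<in> verts H" for v
  proof -
    have "\<forall>x\<in>W. \<exists>p. walk H p \<and> hd p = x \<and> last p = v"
      using conn v W' unfolding graph_connected_def by blast
    then obtain P where P: "\<And>x. x \<in> W \<Longrightarrow> walk H (P x) \<and> hd (P x) = x \<and> last (P x) = v" by metis
    \<comment> \<open>The index stops at the last vertex, so that paths of different lengths can be
      followed for one common number of steps.\<close>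
    define f where "f i n = P (w n) ! min i (length (P (w n)) - 1)" for i n
    have Pw: "P (w n) \<noteq> []" "walk H (P (w n))" for n using P[OF w(1)[of n]] by (auto simp: walk_def)
    have fv: "f i n \<in> verts H" for i n
    proof -
      have "f i n \<in> set (P (w n))" unfolding f_def using Pw(1)[of n] by (intro nth_mem) (cases "P (w n)", auto)
      thus ?thesis using Pw(2)[of n] by (auto simp: walk_def)
    qed
    have step: "f i n = f (Suc i) n \<or> {f i n, f (Suc i) n} \<in> edges H" for i n
    proof (cases "Suc i < length (P (w n))")
      case True
      thus ?thesis using Pw(2)[of n] by (auto simp: f_def walk_def min_def dest!: successively_nth)
    next
      case False
      hence "min i (length (P (w n)) - 1) = min (Suc i) (length (P (w n)) - 1)" by simp
      thus ?thesis by (simp add: f_def)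
    qed
    have "f 0 = w" using P[OF w(1)] Pw(1) by (auto simp: f_def hd_conv_nth fun_eq_iff)
    hence "grows_at_rate \<mu> (f i) (2 ^ i)" for i
    proof (induction i)
      case (Suc i)
      show ?case using grows_at_rate_neighbour[OF \<mu>(1) up Suc.IH[OF Suc.prems], of "f (Suc i)"] step fv by simp
    qed (use grow0 in simp)
    moreover have "f (Max ((\<lambda>x. length (P x)) ` W)) = (\<lambda>_. v)"
    proof
      fix n
      have "length (P (w n)) \<le> Max ((\<lambda>x. length (P x)) ` W)" using W' w by (intro Max_ge) auto
      hence "f (Max ((\<lambda>x. length (P x)) ` W)) n = last (P (w n))"
        using Pw(1)[of n] by (simp add: f_def last_conv_nth min_absorb2)
      thus "f (Max ((\<lambda>x. length (P x)) ` W)) n = v" using P[OF w(1)] by simp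
    qed
    ultimately show ?thesis by (metis one_le_numeral one_le_power)
  qed
  have "(\<lambda>n. root n (saw_count v n)) \<longlonglongrightarrow> \<mu>" if v: "v \<in> verts H" for v
  proof (rule order_tendstoI)
    fix b assume b: "\<mu> < b"
    define \<delta> where "\<delta> = (b / \<mu> - 1) / 2"
    have \<delta>: "\<delta> > 0" "(1 + \<delta>) * \<mu> < b" using b \<mu> by (auto simp: \<delta>_def field_simps)
    obtain C where C: "C \<ge> 1" "\<And>n. max_saw_count n \<le> C * ((1 + \<delta>) * \<mu>) ^ n" using up[OF \<delta>(1)] by blast
    have "(\<lambda>n. root n C * ((1 + \<delta>) * \<mu>)) \<longlonglongrightarrow> 1 * ((1 + \<delta>) * \<mu>)"
      using C by (intro tendsto_mult LIMSEQ_root_const) auto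
    hence "eventually (\<lambda>n. root n C * ((1 + \<delta>) * \<mu>) < b) sequentially" using \<delta> by (intro order_tendstoD) auto
    thus "eventually (\<lambda>n. root n (saw_count v n) < b) sequentially"
      using eventually_gt_at_top[of 0]
    proof eventually_elim
      case (elim n)
      have "root n (saw_count v n) \<le> root n (C * ((1 + \<delta>) * \<mu>) ^ n)"
        using C(2)[of n] saw_count_le_max[OF v, of n] elim by (intro real_root_le_mono) auto
      also have "\<dots> = root n C * ((1 + \<delta>) * \<mu>)"
        using elim \<delta> \<mu> by (simp add: real_root_mult real_root_power_cancel)
      finally show ?case using elim by simp
    qed
  next
    fix b assume b: "b < \<mu>"
    obtain c where c: "c \<ge> 1" "grows_at_rate \<mu> (\<lambda>_. v) c" using grow[OF v] by blast
    \<comment> \<open>The maximum keeps \<open>a\<close> positive when \<open>b\<close> is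
      not.\<close>
    define a where "a = max b (\<mu> / 2)"
    have a: "a > 0" "b \<le> a" "a < \<mu>" using b \<mu> by (auto simp: a_def)
    define \<rho> where "\<rho> = (1 + \<mu> / a) / 2"
    have \<rho>: "\<rho> > 1" "\<rho> < \<mu> / a" using a by (auto simp: \<rho>_def field_simps)
    \<comment> \<open>Chosen so that the loss on the length scale \<open>n * c\<close> is exactly
      \<open>\<rho> ^ n\<close>.\<close>
    define \<delta> where "\<delta> = root c \<rho> - 1"
    have \<delta>: "\<delta> > 0" "(1 + \<delta>) ^ c = \<rho>" using \<rho> c by (simp_all add: \<delta>_def)
    obtain K where K: "K > 0" "\<And>n m. m * c \<le> n \<Longrightarrow> \<mu> ^ m \<le> K * (1 + \<delta>) ^ n * saw_count v m"
      using c(2) \<delta>(1) unfolding grows_at_rate_def by blast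
    have "a < \<mu> / \<rho>" using \<rho> a by (simp add: field_simps)
    have "(\<lambda>n. root n (1 / K) * (\<mu> / \<rho>)) \<longlonglongrightarrow> 1 * (\<mu> / \<rho>)"
      using K by (intro tendsto_mult LIMSEQ_root_const) auto
    hence "eventually (\<lambda>n. root n (1 / K) * (\<mu> / \<rho>) > a) sequentially"
      using \<open>a < \<mu> / \<rho>\<close> by (intro order_tendstoD) auto
    thus "eventually (\<lambda>n. b < root n (saw_count v n)) sequentially"
      using eventually_gt_at_top[of 0]
    proof eventually_elim
      case (elim n)
      have "\<mu> ^ n \<le> K * \<rho> ^ n * saw_count v n"
        using K(2)[of n "n * c"] \<delta>(2) by (simp add: power_mult[symmetric] mult.commute[of n c])
          (simp add: power_mult)
      hence "1 / K * (\<mu> / \<rho>) ^ n \<le> saw_count v n" using K \<rho> by (simp add: field_simps power_divide)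
      hence "root n (1 / K * (\<mu> / \<rho>) ^ n) \<le> root n (saw_count v n)" using elim by (intro real_root_le_mono) auto
      moreover have "root n (1 / K * (\<mu> / \<rho>) ^ n) = root n (1 / K) * (\<mu> / \<rho>)"
        unfolding real_root_mult using elim \<rho> \<mu> by (subst real_root_power_cancel) auto
      ultimately show ?case using elim a by linarith
    qed
  qed
  thus ?thesis using that \<mu>(1) by blast
qed

section \<open>The connective constant as a radius of convergence\<close>

lemma connective_constant_ge_1: "connective_constant H \<ge> 1"
  and saw_count_root_tendsto_connective_constant:
    "v \<in> verts H \<Longrightarrow> (\<lambda>n. root n (saw_count v n)) \<longlonglongrightarrow> connective_constant H"
proof -
  obtain \<mu> where \<mu>: "\<mu> \<ge> 1" "\<And>v. v \<in> verts H \<Longrightarrow> (\<lambda>n. root n (saw_count v n)) \<longlonglongrightarrow> \<mu>"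
    using saw_count_root_tendsto by blast
  have "connective_constant H = \<mu>"
    unfolding connective_constant_def
  proof (rule the_equality)
    fix \<mu>' assume "\<forall>v\<in>verts H. (\<lambda>n. root n (real (card (saws_from H v n)))) \<longlonglongrightarrow> \<mu>'"
    thus "\<mu>' = \<mu>" using \<mu>(2) verts_nonempty LIMSEQ_unique unfolding saw_count_def by blast
  qed (use \<mu>(2) in \<open>auto simp: saw_count_def\<close>)
  with \<mu> show "connective_constant H \<ge> 1"
    "v \<in> verts H \<Longrightarrow> (\<lambda>n. root n (saw_count v n)) \<longlonglongrightarrow> connective_constant H" by auto
qed

text \<open>The threshold \<open>n \<ge> 2\<close> ensures that the vertex list of such a walk can
  also be read as a mid-edge walk of positive length.\<close>

lemma saw_count_unbounded_above_radius:
  assumes "v \<in> verts H" "x > 1 / connective_constant H"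
  shows "\<exists>n\<ge>2. saw_count v n * x ^ n \<ge> b"
proof -
  let ?\<mu> = "connective_constant H"
  have "0 < 1 / ?\<mu>" using connective_constant_ge_1 by simp
  hence "x > 0" using assms(2) by linarith
  hence x: "x > 0" "1 / x < ?\<mu>"
    using assms(2) connective_constant_ge_1 by (auto simp: field_simps)
  then obtain a where a: "1 / x < a" "a < ?\<mu>" using dense by blast
  hence "a * x > 1" "a > 0" using x by (auto simp: field_simps intro: order_less_trans[of 0 "1 / x"])
  then obtain N where N: "b < (a * x) ^ N" using real_arch_pow by blast
  have "eventually (\<lambda>n. a < root n (saw_count v n)) sequentially"
    using saw_count_root_tendsto_connective_constant[OF assms(1)] a(2) by (rule order_tendstoD)
  then obtain M where M: "\<And>n. n \<ge> M \<Longrightarrow> a < root n (saw_count v n)" by (auto simp: eventually_sequentially)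
  define n where "n = max 2 (max M N)"
  have "a ^ n \<le> root n (saw_count v n) ^ n" using M[of n] \<open>a > 0\<close> by (intro power_mono) (auto simp: n_def intro!: less_imp_le)
  hence "a ^ n \<le> saw_count v n" using saw_count_ge_1[OF assms(1), of n] by (simp add: n_def)
  hence "(a * x) ^ n \<le> saw_count v n * x ^ n" unfolding power_mult_distrib using x by (intro mult_right_mono) auto
  moreover have "(a * x) ^ N \<le> (a * x) ^ n" using \<open>a * x > 1\<close> by (intro power_increasing) (auto simp: n_def)
  ultimately show ?thesis using N by (intro exI[of _ n]) (auto simp: n_def)
qed

lemma saw_count_summable_below_radius:
  assumes "v \<in> verts H" "0 < x" "x < 1 / connective_constant H"
  shows "summable (\<lambda>n. saw_count v n * x ^ n)"
proof -
  let ?\<mu> = "connective_constant H"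
  have "?\<mu> < 1 / x" using assms connective_constant_ge_1 by (auto simp: field_simps)
  then obtain a where a: "?\<mu> < a" "a < 1 / x" using dense by blast
  hence a': "a * x < 1" "a > 0" using assms connective_constant_ge_1 by (auto simp: field_simps)
  have "eventually (\<lambda>n. root n (saw_count v n) < a) sequentially"
    using saw_count_root_tendsto_connective_constant[OF assms(1)] a(1) by (rule order_tendstoD)
  hence ev: "eventually (\<lambda>n. norm (saw_count v n * x ^ n) \<le> (a * x) ^ n) sequentially"
    using eventually_gt_at_top[of 0]
  proof eventually_elim
    case (elim n)
    have "saw_count v n = root n (saw_count v n) ^ n" using elim saw_count_ge_1[OF assms(1), of n] by simp
    also have "\<dots> \<le> a ^ n" using elim saw_count_ge_1[OF assms(1), of n] by (intro power_mono) auto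
    finally show ?case using assms(2) saw_count_ge_1[OF assms(1), of n] by (simp add: power_mult_distrib)
  qed
  show ?thesis by (rule summable_comparison_test_ev[OF ev]) (use a' assms in \<open>simp add: summable_geometric\<close>)
qed

end


section \<open>Projecting walks from the Fisher graph\<close>

text \<open>A repetition \<open>x, x\<close> contributes the degenerate pair \<open>{x, x}\<close>,
  of cardinality 1; these are exactly the entries that disappear.\<close>

lemma path_edges_remdups_adj: "path_edges (remdups_adj xs) = filter (\<lambda>e. card e = 2) (path_edges xs)"
proof (induction xs rule: remdups_adj.induct)
  case (3 x y xs)
  show ?case
  proof (cases "x = y")
    case False
    have "remdups_adj (y # xs) = y # tl (remdups_adj (y # xs))" by simp
    hence "path_edges (remdups_adj (x # y # xs)) = {x, y} # path_edges (remdups_adj (y # xs))"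
      using False by (metis path_edges.simps(3) remdups_adj.simps(3))
    thus ?thesis using 3 False by simp
  qed (use 3 in simp)
qed auto

text \<open>A cut of the collapsed list falls between two different entries, so it comes from a cut
  of the original list. This cuts walks on the Fisher graph into blocks with constant base.\<close>

lemma remdups_adj_split:
  "remdups_adj l = xs @ ys \<Longrightarrow> xs \<noteq> [] \<Longrightarrow> ys \<noteq> [] \<Longrightarrow>
     \<exists>l1 l2. l = l1 @ l2 \<and> remdups_adj l1 = xs \<and> remdups_adj l2 = ys"
proof (induction l arbitrary: xs)
  case (Cons a l)
  show ?case
  proof (cases "l \<noteq> [] \<and> a = hd l")
    case True
    hence "remdups_adj (a # l) = remdups_adj l" by (cases l) auto
    with Cons obtain l1 l2 where l: "l = l1 @ l2" "remdups_adj l1 = xs" "remdups_adj l2 = ys"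
      by (metis (no_types, lifting))
    hence "l1 \<noteq> []" using Cons.prems by auto
    hence "remdups_adj (a # l1) = xs" using l True by (cases l1) auto
    thus ?thesis using l by (intro exI[of _ "a # l1"] exI[of _ l2]) auto
  next
    case False
    hence r: "remdups_adj (a # l) = a # remdups_adj l" by (cases l) auto
    then obtain xs' where xs: "xs = a # xs'" "remdups_adj l = xs' @ ys"
      using Cons.prems by (cases xs) auto
    show ?thesis
    proof (cases "xs' = []")
      case True
      thus ?thesis using xs by (intro exI[of _ "[a]"] exI[of _ l]) auto
    next
      case xs': False
      with Cons.IH[OF xs(2)] Cons.prems obtain l1 l2
        where l: "l = l1 @ l2" "remdups_adj l1 = xs'" "remdups_adj l2 = ys" by auto
      hence "l1 \<noteq> []" using xs' by auto
      hence "remdups_adj (a # l1) = xs" using l False xs by (cases l1) auto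
      thus ?thesis using l by (intro exI[of _ "a # l1"] exI[of _ l2]) auto
    qed
  qed
qed simp

fun base :: "'a fisher_vertex \<Rightarrow> 'a" where
  "base (Keep u) = u"
| "base (Tri v u) = v"

text \<open>Steps inside a triangle become repetitions under \<open>base\<close>, and
  \<open>remdups_adj\<close> removes them.\<close>

definition proj :: "'a fisher_vertex list \<Rightarrow> 'a list" where
  "proj q = remdups_adj (map base q)"

lemma proj_split:
  assumes "proj q = xs @ ys" "xs \<noteq> []" "ys \<noteq> []"
  obtains q1 q2 where "q = q1 @ q2" "proj q1 = xs" "proj q2 = ys"
  using remdups_adj_split[OF assms[unfolded proj_def]] that
  by (auto simp: map_eq_append_conv proj_def)

lemma proj_eq_Nil_iff [simp]: "proj q = [] \<longleftrightarrow> q = []"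
  by (simp add: proj_def)

lemma set_proj: "set (proj q) = base ` set q"
  by (simp add: proj_def)

lemma hd_proj: "q \<noteq> [] \<Longrightarrow> hd (proj q) = base (hd q)"
  by (simp add: proj_def hd_map)

lemma last_proj: "q \<noteq> [] \<Longrightarrow> last (proj q) = base (last q)"
  by (simp add: proj_def last_map)

lemma proj_rev: "proj (rev q) = rev (proj q)"
  by (simp add: proj_def flip: rev_map)

lemma length_proj_le: "length (proj q) \<le> length q"
  using remdups_adj_length[of "map base q"] by (simp add: proj_def)

text \<open>Only an inclusion, since the first edge of \<open>q\<close> may lie inside a triangle
  and then collapses to one end of the first edge of the projection.\<close>

lemma base_first_edge:
  assumes "length q \<ge> 2" "length (proj q) \<ge> 2"
  shows "base ` hd (path_edges q) \<subseteq> hd (path_edges (proj q))"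
proof -
  obtain a b q' where q: "q = a # b # q'" using assms(1) by (cases q rule: path_edges.cases) auto
  have "hd (proj q) = base a" using hd_proj[of q] q by simp
  moreover have "hd (tl (proj q)) = base b" if "base b \<noteq> base a"
  proof -
    have "proj q = base a # proj (b # q')" using that unfolding q proj_def by simp
    thus ?thesis using hd_proj[of "b # q'"] by simp
  qed
  moreover have "hd (path_edges q) = {a, b}" using q by simp
  ultimately show ?thesis unfolding hd_path_edges[OF assms(2)] by (cases "base b = base a") auto
qed

lemma base_last_edge:
  assumes "length q \<ge> 2" "length (proj q) \<ge> 2"
  shows "base ` last (path_edges q) \<subseteq> last (path_edges (proj q))"
  using base_first_edge[of "rev q"] assms by (simp add: proj_rev path_edges_rev hd_rev)

locale fisher_setting = qt_graph G "coloured_automorphisms G B" for G :: "'a ugraph" and B +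
  assumes bip: "bipartite_colouring G B" and deg3: "\<And>v. v \<in> B \<Longrightarrow> vertex_degree G v = 3"
begin

abbreviation F where "F \<equiv> fisher G B"

text \<open>The endpoint at \<open>v\<close> of the edge that replaces \<open>{v, u}\<close>; this
  treats both colours of \<open>v\<close> alike.\<close>

definition edge_end :: "'a \<Rightarrow> 'a \<Rightarrow> 'a fisher_vertex" where
  "edge_end v u = (if v \<in> B then Tri v u else Keep v)"

lemma base_edge_end [simp]: "base (edge_end v u) = v"
  by (simp add: edge_end_def)

lemma black_iff: "{u, v} \<in> edges G \<Longrightarrow> u \<in> B \<longleftrightarrow> v \<notin> B"
  using bip by (simp add: bipartite_colouring_def)

lemma B_verts: "B \<subseteq> verts G"
  using bip by (simp add: bipartite_colouring_def)

lemma card_nbrs_black: "v \<in> B \<Longrightarrow> card (nbrs G v) = 3"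
  using deg3 by (simp add: card_nbrs simple)

lemma Keep_in_fisher [simp]: "Keep u \<in> verts F \<longleftrightarrow> u \<in> verts G \<and> u \<notin> B"
  and Tri_in_fisher [simp]: "Tri v u \<in> verts F \<longleftrightarrow> v \<in> B \<and> u \<in> nbrs G v"
  using B_verts by (auto simp: fisher_def fisher_verts_def nbrs_def)

lemma fisher_edge_cases:
  assumes "{a, b} \<in> edges F"
  obtains (orig) "base a \<noteq> base b" "{base a, base b} \<in> edges G"
      "a = edge_end (base a) (base b)" "b = edge_end (base b) (base a)"
    | (tri) v s t where "v \<in> B" "s \<in> nbrs G v" "t \<in> nbrs G v" "s \<noteq> t" "a = Tri v s" "b = Tri v t"
proof -
  from assms consider v u where "v \<in> B" "{v, u} \<in> edges G" "{a, b} = {Tri v u, Keep u}"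
    | v s t where "v \<in> B" "s \<in> nbrs G v" "t \<in> nbrs G v" "s \<noteq> t" "{a, b} = {Tri v s, Tri v t}"
    by (auto simp: fisher_def nbrs_def)
  thus thesis
  proof cases
    case 1
    have "u \<notin> B" "u \<noteq> v" using 1 black_iff[of v u] simple_graphD(1)[OF simple 1(2)] by auto
    thus ?thesis using 1 orig by (auto simp: doubleton_eq_iff edge_end_def insert_commute)
  next
    case 2
    thus ?thesis using tri by (auto simp: doubleton_eq_iff)
  qed
qed

lemma orig_edge: "{v, u} \<in> edges G \<Longrightarrow> {edge_end v u, edge_end u v} \<in> edges F"
proof -
  have orig: "{Tri v u, Keep u} \<in> edges F" if "v \<in> B" "{v, u} \<in> edges G" for v u
    using that by (auto simp: fisher_def)
  assume "{v, u} \<in> edges G"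
  thus ?thesis using black_iff[of v u] orig[of v u] orig[of u v]
    by (auto simp: edge_end_def insert_commute)
qed

lemma tri_edge: "v \<in> B \<Longrightarrow> s \<in> nbrs G v \<Longrightarrow> t \<in> nbrs G v \<Longrightarrow> s \<noteq> t \<Longrightarrow> {Tri v s, Tri v t} \<in> edges F"
  by (auto simp: fisher_def nbrs_def)

lemma edge_end_in_fisher: "{v, u} \<in> edges G \<Longrightarrow> edge_end v u \<in> verts F"
  using simple_graphD[OF simple] by (auto simp: edge_end_def nbrs_def)

lemma base_in_verts: "a \<in> verts F \<Longrightarrow> base a \<in> verts G"
  using B_verts by (cases a) auto

lemma simple_fisher: "simple_graph F"
  unfolding simple_graph_def
proof
  fix e assume e: "e \<in> edges F"
  then obtain a b where ab: "e = {a, b}" by (auto simp: fisher_def)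
  from e[unfolded ab] show "e \<subseteq> verts F \<and> card e = 2"
  proof (cases rule: fisher_edge_cases)
    case orig
    have "a \<in> verts F" "b \<in> verts F"
      using orig edge_end_in_fisher[of "base a" "base b"] edge_end_in_fisher[of "base b" "base a"]
      by (auto simp: insert_commute)
    thus ?thesis using ab orig(1) by (auto simp: card_2_iff)
  qed (use ab in auto)
qed

section \<open>Fibres over white and black vertices\<close>

lemma white_vertex: "z \<in> verts F \<Longrightarrow> base z = v \<Longrightarrow> v \<notin> B \<Longrightarrow> z = Keep v"
  by (cases z) auto

lemma black_vertex: "z \<in> verts F \<Longrightarrow> base z = v \<Longrightarrow> v \<in> B \<Longrightarrow> \<exists>u\<in>nbrs G v. z = Tri v u"
  by (cases z) auto

lemma fibre_white:
  assumes "walk F q" "\<And>z. z \<in> set q \<Longrightarrow> base z = a" "a \<notin> B"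
  shows "q = [Keep a]"
proof -
  have K: "z = Keep a" if "z \<in> set q" for z
  proof -
    have "base z = a" "z \<in> verts F" using assms that by (auto simp: walk_def)
    thus ?thesis using assms(3) by (cases z) auto
  qed
  obtain z q' where q: "q = z # q'" using assms(1) by (cases q) (auto simp: walk_def)
  have "q' = []"
  proof (rule ccontr)
    assume ne: "q' \<noteq> []"
    hence "{z, hd q'} \<in> edges F" using assms(1) q by (simp add: walk_Cons_iff)
    hence "z \<noteq> hd q'" by (rule simple_graphD(1)[OF simple_fisher])
    moreover have "z = Keep a" "hd q' = Keep a" using K q ne by auto
    ultimately show False by simp
  qed
  thus ?thesis using q K by simp
qed

lemma fibre_black:
  assumes "walk F q" "\<And>z. z \<in> set q \<Longrightarrow> base z = a" "a \<in> B"
  shows "set q \<subseteq> Tri a ` nbrs G a"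
proof
  fix z assume "z \<in> set q"
  hence "base z = a" "z \<in> verts F" using assms by (auto simp: walk_def)
  thus "z \<in> Tri a ` nbrs G a" using assms(3) by (cases z) auto
qed

lemma triangle_length:
  assumes "a \<in> B" "set q \<subseteq> Tri a ` nbrs G a" "distinct q"
  shows "length q \<le> 3"
proof -
  have "length q = card (set q)" using assms(3) by (simp add: distinct_card)
  also have "\<dots> \<le> card (Tri a ` nbrs G a)" using assms(2) finite_nbrs by (intro card_mono) auto
  also have "\<dots> \<le> 3" using card_image_le[OF finite_nbrs, of "Tri a" a] card_nbrs_black[OF assms(1)] by simp
  finally show ?thesis .
qed

lemma walk_proj:
  assumes "walk F q"
  shows "walk G (proj q)"
proof -
  have "successively (\<lambda>a b. base a = base b \<or> {base a, base b} \<in> edges G) q"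
    by (rule successively_mono[of "\<lambda>a b. {a, b} \<in> edges F"])
      (use assms in \<open>auto simp: walk_def elim: fisher_edge_cases\<close>)
  hence 1: "successively (\<lambda>a b. a = b \<or> {a, b} \<in> edges G) (proj q)"
    unfolding proj_def by (intro successively_remdups_adjI) (simp add: successively_map)
  have 2: "distinct_adj (proj q)" by (simp add: proj_def)
  have "successively (\<lambda>a b. {a, b} \<in> edges G) p"
    if "successively (\<lambda>a b. a = b \<or> {a, b} \<in> edges G) p" "distinct_adj p" for p
    using that by (induction p rule: path_edges.induct) auto
  from this[OF 1 2] show ?thesis
    using assms base_in_verts by (auto simp: walk_def set_proj)
qed

lemma path_edges_proj:
  "path_edges (proj q) = map ((`) base) (filter (\<lambda>e. card (base ` e) = 2) (path_edges q))"
  by (simp add: proj_def path_edges_remdups_adj path_edges_map filter_map o_def)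

lemma orig_edge_determined:
  assumes "e \<in> edges F" "card (base ` e) = 2" "base ` e = {x, y}"
  shows "e = {edge_end x y, edge_end y x}"
proof -
  obtain a b where ab: "e = {a, b}" using assms by (auto simp: fisher_def)
  from assms(1)[unfolded ab] show ?thesis
  proof (cases rule: fisher_edge_cases)
    case orig
    have "{base a, base b} = {x, y}" using assms ab by simp
    thus ?thesis using orig ab by (auto simp: doubleton_eq_iff insert_commute)
  qed (use ab assms in auto)
qed

text \<open>The edges of the projection are the images of those edges of \<open>q\<close> that lie
  in no triangle, and \<open>base\<close> is injective on these, as each is determined by its two
  ends in \<open>G\<close>.\<close>

lemma distinct_path_edges_proj:
  assumes "walk F q" "distinct (path_edges q)"
  shows "distinct (path_edges (proj q))"
proof -
  let ?E = "{e \<in> edges F. card (base ` e) = 2}"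
  have inj: "inj_on ((`) base) ?E"
  proof (rule inj_onI)
    fix e f assume e: "e \<in> ?E" and f: "f \<in> ?E" and ef: "base ` e = base ` f"
    obtain x y where xy: "base ` e = {x, y}" using e unfolding card_2_iff by blast
    have "e = {edge_end x y, edge_end y x}" by (rule orig_edge_determined) (use e xy in auto)
    moreover have "f = {edge_end x y, edge_end y x}"
      by (rule orig_edge_determined) (use f xy ef in auto)
    ultimately show "e = f" by simp
  qed
  have "set (path_edges q) \<subseteq> edges F"
    using assms(1) by (simp add: walk_def set_path_edges_subset_iff)
  hence sub: "set (filter (\<lambda>e. card (base ` e) = 2) (path_edges q)) \<subseteq> ?E" by auto
  show ?thesis
    unfolding path_edges_proj distinct_map using assms(2) inj_on_subset[OF inj sub] by simp
qed

text \<open>Two inner visits of the projection to a black vertex would use four distinct edges at it.\<close>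

lemma distinct_inner_proj:
  assumes q: "mid_path F q"
  shows "distinct (butlast (tl (proj q)))"
proof -
  let ?p = "proj q"
  have w: "walk G ?p" using q by (auto simp: mid_path_def intro: walk_proj)
  have de: "distinct (path_edges ?p)" using q by (auto simp: mid_path_def intro: distinct_path_edges_proj)
  have neq: "?p ! I \<noteq> ?p ! J" if IJ: "1 \<le> I" "I < J" "Suc J < length ?p" for I J
  proof
    assume eq: "?p ! I = ?p ! J"
    define v where "v = ?p ! I"
    have vJ: "?p ! J = v" using eq v_def by simp
    have nth: "path_edges ?p ! k = {?p ! k, ?p ! Suc k}" "path_edges ?p ! k \<in> edges G"
      if "Suc k < length ?p" for k
      using that w path_edges_nth[of k ?p] set_path_edges_subset_iff[of ?p "edges G"]
        nth_mem[of k "path_edges ?p"] by (auto simp: walk_def)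
    show False
    proof (cases "v \<in> B")
      case True
      have "J \<noteq> Suc I"
      proof
        assume "J = Suc I"
        hence "{v, v} \<in> edges G" using nth[of I] IJ vJ v_def by simp
        thus False using simple_graphD(1)[OF simple] by blast
      qed
      hence J: "Suc I < J" using IJ by simp
      \<comment> \<open>The edges just before and just after each visit; the visits are at least two
        steps apart, so the four positions are distinct.\<close>
      let ?K = "{I - 1, I, J - 1, J}"
      have "I - 1 \<noteq> I" "I - 1 \<noteq> J - 1" "I - 1 \<noteq> J" "I \<noteq> J - 1" "I \<noteq> J" "J - 1 \<noteq> J"
        using IJ J by auto
      hence K: "card ?K = 4" by simp
      have inj: "inj_on (\<lambda>k. path_edges ?p ! k) ?K"
        using IJ de by (intro inj_on_nth) auto
      have "card ((\<lambda>k. path_edges ?p ! k) ` ?K) = 4" unfolding card_image[OF inj] by (rule K)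
      moreover have "path_edges ?p ! k \<in> incident_edges G {v}" if k: "k \<in> ?K" for k
      proof -
        have "Suc k < length ?p" using k IJ by auto
        moreover have "?p ! k = v \<or> ?p ! Suc k = v" using k IJ vJ v_def by auto
        ultimately show ?thesis using nth[of k] by (auto simp: incident_edges_def)
      qed
      hence "card ((\<lambda>k. path_edges ?p ! k) ` ?K) \<le> card (incident_edges G {v})"
        using True B_verts lf by (intro card_mono) (auto simp: locally_finite_def)
      ultimately show False using deg3[OF True] by (simp add: vertex_degree_def)
    next
      case False
      \<comment> \<open>A white \<open>v\<close> has the single preimage \<open>Keep v\<close>.
        Cutting \<open>q\<close> at the two visits exhibits \<open>Keep v\<close> twice among the
        inner vertices of \<open>q\<close> itself.\<close>
      have "q \<noteq> []" using IJ by (auto simp: proj_def)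
      hence "proj q = take I ?p @ drop I ?p" "take I ?p \<noteq> []" "drop I ?p \<noteq> []" using IJ by auto
      then obtain q1 q' where q1: "q = q1 @ q'" "proj q1 = take I ?p" "proj q' = drop I ?p"
        by (rule proj_split)
      have "proj q' = take (J - I) (drop I ?p) @ drop J ?p"
        using IJ q1(3) append_take_drop_id[of "J - I" "drop I ?p"] by (simp del: append_take_drop_id)
      moreover have "take (J - I) (drop I ?p) \<noteq> []" "drop J ?p \<noteq> []" using IJ \<open>q \<noteq> []\<close> by auto
      ultimately obtain q2 q3
        where q2: "q' = q2 @ q3" "proj q2 = take (J - I) (drop I ?p)" "proj q3 = drop J ?p"
        by (rule proj_split)
      have "proj q1 \<noteq> []" "proj q2 \<noteq> []" "proj q3 \<noteq> []" unfolding q1(2) q2(2,3) using IJ \<open>q \<noteq> []\<close> by auto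
      hence ne: "q1 \<noteq> []" "q2 \<noteq> []" "q3 \<noteq> []" by auto
      have "length q3 \<ge> 2" using length_proj_le[of q3] q2(3) IJ by simp
      have "base (hd q2) = v"
        using hd_proj[OF ne(2)] q2(2) IJ v_def by (simp add: hd_drop_conv_nth)
      moreover have "base (hd q3) = v"
        using hd_proj[OF ne(3)] q2(3) IJ vJ by (simp add: hd_drop_conv_nth)
      moreover have "hd q2 \<in> verts F" "hd q3 \<in> verts F"
        using q q1 q2 ne by (auto simp: mid_path_def walk_def)
      ultimately have K: "hd q2 = Keep v" "hd q3 = Keep v"
        using False white_vertex by metis+
      have "butlast (tl q) = tl q1 @ q2 @ butlast q3"
        using q1 q2 ne by (simp add: butlast_append)
      moreover have "Keep v \<in> set q2" using K ne by (metis hd_in_set)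
      moreover have "Keep v \<in> set (butlast q3)"
        using K \<open>length q3 \<ge> 2\<close> by (cases q3 rule: path_edges.cases) auto
      ultimately show False using q by (auto simp: mid_path_def)
    qed
  qed
  show ?thesis
    unfolding distinct_conv_nth
  proof (intro allI impI)
    fix i j assume ij: "i < length (butlast (tl ?p))" "j < length (butlast (tl ?p))" "i \<noteq> j"
    hence "butlast (tl ?p) ! i = ?p ! Suc i" "butlast (tl ?p) ! j = ?p ! Suc j"
      by (simp_all add: nth_butlast nth_tl)
    moreover have "?p ! Suc i \<noteq> ?p ! Suc j"
    proof (cases "i < j")
      case True
      have "Suc (Suc j) < length ?p" using ij by auto
      thus ?thesis using neq[of "Suc i" "Suc j"] True by simp
    next
      case False
      hence "j < i" "Suc (Suc i) < length ?p" using ij by auto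
      thus ?thesis using neq[of "Suc j" "Suc i"] by simp
    qed
    ultimately show "butlast (tl ?p) ! i \<noteq> butlast (tl ?p) ! j" by simp
  qed
qed

lemma mid_path_proj:
  assumes "mid_path F q" "length (proj q) \<ge> 2"
  shows "mid_path G (proj q)"
  using assms walk_proj distinct_path_edges_proj distinct_inner_proj by (simp add: mid_path_def)

end


section \<open>Lifting walks to the Fisher graph\<close>

text \<open>Follows the recursion of \<open>lifts\<close>: each step removes one vertex and leaves
  at least one edge.\<close>

lemma path_induct [case_names 1 2 3 4]:
  assumes "P []" "\<And>a. P [a]" "\<And>a b. P [a, b]" "\<And>a v b p. P (v # b # p) \<Longrightarrow> P (a # v # b # p)"
  shows "P (p :: 'a list)"
  using assms by induction_schema (pat_completeness, lexicographic_order)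

context fisher_setting
begin

definition third :: "'a \<Rightarrow> 'a \<Rightarrow> 'a \<Rightarrow> 'a" where
  "third v a b = (SOME c. c \<in> nbrs G v \<and> c \<noteq> a \<and> c \<noteq> b)"

lemma nbrs_third:
  assumes "v \<in> B" "a \<in> nbrs G v" "b \<in> nbrs G v" "a \<noteq> b"
  shows "nbrs G v = {a, b, third v a b}" "third v a b \<noteq> a" "third v a b \<noteq> b"
proof -
  obtain c where c: "c \<in> nbrs G v - {a, b}"
  proof -
    have "card (nbrs G v - {a, b}) = 1"
      using assms card_nbrs_black[OF assms(1)] by (subst card_Diff_subset) auto
    thus ?thesis using that by (metis card_1_singletonE insertI1)
  qed
  hence "third v a b \<in> nbrs G v \<and> third v a b \<noteq> a \<and> third v a b \<noteq> b"
    using someI[of "\<lambda>c. c \<in> nbrs G v \<and> c \<noteq> a \<and> c \<noteq> b" c] unfolding third_def by auto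
  hence *: "third v a b \<in> nbrs G v" "third v a b \<noteq> a" "third v a b \<noteq> b" by auto
  thus "third v a b \<noteq> a" "third v a b \<noteq> b" by auto
  have "card {a, b, third v a b} = card (nbrs G v)"
    using * assms(4) card_nbrs_black[OF assms(1)] by auto
  moreover have "{a, b, third v a b} \<subseteq> nbrs G v" using * assms by auto
  ultimately show "nbrs G v = {a, b, third v a b}" using card_subset_eq[OF finite_nbrs] by metis
qed

text \<open>A lift starts and ends with the edges that replace the first and the last edge of the
  walk. At a black inner vertex it goes from \<open>Tri v a\<close> to \<open>Tri v b\<close>
  directly or through the third corner. At a white one nothing is inserted, because
  \<open>edge_end v a\<close> and \<open>edge_end v b\<close> are both
  \<open>Keep v\<close>.\<close>

fun lifts :: "'a list \<Rightarrow> 'a fisher_vertex list set" where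
  "lifts [] = {}"
| "lifts [a] = {}"
| "lifts [a, b] = {[edge_end a b, edge_end b a]}"
| "lifts (a # v # b # p) =
     (if v \<in> B
      then (\<lambda>m. edge_end a v # edge_end v a # m) ` lifts (v # b # p) \<union>
           (\<lambda>m. edge_end a v # edge_end v a # Tri v (third v a b) # m) ` lifts (v # b # p)
      else (\<lambda>m. edge_end a v # m) ` lifts (v # b # p))"

lemma finite_lifts: "finite (lifts p)"
  by (induction p rule: path_induct) auto

lemma lifts_cases:
  assumes "m \<in> lifts (a # v # b # p)"
  obtains (white) m' where "v \<notin> B" "m' \<in> lifts (v # b # p)" "m = edge_end a v # m'"
    | (short) m' where "v \<in> B" "m' \<in> lifts (v # b # p)" "m = edge_end a v # edge_end v a # m'"
    | (long) m' where "v \<in> B" "m' \<in> lifts (v # b # p)"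
        "m = edge_end a v # edge_end v a # Tri v (third v a b) # m'"
  using assms by (auto split: if_splits)

text \<open>Besides the first vertex, the presence of a second one matters: it shows that the head
  of a lift becomes an inner vertex when something is put in front.\<close>

lemma lifts_form': "m \<in> lifts p \<Longrightarrow> \<exists>z m'. m = edge_end (p ! 0) (p ! 1) # z # m'"
proof (induction p arbitrary: m rule: path_induct)
  case (4 a v b p)
  from 4(2) obtain m1 where m1: "m1 \<in> lifts (v # b # p)"
    "m = edge_end a v # m1 \<or> (\<exists>z m'. m = edge_end a v # z # m')"
    by (cases rule: lifts_cases) auto
  thus ?case using 4(1)[OF m1(1)] by auto
qed auto

lemma lifts_form: "m \<in> lifts (a # b # p) \<Longrightarrow> \<exists>z m'. m = edge_end a b # z # m'"
  using lifts_form'[of m "a # b # p"] by simp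

lemma lifts_length: "m \<in> lifts p \<Longrightarrow> length m \<le> 3 * length p"
  by (induction p arbitrary: m rule: path_induct) (fastforce split: if_splits)+

text \<open>Equal neighbours on both sides of \<open>v\<close> would mean that the edge
  \<open>{a, v}\<close> is used twice in a row.\<close>

lemma no_backtrack:
  assumes "walk G (a # v # b # p)" "distinct (path_edges (a # v # b # p))"
  shows "a \<in> nbrs G v" "b \<in> nbrs G v" "a \<noteq> b" "walk G (v # b # p)" "distinct (path_edges (v # b # p))"
  using assms by (auto simp: walk_Cons_iff nbrs_def insert_commute)

lemma lifts_walk:
  "m \<in> lifts p \<Longrightarrow> walk G p \<Longrightarrow> distinct (path_edges p) \<Longrightarrow> walk F m \<and> proj m = p"
proof (induction p arbitrary: m rule: path_induct)
  case (3 a b)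
  have e: "{a, b} \<in> edges G" "{b, a} \<in> edges G" using 3 by (auto simp: walk_Cons_iff insert_commute)
  have "a \<noteq> b" using simple_graphD(1)[OF simple e(1)] .
  thus ?case using 3 orig_edge[OF e(1)] edge_end_in_fisher[OF e(1)] edge_end_in_fisher[OF e(2)]
    by (auto simp: walk_Cons_iff proj_def)
next
  case (4 a v b p)
  note nb = no_backtrack[OF 4(3,4)]
  have av: "{a, v} \<in> edges G" "{v, a} \<in> edges G" using nb(1) by (auto simp: nbrs_def insert_commute)
  have ne: "a \<noteq> v" using simple_graphD(1)[OF simple av(1)] .
  note ends = edge_end_in_fisher[OF av(1)] edge_end_in_fisher[OF av(2)] orig_edge[OF av(1)]
  have IH: "walk F m' \<and> proj m' = v # b # p" "hd m' = edge_end v b" "m' \<noteq> []" "\<exists>m''. m' = edge_end v b # m''"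
    if "m' \<in> lifts (v # b # p)" for m'
    using 4(1) that nb lifts_form[OF that] by (cases "v \<in> B"; auto)+
  from 4(2) show ?case
  proof (cases rule: lifts_cases)
    case (white m')
    moreover have "edge_end v b = edge_end v a" using white(1) by (simp add: edge_end_def)
    ultimately show ?thesis using IH[OF white(2)] ends ne by (auto simp: walk_Cons_iff proj_def)
  next
    case (short m')
    have "{edge_end v a, edge_end v b} \<in> edges F"
      using tri_edge[OF short(1) nb(1,2,3)] short(1) by (simp add: edge_end_def)
    thus ?thesis using IH[OF short(2)] ends ne short(3) by (auto simp: walk_Cons_iff proj_def)
  next
    case (long m')
    let ?c = "third v a b"
    note th = nbrs_third[OF long(1) nb(1,2,3)]
    have "{edge_end v a, Tri v ?c} \<in> edges F" "{Tri v ?c, edge_end v b} \<in> edges F" "Tri v ?c \<in> verts F"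
      using tri_edge[OF long(1), of a ?c] tri_edge[OF long(1), of ?c b] th nb long(1)
      by (auto simp: edge_end_def)
    thus ?thesis using IH[OF long(2)] ends ne long(3) by (auto simp: walk_Cons_iff proj_def)
  qed
qed auto

text \<open>Ensures that the vertices over \<open>v\<close> put in front of a lift do not recur
  among its later inner vertices when \<open>v\<close> is an inner vertex of the walk only
  once.\<close>

lemma lifts_inner:
  assumes "m \<in> lifts p" "walk G p" "distinct (path_edges p)"
  shows "base ` set (butlast (tl m)) \<subseteq> set (butlast (tl p))"
  using assms
proof (induction p arbitrary: m rule: path_induct)
  case (4 a v b p)
  note nb = no_backtrack[OF 4(3,4)]
  have IH: "base ` set (butlast (tl m')) \<subseteq> set (butlast (b # p))" "\<exists>z m''. m' = edge_end v b # z # m''"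
    if "m' \<in> lifts (v # b # p)" for m'
    using 4(1) that nb lifts_form[OF that] by (cases "v \<in> B"; simp)+
  from 4(2) show ?case
    by (cases rule: lifts_cases) (use IH in \<open>fastforce simp: edge_end_def\<close>)+
qed auto

lemma lifts_distinct_inner:
  assumes "m \<in> lifts p" "walk G p" "distinct (path_edges p)" "distinct (butlast (tl p))"
  shows "distinct (butlast (tl m))"
  using assms
proof (induction p arbitrary: m rule: path_induct)
  case (4 a v b p)
  note nb = no_backtrack[OF 4(3,4)]
  have d: "distinct (butlast (b # p))" "v \<notin> set (butlast (b # p))" using 4(5) by simp_all
  have IH: "distinct (butlast (tl m'))" "\<exists>z m''. m' = edge_end v b # z # m''"
    if "m' \<in> lifts (v # b # p)" for m'
    using 4(1) that nb lifts_form[OF that] d by (cases "v \<in> B"; simp)+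
  have v: "z \<notin> set (butlast (tl m'))" if "m' \<in> lifts (v # b # p)" "base z = v" for m' z
    using lifts_inner[OF that(1) nb(4,5)] d(2) that(2) by auto
  from 4(2) show ?case
  proof (cases rule: lifts_cases)
    case (white m')
    thus ?thesis using IH[OF white(2)] v[OF white(2)] by auto
  next
    case (short m')
    thus ?thesis using IH[OF short(2)] v[OF short(2)] nb(3) by (auto simp: edge_end_def)
  next
    case (long m')
    thus ?thesis using IH[OF long(2)] v[OF long(2)] nbrs_third[OF long(1) nb(1,2,3)] nb(3)
      by (auto simp: edge_end_def)
  qed
qed auto

text \<open>Classifies edges by their image under \<open>base\<close>; this is how the edges put in
  front of a lift are told apart from the later ones.\<close>

lemma lifts_edges:
  assumes "m \<in> lifts p" "walk G p" "distinct (path_edges p)" "e \<in> set (path_edges m)"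
  shows "card (base ` e) = 2 \<and> base ` e \<in> set (path_edges p) \<or> (\<exists>v\<in>set (butlast (tl p)). base ` e = {v})"
  using assms
proof (induction p arbitrary: m rule: path_induct)
  case (3 a b)
  thus ?case using simple_graphD(1)[OF simple, of a b] by (auto simp: walk_Cons_iff)
next
  case (4 a v b p)
  note nb = no_backtrack[OF 4(3,4)]
  have "a \<noteq> v" using nb(1) simple_graphD(1)[OF simple, of v a] by (auto simp: nbrs_def)
  have IH: "card (base ` e) = 2 \<and> base ` e \<in> set (path_edges (v # b # p)) \<or>
      (\<exists>w\<in>set (butlast (b # p)). base ` e = {w})" if "m' \<in> lifts (v # b # p)" "e \<in> set (path_edges m')" for m'
    using 4(1) that nb by (cases "v \<in> B"; simp)
  have up: ?case if "m' \<in> lifts (v # b # p)" "e \<in> set (path_edges m')" for m'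
    using IH[OF that] by (elim disjE) auto
  have orig: ?case if "e = {y, z}" "base y = a" "base z = v" for y z
  proof -
    have "base ` e = {a, v}" using that by auto
    thus ?thesis using \<open>a \<noteq> v\<close> by simp
  qed
  have tri: ?case if "e = {y, z}" "base y = v" "base z = v" for y z
  proof -
    have "base ` e = {v}" using that by auto
    thus ?thesis by simp
  qed
  from 4(2) show ?case
  proof (cases rule: lifts_cases)
    case (white m')
    obtain m'' where "m' = edge_end v b # m''" using lifts_form[OF white(2)] by blast
    hence "e = {edge_end a v, edge_end v b} \<or> e \<in> set (path_edges m')" using white(3) 4(5) by simp
    thus ?thesis using up[OF white(2)] orig by (elim disjE) simp_all
  next
    case (short m')
    obtain m'' where "m' = edge_end v b # m''" using lifts_form[OF short(2)] by blast
    hence "e = {edge_end a v, edge_end v a} \<or> e = {edge_end v a, edge_end v b} \<or> e \<in> set (path_edges m')"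
      using short(3) 4(5) by simp
    thus ?thesis using up[OF short(2)] orig tri by (elim disjE) simp_all
  next
    case (long m')
    obtain m'' where "m' = edge_end v b # m''" using lifts_form[OF long(2)] by blast
    hence "e = {edge_end a v, edge_end v a} \<or> e = {edge_end v a, Tri v (third v a b)} \<or>
        e = {Tri v (third v a b), edge_end v b} \<or> e \<in> set (path_edges m')"
      using long(3) 4(5) by simp
    thus ?thesis using up[OF long(2)] orig tri by (elim disjE) simp_all
  qed
qed auto

text \<open>A new edge over \<open>{a, v}\<close> cannot recur, since the walk uses that edge once;
  a new triangle edge over \<open>v\<close> cannot recur, since \<open>v\<close> is an inner vertex
  once. The new edges differ from each other by their bases or by the corners they join.\<close>

lemma lifts_distinct_edges:
  assumes "m \<in> lifts p" "walk G p" "distinct (path_edges p)" "distinct (butlast (tl p))"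
  shows "distinct (path_edges m)"
  using assms
proof (induction p arbitrary: m rule: path_induct)
  case (4 a v b p)
  note nb = no_backtrack[OF 4(3,4)]
  have d: "distinct (butlast (b # p))" "v \<notin> set (butlast (b # p))" using 4(5) by simp_all
  have "a \<noteq> v" using nb(1) simple_graphD(1)[OF simple, of v a] by (auto simp: nbrs_def)
  have IH: "distinct (path_edges m')" "\<exists>m''. m' = edge_end v b # m''"
    if "m' \<in> lifts (v # b # p)" for m'
    using 4(1) that nb lifts_form[OF that] d by (cases "v \<in> B"; auto)+
  have 1: "{y, z} \<notin> set (path_edges m')" if "m' \<in> lifts (v # b # p)" "base y = a" "base z = v" for m' y z
  proof
    assume "{y, z} \<in> set (path_edges m')"
    from lifts_edges[OF that(1) nb(4,5) this] have "{a, v} \<in> set (path_edges (v # b # p))"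
      using that(2,3) \<open>a \<noteq> v\<close> by (simp add: doubleton_eq_iff)
    thus False using 4(4) by simp
  qed
  have 2: "{y, z} \<notin> set (path_edges m')" if "m' \<in> lifts (v # b # p)" "base y = v" "base z = v" for m' y z
  proof
    assume "{y, z} \<in> set (path_edges m')"
    from lifts_edges[OF that(1) nb(4,5) this] have "v \<in> set (butlast (b # p))"
      using that(2,3) by simp
    thus False using d by simp
  qed
  have ne: "{edge_end a v, y} \<noteq> {z, w}" if "base z = v" "base w = v" for y z w
  proof
    assume "{edge_end a v, y} = {z, w}"
    hence "edge_end a v = z \<or> edge_end a v = w" by (auto simp: doubleton_eq_iff)
    hence "base (edge_end a v) = v" by (elim disjE; simp only: that)
    thus False using \<open>a \<noteq> v\<close> by simp
  qed
  from 4(2) show ?case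
  proof (cases rule: lifts_cases)
    case (white m')
    obtain m'' where m'': "m' = edge_end v b # m''" using IH[OF white(2)] by blast
    have "{edge_end a v, edge_end v b} \<notin> set (path_edges m')" by (rule 1[OF white(2)]) auto
    thus ?thesis using IH(1)[OF white(2)] m'' white(3) by simp
  next
    case (short m')
    obtain m'' where m'': "m' = edge_end v b # m''" using IH[OF short(2)] by blast
    have "{edge_end a v, edge_end v a} \<notin> set (path_edges m')" by (rule 1[OF short(2)]) auto
    moreover have "{edge_end v a, edge_end v b} \<notin> set (path_edges m')" by (rule 2[OF short(2)]) auto
    ultimately show ?thesis
      using IH(1)[OF short(2)] m'' short(3) ne[of "edge_end v a" "edge_end v b" "edge_end v a"] by simp
  next
    case (long m')
    let ?c = "Tri v (third v a b)"
    obtain m'' where m'': "m' = edge_end v b # m''" using IH[OF long(2)] by blast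
    have "{edge_end a v, edge_end v a} \<notin> set (path_edges m')" by (rule 1[OF long(2)]) auto
    moreover have "{edge_end v a, ?c} \<notin> set (path_edges m')" by (rule 2[OF long(2)]) auto
    moreover have "{?c, edge_end v b} \<notin> set (path_edges m')" by (rule 2[OF long(2)]) auto
    moreover have "{edge_end v a, ?c} \<noteq> {?c, edge_end v b}"
      using nb(3) long(1) by (auto simp: doubleton_eq_iff edge_end_def)
    ultimately show ?thesis
      using IH(1)[OF long(2)] m'' long(3) ne[of "edge_end v a" ?c "edge_end v a"]
        ne[of ?c "edge_end v b" "edge_end v a"] by simp
  qed
qed auto

lemma mid_path_lifts:
  assumes "mid_path G p" "m \<in> lifts p"
  shows "mid_path F m" "proj m = p"
proof -
  have p: "walk G p" "distinct (path_edges p)" "distinct (butlast (tl p))" "length p \<ge> 2"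
    using assms(1) by (auto simp: mid_path_def)
  show "proj m = p" using lifts_walk[OF assms(2) p(1,2)] by simp
  hence "length m \<ge> 2" using length_proj_le[of m] p(4) by simp
  thus "mid_path F m"
    using lifts_walk[OF assms(2) p(1,2)] lifts_distinct_inner[OF assms(2) p(1,2,3)]
      lifts_distinct_edges[OF assms(2) p(1,2,3)] by (simp add: mid_path_def)
qed

section \<open>Total weight of the lifts of a walk\<close>

definition rate :: "real \<Rightarrow> real" where
  "rate x = sqrt (x ^ 3 + x ^ 4)"

lemma rate_pos: "x > 0 \<Longrightarrow> rate x > 0"
  by (simp add: rate_def add_pos_pos)

lemma rate_power2: "x > 0 \<Longrightarrow> (rate x)\<^sup>2 = x ^ 3 + x ^ 4"
  by (simp add: rate_def)

text \<open>With \<open>t = sqrt (rate x / x)\<close>, a white inner vertex has weight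
  \<open>x = rate x / t\<^sup>2\<close> and a black one
  \<open>x\<^sup>2 + x ^ 3 = rate x * t\<^sup>2\<close>. Along an alternating walk the powers of
  \<open>t\<close> cancel up to one factor \<open>t\<close> or \<open>1 / t\<close> at each
  end.\<close>

definition end_weight :: "real \<Rightarrow> 'a \<Rightarrow> real" where
  "end_weight x v = (if v \<in> B then 1 / sqrt (rate x / x) else sqrt (rate x / x))"

text \<open>A white inner vertex contributes the factor \<open>x\<close> and a black one \<open>x\<^sup>2 + x\<^sup>3\<close>; their product is the
  square of the rate, and the colours alternate, so only the colours of the two ends matter.\<close>

lemma lifts_sum:
  assumes "x > 0"
  shows "walk G p \<Longrightarrow> distinct (path_edges p) \<Longrightarrow> length p \<ge> 2 \<Longrightarrow>
    (\<Sum>m\<in>lifts p. x ^ length m) = x\<^sup>2 * rate x ^ (length p - 2) * (end_weight x (hd p) * end_weight x (last p))"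
proof (induction p rule: path_induct)
  case (3 a b)
  have "{a, b} \<in> edges G" using 3 by (simp add: walk_Cons_iff)
  hence "end_weight x a * end_weight x b = 1"
    using black_iff[of a b] rate_pos[OF assms] assms by (auto simp: end_weight_def)
  thus ?case by (simp add: power2_eq_square)
next
  case (4 a v b p)
  note nb = no_backtrack[OF 4(2,3)]
  let ?S = "\<Sum>m\<in>lifts (v # b # p). x ^ length m"
  let ?l = "last (b # p)"
  define t where "t = sqrt (rate x / x)"
  have t: "t > 0" "rate x = t\<^sup>2 * x" using assms rate_pos[OF assms] by (auto simp: t_def)
  have t4: "x\<^sup>2 + x ^ 3 = rate x * t\<^sup>2"
  proof -
    have "x * (x\<^sup>2 + x ^ 3) = (rate x)\<^sup>2" using rate_power2[OF assms] by (simp add: power2_eq_square eval_nat_numeral algebra_simps)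
    also have "\<dots> = x * (rate x * t\<^sup>2)" using t(2) by (simp add: power2_eq_square)
    finally show ?thesis using assms by simp
  qed
  have IH: "?S = x\<^sup>2 * rate x ^ length p * (end_weight x v * end_weight x ?l)" using 4(1) nb by simp
  have av: "{a, v} \<in> edges G" using 4(2) by (simp add: walk_Cons_iff)
  show ?case
  proof (cases "v \<in> B")
    case False
    hence "a \<in> B" using black_iff[OF av] by simp
    have "(\<Sum>m\<in>lifts (a # v # b # p). x ^ length m) = x * ?S"
      using False by (simp add: sum.reindex inj_on_def sum_distrib_left o_def)
    also have "\<dots> = x\<^sup>2 * rate x ^ length p * (x * t) * end_weight x ?l"
      unfolding IH using False by (simp add: end_weight_def t_def)
    also have "x * t = rate x * end_weight x a"
      using \<open>a \<in> B\<close> t by (simp add: end_weight_def t_def[symmetric] power2_eq_square field_simps)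
    finally show ?thesis by (simp add: mult_ac)
  next
    case True
    hence "a \<notin> B" using black_iff[OF av] by simp
    let ?A = "(\<lambda>m. edge_end a v # edge_end v a # m) ` lifts (v # b # p)"
    let ?A' = "(\<lambda>m. edge_end a v # edge_end v a # Tri v (third v a b) # m) ` lifts (v # b # p)"
    \<comment> \<open>The third vertices distinguish the two families: \<open>edge_end v b\<close>
      in one, the third corner in the other.\<close>
    have "?A \<inter> ?A' = {}"
    proof (intro equals0I)
      fix m assume "m \<in> ?A \<inter> ?A'"
      then obtain m1 m2 where "m1 \<in> lifts (v # b # p)" "m1 = Tri v (third v a b) # m2" by auto
      with lifts_form[of m1 v b p] have "Tri v (third v a b) = edge_end v b" by auto
      thus False using nbrs_third(3)[OF True nb(1,2,3)] True by (simp add: edge_end_def)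
    qed
    hence "(\<Sum>m\<in>lifts (a # v # b # p). x ^ length m) = (\<Sum>m\<in>?A. x ^ length m) + (\<Sum>m\<in>?A'. x ^ length m)"
      using True by (simp add: sum.union_disjoint finite_lifts)
    also have "(\<Sum>m\<in>?A. x ^ length m) = x\<^sup>2 * ?S"
      by (simp add: sum.reindex inj_on_def sum_distrib_left o_def power2_eq_square mult_ac)
    also have "(\<Sum>m\<in>?A'. x ^ length m) = x ^ 3 * ?S"
      by (simp add: sum.reindex inj_on_def sum_distrib_left o_def power3_eq_cube mult_ac)
    also have "x\<^sup>2 * ?S + x ^ 3 * ?S = (x\<^sup>2 + x ^ 3) * ?S" by (simp add: algebra_simps)
    also have "\<dots> = x\<^sup>2 * rate x ^ length p * ((x\<^sup>2 + x ^ 3) * (1 / t)) * end_weight x ?l"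
      unfolding IH using True by (simp add: end_weight_def t_def)
    also have "(x\<^sup>2 + x ^ 3) * (1 / t) = rate x * end_weight x a"
      unfolding t4 using \<open>a \<notin> B\<close> t(1) by (simp add: end_weight_def t_def[symmetric] power2_eq_square)
    finally show ?thesis by (simp add: mult_ac)
  qed
qed auto

text \<open>The exponents are walk lengths; dividing by \<open>x\<^sup>2\<close> removes the two
  outer vertices. The product of the end weights takes only the values \<open>t * t\<close>,
  \<open>1\<close> and \<open>1 / (t * t)\<close>, whence the choice of \<open>c\<close>.\<close>

lemma lifts_sum_bounds:
  assumes "x > 0"
  obtains c where "c \<ge> 1"
    "\<And>p. mid_path G p \<Longrightarrow> rate x ^ (length p - 2) \<le> c * (\<Sum>m\<in>lifts p. x ^ (length m - 2))"
    "\<And>p. mid_path G p \<Longrightarrow> (\<Sum>m\<in>lifts p. x ^ (length m - 2)) \<le> c * rate x ^ (length p - 2)"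
proof -
  define t where "t = sqrt (rate x / x)"
  have t: "t > 0" using assms rate_pos[OF assms] by (auto simp: t_def)
  define c where "c = max (t * t) (max 1 ((1 / t) * (1 / t)))"
  have w: "end_weight x u * end_weight x v \<le> c" "1 \<le> c * (end_weight x u * end_weight x v)" for u v
  proof -
    have cases: "end_weight x u * end_weight x v \<in> {t * t, 1, (1 / t) * (1 / t)}"
      using t by (auto simp: end_weight_def t_def)
    thus "end_weight x u * end_weight x v \<le> c" by (auto simp: c_def)
    have c: "1 \<le> c" "1 / (t * t) \<le> c" "t * t \<le> c" by (auto simp: c_def)
    from cases consider "end_weight x u * end_weight x v = t * t" | "end_weight x u * end_weight x v = 1"
      | "end_weight x u * end_weight x v = 1 / (t * t)" by auto
    thus "1 \<le> c * (end_weight x u * end_weight x v)"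
    proof cases
      case 1
      show ?thesis unfolding 1 using c(2) t by (simp add: field_simps)
    next
      case 3
      show ?thesis unfolding 3 using c(3) t by (simp add: field_simps)
    qed (use c in simp)
  qed
  have eq: "(\<Sum>m\<in>lifts p. x ^ (length m - 2)) = rate x ^ (length p - 2) * (end_weight x (hd p) * end_weight x (last p))"
    if p: "mid_path G p" for p
  proof -
    have "length m \<ge> 2" if "m \<in> lifts p" for m using mid_path_lifts[OF p that] by (simp add: mid_path_def)
    hence "x\<^sup>2 * x ^ (length m - 2) = x ^ length m" if "m \<in> lifts p" for m
      using that by (metis le_add_diff_inverse power_add)
    hence "x\<^sup>2 * (\<Sum>m\<in>lifts p. x ^ (length m - 2)) = (\<Sum>m\<in>lifts p. x ^ length m)"
      unfolding sum_distrib_left by (intro sum.cong refl)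
    also have "\<dots> = x\<^sup>2 * (rate x ^ (length p - 2) * (end_weight x (hd p) * end_weight x (last p)))"
      using lifts_sum[OF assms, of p] p by (simp add: mid_path_def mult_ac)
    finally show ?thesis using assms by simp
  qed
  have "c \<ge> 1" by (simp add: c_def)
  moreover have "rate x ^ (length p - 2) \<le> c * (\<Sum>m\<in>lifts p. x ^ (length m - 2))" if "mid_path G p" for p
    unfolding eq[OF that] using mult_left_mono[OF w(2), of "rate x ^ (length p - 2)" "hd p" "last p"] rate_pos[OF assms]
    by (simp add: mult_ac)
  moreover have "(\<Sum>m\<in>lifts p. x ^ (length m - 2)) \<le> c * rate x ^ (length p - 2)" if "mid_path G p" for p
    unfolding eq[OF that] using mult_left_mono[OF w(1), of "rate x ^ (length p - 2)" "hd p" "last p"] rate_pos[OF assms]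
    by (simp add: mult_ac)
  ultimately show ?thesis using that by blast
qed

section \<open>Decomposing a walk on the Fisher graph into a lift and two end pieces\<close>

definition triangle_ext :: "'a \<Rightarrow> 'a fisher_vertex list set" where
  "triangle_ext v = {s. set s \<subseteq> Tri v ` (if v \<in> B then nbrs G v else {}) \<and> length s \<le> 3}"

lemma finite_triangle_ext: "finite (triangle_ext v)"
  unfolding triangle_ext_def by (rule finite_lists_length_le) (simp add: finite_nbrs)

text \<open>There are \<open>1 + 3 + 9 + 27\<close> lists of length at most 3 over three corners.
  Lists with repetitions are counted too, as only an upper bound is wanted.\<close>

lemma card_triangle_ext: "card (triangle_ext v) \<le> 40"
proof -
  let ?A = "Tri v ` (if v \<in> B then nbrs G v else {})"
  have "card ?A \<le> 3" using card_image_le[OF finite_nbrs, of "Tri v" v] card_nbrs_black[of v] by auto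
  hence "(\<Sum>i\<le>3. card ?A ^ i) \<le> (\<Sum>i\<le>3. 3 ^ i)" by (intro sum_mono power_mono) auto
  also have "\<dots> = (40::nat)" by (simp add: eval_nat_numeral)
  finally show ?thesis
    unfolding triangle_ext_def using card_lists_length_le[of ?A 3] finite_nbrs by simp
qed

text \<open>The first vertex of \<open>q\<close> is an outer one and may recur, so a block over a
  black vertex may have four vertices. Its last vertex is left to the lift; the others number at
  most three.\<close>

lemma block_prefix:
  assumes w: "walk F q" and b: "\<And>z. z \<in> set q \<Longrightarrow> base z = a" and d: "distinct (tl q)"
  shows "butlast q \<in> triangle_ext a"
proof (cases "a \<in> B")
  case True
  have sub: "set q \<subseteq> Tri a ` nbrs G a" using fibre_black[OF w b True] by blast
  have "set (tl q) \<subseteq> Tri a ` nbrs G a" using sub by (cases q) auto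
  hence "length (tl q) \<le> 3" using triangle_length[OF True _ d] by blast
  thus ?thesis using True sub by (auto simp: triangle_ext_def dest: in_set_butlastD)
next
  case False
  have "q = [Keep a]" by (rule fibre_white[OF w b False])
  thus ?thesis by (simp add: triangle_ext_def)
qed

lemma block_suffix:
  assumes w: "walk F q" and b: "\<And>z. z \<in> set q \<Longrightarrow> base z = a" and d: "distinct (butlast q)"
  shows "tl q \<in> triangle_ext a"
proof -
  have "butlast (rev q) \<in> triangle_ext a"
  proof (rule block_prefix)
    show "distinct (tl (rev q))" using d by (metis butlast_rev distinct_rev rev_rev_ident)
  qed (use w b in \<open>auto simp: walk_rev\<close>)
  thus ?thesis by (simp add: butlast_rev triangle_ext_def)
qed

lemma proj_singleton: "proj q = [a] \<Longrightarrow> z \<in> set q \<Longrightarrow> base z = a"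
  using set_proj[of q] by auto

text \<open>Splitting off the block over the first vertex and applying the induction hypothesis to
  the rest leaves a piece \<open>s\<close> over the next vertex \<open>v\<close>. If
  \<open>v\<close> is black, \<open>s\<close> followed by \<open>edge_end v b\<close> is a list of
  distinct corners that begins with the entry corner, so \<open>s\<close> is one of the two
  insertions made by \<open>lifts\<close>; if \<open>v\<close> is white, \<open>s\<close> is empty.
  Either way \<open>s\<close> joins the lift. The last conjunct, on the base of \<open>s\<close>, is
  there to make this induction go through.\<close>

lemma fibre_decomposition:
  assumes "walk F q" "distinct (butlast (tl q))" "proj q = p" "length p \<ge> 2" "distinct (path_edges p)"
  shows "\<exists>s m e. q = s @ m @ e \<and> m \<in> lifts p \<and> s \<in> triangle_ext (hd p) \<and> e \<in> triangle_ext (last p) \<and>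
    (\<forall>z\<in>set s. base z = hd p)"
  using assms
proof (induction p arbitrary: q rule: path_induct)
  case (3 a b)
  obtain q1 q2 where q: "q = q1 @ q2" "proj q1 = [a]" "proj q2 = [b]"
    using proj_split[of q "[a]" "[b]"] 3 by auto
  have ne: "q1 \<noteq> []" "q2 \<noteq> []" using q by (auto simp: proj_def)
  have w: "walk F q1" "walk F q2" "{last q1, hd q2} \<in> edges F" using 3 q ne by (auto simp: walk_append_iff)
  have base: "base (last q1) = a" "base (hd q2) = b"
    using last_proj[OF ne(1)] hd_proj[OF ne(2)] q by simp_all
  have "a \<noteq> b" using walk_proj[OF 3(1)] 3(3) simple_graphD(1)[OF simple] by (auto simp: walk_Cons_iff)
  with w(3) base have ends: "last q1 = edge_end a b" "hd q2 = edge_end b a"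
    by (auto elim: fisher_edge_cases)
  have d: "distinct (tl q1)" "distinct (butlast q2)" using 3(2) q ne by (simp_all add: butlast_append)
  have "butlast q1 \<in> triangle_ext a" "tl q2 \<in> triangle_ext b"
    by (rule block_prefix[OF w(1) proj_singleton[OF q(2)] d(1)], assumption,
        rule block_suffix[OF w(2) proj_singleton[OF q(3)] d(2)], assumption)
  moreover have "q = butlast q1 @ [edge_end a b, edge_end b a] @ tl q2"
    using q(1) ne ends by (metis append.assoc append_Cons append_Nil append_butlast_last_id list.collapse)
  ultimately show ?case using proj_singleton[OF q(2)]
    by (intro exI[of _ "butlast q1"] exI[of _ "[edge_end a b, edge_end b a]"] exI[of _ "tl q2"])
      (auto dest: in_set_butlastD)
next
  case (4 a v b p)
  obtain q1 q2 where q: "q = q1 @ q2" "proj q1 = [a]" "proj q2 = v # b # p"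
    using proj_split[of q "[a]" "v # b # p"] 4(4) by auto
  have ne: "q1 \<noteq> []" "q2 \<noteq> []" using q by (auto simp: proj_def)
  have w: "walk F q1" "walk F q2" "{last q1, hd q2} \<in> edges F" using 4 q ne by (auto simp: walk_append_iff)
  have base: "base (last q1) = a" "base (hd q2) = v"
    using last_proj[OF ne(1)] hd_proj[OF ne(2)] q by simp_all
  have wp: "walk G (a # v # b # p)" using walk_proj[OF 4(2)] 4(4) by simp
  note nb = no_backtrack[OF wp 4(6)]
  have "a \<noteq> v" using nb(1) simple_graphD(1)[OF simple, of v a] by (auto simp: nbrs_def)
  with w(3) base have ends: "last q1 = edge_end a v" "hd q2 = edge_end v a"
    by (auto elim: fisher_edge_cases)
  have d: "distinct (tl q1)" "distinct (butlast q2)" using 4(3) q ne by (simp_all add: butlast_append)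
  hence d2: "distinct (butlast (tl q2))" by (simp add: butlast_tl distinct_tl)
  have s: "butlast q1 \<in> triangle_ext a"
    by (rule block_prefix[OF w(1) proj_singleton[OF q(2)] d(1)])
  have q1: "q1 = butlast q1 @ [edge_end a v]" using ne ends by (metis append_butlast_last_id)
  from 4(1)[OF w(2) d2 q(3)] nb obtain s m e where q2: "q2 = s @ m @ e" "m \<in> lifts (v # b # p)"
    "e \<in> triangle_ext (last (v # b # p))" "\<forall>z\<in>set s. base z = v" by auto
  obtain z m' where m': "m = edge_end v b # z # m'" using lifts_form[OF q2(2)] by blast
  have "walk F ((s @ [edge_end v b]) @ (z # m') @ e)" using w(2) q2(1) m' by simp
  hence ws: "walk F (s @ [edge_end v b])" by (subst (asm) walk_append_iff) auto
  have bs: "base y = v" if "y \<in> set (s @ [edge_end v b])" for y using that q2(4) by auto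
  \<comment> \<open>The lift has a further vertex \<open>z\<close>, so \<open>edge_end v b\<close>
    is not the last vertex of \<open>q2\<close> and is covered by the distinctness of
    \<open>butlast q2\<close>.\<close>
  have ds: "distinct (s @ [edge_end v b])"
    using d(2) q2(1) m' by (auto simp: butlast_append)
  have "edge_end a v # s @ m \<in> lifts (a # v # b # p)"
  proof (cases "v \<in> B")
    case False
    have "s @ [edge_end v b] = [Keep v]" using fibre_white[OF ws bs False] .
    hence "s = []" by simp
    thus ?thesis using False q2(2) by simp
  next
    case True
    let ?c = "third v a b"
    note th = nbrs_third[OF True nb(1,2,3)]
    have sub: "set (s @ [Tri v b]) \<subseteq> Tri v ` {a, b, ?c}"
      using fibre_black[OF ws bs True] th(1) True by (simp add: edge_end_def)
    \<comment> \<open>Entry and exit corner differ because \<open>a \<noteq> b\<close>, so at least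
      the entry corner belongs to \<open>s\<close>.\<close>
    have "s \<noteq> []"
    proof
      assume "s = []"
      hence "edge_end v b = edge_end v a" using ends(2) q2(1) m' by simp
      thus False using True nb(3) by (simp add: edge_end_def)
    qed
    then obtain s' where s': "s = Tri v a # s'"
      using ends(2) q2(1) True by (cases s) (auto simp: edge_end_def)
    have "set s' \<subseteq> {Tri v ?c}" "distinct s'" using sub ds s' True by (auto simp: edge_end_def)
    hence "s' = [] \<or> s' = [Tri v ?c]"
      by (cases s' rule: path_edges.cases) auto
    thus ?thesis using True q2(2) s' by (auto simp: edge_end_def)
  qed
  moreover have "q = butlast q1 @ (edge_end a v # s @ m) @ e" using q(1) q1 q2(1) by simp
  ultimately show ?case using s q2(3) proj_singleton[OF q(2)]
    by (intro exI[of _ "butlast q1"] exI[of _ "edge_end a v # s @ m"] exI[of _ e])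
      (auto dest: in_set_butlastD)
qed auto

text \<open>Three vertices for each vertex of the projection and three at each end. If the
  projection is a single black vertex, the walk stays in one triangle and has at most three inner
  vertices.\<close>

lemma length_fibre_le:
  assumes "mid_path F q"
  shows "length q \<le> 3 * length (proj q) + 6"
proof -
  let ?p = "proj q"
  have q: "walk F q" "distinct (butlast (tl q))" "distinct (path_edges q)" "length q \<ge> 2" "q \<noteq> []"
    using assms by (auto simp: mid_path_def)
  show ?thesis
  proof (cases "length ?p \<ge> 2")
    case True
    from fibre_decomposition[OF q(1,2) refl True distinct_path_edges_proj[OF q(1,3)]]
    obtain s m e where "q = s @ m @ e" "m \<in> lifts ?p" "length s \<le> 3" "length e \<le> 3"
      by (auto simp: triangle_ext_def)
    thus ?thesis using lifts_length[of m ?p] by simp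
  next
    case False
    moreover have "length ?p \<noteq> 0" using q(5) by simp
    ultimately have "length ?p = 1" by linarith
    then obtain a where a: "?p = [a]" by (auto simp: length_Suc_conv)
    note b = proj_singleton[OF a]
    show ?thesis
    proof (cases "a \<in> B")
      case True
      have "set (butlast (tl q)) \<subseteq> set q" by (cases q) (auto dest: in_set_butlastD)
      hence "set (butlast (tl q)) \<subseteq> Tri a ` nbrs G a" using fibre_black[OF q(1) b True] by blast
      hence "length (butlast (tl q)) \<le> 3" using triangle_length[OF True _ q(2)] by blast
      thus ?thesis by simp
    next
      case False
      have "q = [Keep a]" by (rule fibre_white[OF q(1) b False])
      thus ?thesis by simp
    qed
  qed
qed

text \<open>An end piece of at most three vertices contributes a factor of at most
  \<open>max 1 (x ^ 3)\<close>, and each end has at most 40 candidates; two ends give the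
  square.\<close>

lemma fibre_sum_le:
  fixes x :: real
  assumes x: "x > 0" and Q: "finite Q" "Q \<subseteq> {q. mid_path F q \<and> proj q = p}" and p: "mid_path G p"
  shows "(\<Sum>q\<in>Q. x ^ (length q - 2)) \<le> (40 * max 1 (x ^ 3))\<^sup>2 * (\<Sum>m\<in>lifts p. x ^ (length m - 2))"
proof -
  define M where "M = max 1 (x ^ 3)"
  define T where "T = triangle_ext (hd p) \<times> lifts p \<times> triangle_ext (last p)"
  let ?g = "\<lambda>(s, m, e). s @ m @ e :: 'a fisher_vertex list"
  have fin: "finite T" by (simp add: T_def finite_triangle_ext finite_lifts)
  have sub: "Q \<subseteq> ?g ` T"
  proof
    fix q assume "q \<in> Q"
    hence q: "walk F q" "distinct (butlast (tl q))" "proj q = p" using Q(2) by (auto simp: mid_path_def)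
    from fibre_decomposition[OF this] p obtain s m e where "q = s @ m @ e" "m \<in> lifts p"
      "s \<in> triangle_ext (hd p)" "e \<in> triangle_ext (last p)" by (auto simp: mid_path_def)
    thus "q \<in> ?g ` T" by (intro image_eqI[of _ _ "(s, m, e)"]) (auto simp: T_def)
  qed
  have "(\<Sum>q\<in>Q. x ^ (length q - 2)) \<le> (\<Sum>q\<in>?g ` T. x ^ (length q - 2))"
    by (rule sum_mono2[OF finite_imageI[OF fin] sub]) (use x in simp)
  also have "\<dots> \<le> (\<Sum>z\<in>T. x ^ (length (?g z) - 2))"
    using sum_image_le[OF fin, of "\<lambda>q. x ^ (length q - 2)" ?g] x by (simp add: o_def)
  also have "\<dots> \<le> (\<Sum>(s, m, e)\<in>T. M * (x ^ (length m - 2) * M))"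
  proof (rule sum_mono)
    fix y assume "y \<in> T"
    moreover obtain s m e where y: "y = (s, m, e)" by (cases y)
    ultimately have t: "(s, m, e) \<in> T" by simp
    hence "length m \<ge> 2" using mid_path_lifts(1)[OF p, of m] by (simp add: T_def mid_path_def)
    hence "length (s @ m @ e) - 2 = length s + ((length m - 2) + length e)" by simp
    hence "x ^ (length (s @ m @ e) - 2) = x ^ length s * (x ^ (length m - 2) * x ^ length e)"
      by (simp add: power_add)
    moreover have le: "x ^ length u \<le> M" if "length u \<le> 3" for u :: "'a fisher_vertex list"
    proof (cases "x \<le> 1")
      case True
      thus ?thesis using x power_le_one[of x "length u"] by (simp add: M_def)
    next
      case False
      thus ?thesis using that power_increasing[of "length u" 3 x] by (simp add: M_def)
    qed
    moreover have "length s \<le> 3" "length e \<le> 3" using t by (auto simp: T_def triangle_ext_def)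
    moreover have "M \<ge> 0" by (simp add: M_def)
    ultimately have "x ^ (length (s @ m @ e) - 2) \<le> M * (x ^ (length m - 2) * M)"
      using x by (auto intro!: mult_mono)
    thus "x ^ (length (?g y) - 2) \<le> (case y of (s, m, e) \<Rightarrow> M * (x ^ (length m - 2) * M))"
      by (simp add: y)
  qed
  also have "\<dots> = (\<Sum>s\<in>triangle_ext (hd p). \<Sum>m\<in>lifts p. \<Sum>e\<in>triangle_ext (last p). M * (x ^ (length m - 2) * M))"
    by (simp only: T_def sum.cartesian_product)
  also have "\<dots> = (real (card (triangle_ext (hd p))) * M) * (real (card (triangle_ext (last p))) * M)
      * (\<Sum>m\<in>lifts p. x ^ (length m - 2))"
    by (simp add: sum_distrib_left sum_distrib_right mult_ac)
  also have "\<dots> \<le> (40 * M) * (40 * M) * (\<Sum>m\<in>lifts p. x ^ (length m - 2))"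
    using card_triangle_ext[of "hd p"] card_triangle_ext[of "last p"] x
    by (intro mult_right_mono mult_mono sum_nonneg) (auto simp: M_def)
  finally show ?thesis by (simp add: M_def power2_eq_square)
qed

text \<open>The constant is fixed before the sets and weights. This uniformity is used for \<eta>,
  where the sets of walks vary with the automorphism, and the free weight \<open>g\<close> later
  carries powers of the length and displacements.\<close>

lemma proj_infsum_le:
  assumes x: "x > 0"
  shows "\<exists>C::real>0. \<forall>A A' f g.
    (\<forall>q\<in>A'. mid_path F q \<and> length (proj q) \<ge> 2 \<and> proj q \<in> A \<and>
      f q \<le> ennreal (x ^ (length q - 2)) * g (proj q)) \<longrightarrow>
    infsum f A' \<le> ennreal C * infsum (\<lambda>p. ennreal (rate x ^ (length p - 2)) * g p) A"
proof -
  obtain c where c: "c \<ge> 1"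
    "\<And>p. mid_path G p \<Longrightarrow> (\<Sum>m\<in>lifts p. x ^ (length m - 2)) \<le> c * rate x ^ (length p - 2)"
    using lifts_sum_bounds[OF x] by metis
  define C where "C = (40 * max 1 (x ^ 3))\<^sup>2 * c"
  have pos: "C > 0" using c(1) by (auto simp: C_def)
  have bound: "infsum f A' \<le> ennreal C * infsum (\<lambda>p. ennreal (rate x ^ (length p - 2)) * g p) A"
    if *: "\<forall>q\<in>A'. mid_path F q \<and> length (proj q) \<ge> 2 \<and> proj q \<in> A \<and>
      f q \<le> ennreal (x ^ (length q - 2)) * g (proj q)" for A A' f g
  proof (rule infsum_le_fibrewise[where p = proj])
    have A: "mid_path F q \<and> length (proj q) \<ge> 2 \<and> proj q \<in> A"
      and f: "f q \<le> ennreal (x ^ (length q - 2)) * g (proj q)" if "q \<in> A'" for q using * that by auto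
    fix p Q assume p: "p \<in> A" and Q: "finite Q" "Q \<subseteq> {q \<in> A'. proj q = p}"
    show "sum f Q \<le> ennreal C * (ennreal (rate x ^ (length p - 2)) * g p)"
    proof (cases "Q = {}")
      case False
      then obtain q where "q \<in> A'" "proj q = p" using Q by auto
      hence mp: "mid_path G p" using A mid_path_proj by blast
      have "sum f Q \<le> (\<Sum>q\<in>Q. ennreal (x ^ (length q - 2)) * g p)"
        by (intro sum_mono) (use f Q in auto)
      also have "\<dots> = ennreal (\<Sum>q\<in>Q. x ^ (length q - 2)) * g p"
        using x by (simp add: sum_distrib_right[symmetric])
      also have "(\<Sum>q\<in>Q. x ^ (length q - 2)) \<le> C * rate x ^ (length p - 2)"
      proof -
        have "(\<Sum>q\<in>Q. x ^ (length q - 2)) \<le> (40 * max 1 (x ^ 3))\<^sup>2 * (\<Sum>m\<in>lifts p. x ^ (length m - 2))"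
          by (rule fibre_sum_le[OF x Q(1) _ mp]) (use Q A in auto)
        also have "\<dots> \<le> (40 * max 1 (x ^ 3))\<^sup>2 * (c * rate x ^ (length p - 2))"
          by (intro mult_left_mono c(2) mp) auto
        finally show ?thesis by (simp add: C_def)
      qed
      hence "ennreal (\<Sum>q\<in>Q. x ^ (length q - 2)) * g p \<le> ennreal (C * rate x ^ (length p - 2)) * g p"
        by (intro mult_right_mono ennreal_leI) auto
      also have "\<dots> = ennreal C * (ennreal (rate x ^ (length p - 2)) * g p)"
        using \<open>C > 0\<close> rate_pos[OF x] by (simp add: ennreal_mult mult.assoc)
      finally show ?thesis .
    qed simp
  qed (use * in auto)
  show ?thesis using pos bound by blast
qed

text \<open>Lifts of different walks are disjoint because \<open>proj\<close> recovers the walk, so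
  the lifts of \<open>p\<close> serve as a finite part of the fibre over \<open>p\<close>.\<close>

lemma lifts_infsum_ge:
  assumes x: "x > 0"
  shows "\<exists>C::real>0. \<forall>A A' f g.
    (\<forall>p\<in>A. mid_path G p \<and> (\<forall>m\<in>lifts p. m \<in> A' \<and> ennreal (x ^ (length m - 2)) * g p \<le> f m)) \<longrightarrow>
    infsum (\<lambda>p. ennreal (rate x ^ (length p - 2)) * g p) A \<le> ennreal C * infsum f A'"
proof -
  obtain c where c: "c \<ge> 1"
    "\<And>p. mid_path G p \<Longrightarrow> rate x ^ (length p - 2) \<le> c * (\<Sum>m\<in>lifts p. x ^ (length m - 2))"
    using lifts_sum_bounds[OF x] by metis
  have bound: "infsum (\<lambda>p. ennreal (rate x ^ (length p - 2)) * g p) A \<le> ennreal c * infsum f A'"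
    if *: "\<forall>p\<in>A. mid_path G p \<and> (\<forall>m\<in>lifts p. m \<in> A' \<and> ennreal (x ^ (length m - 2)) * g p \<le> f m)"
      for A A' f g
  proof (rule infsum_ge_fibrewise[where p = proj and S = lifts])
    have A: "mid_path G p" and A': "m \<in> lifts p \<Longrightarrow> m \<in> A'"
      and f: "m \<in> lifts p \<Longrightarrow> ennreal (x ^ (length m - 2)) * g p \<le> f m" if "p \<in> A" for p m
      using * that by auto
    fix p assume p: "p \<in> A"
    show "finite (lifts p)" by (rule finite_lifts)
    show "lifts p \<subseteq> {a \<in> A'. proj a = p}" using A[OF p] A'[OF p] mid_path_lifts(2) by auto
    have "ennreal (rate x ^ (length p - 2)) * g p \<le> ennreal (c * (\<Sum>m\<in>lifts p. x ^ (length m - 2))) * g p"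
      by (intro mult_right_mono ennreal_leI c(2) A p) auto
    also have "\<dots> = ennreal c * (\<Sum>m\<in>lifts p. ennreal (x ^ (length m - 2)) * g p)"
      using x c(1) by (simp add: ennreal_mult sum_nonneg mult.assoc sum_distrib_right[symmetric])
    also have "\<dots> \<le> ennreal c * sum f (lifts p)"
      by (intro mult_left_mono sum_mono f p) auto
    finally show "ennreal (rate x ^ (length p - 2)) * g p \<le> ennreal c * sum f (lifts p)" .
  qed
  have pos: "c > 0" using c(1) by simp
  show ?thesis using pos bound by blast
qed

end


section \<open>Generating functions and automorphisms\<close>

lemma distinct_path_edges_if_distinct: "distinct p \<Longrightarrow> distinct (path_edges p)"
proof (induction p rule: path_edges.induct)
  case (3 a b p)
  have "{a, b} \<notin> set (path_edges (b # p))" using Union_path_edges[of "b # p"] 3(2) by auto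
  thus ?case using 3 by simp
qed auto

lemma exists_inner_form: "length p \<ge> 2 \<Longrightarrow> \<exists>a s b. p = a # s @ [b]"
  by (cases p; cases "tl p" rule: rev_cases) auto

lemma infsum_ennreal_summable_less_top:
  fixes h :: "nat \<Rightarrow> real"
  assumes "summable h" "\<And>n. h n \<ge> 0"
  shows "infsum (\<lambda>n. ennreal (h n)) A < \<infinity>"
proof -
  have "infsum (\<lambda>n. ennreal (h n)) A \<le> ennreal (suminf h)"
  proof (rule infsum_le_finite_sums)
    fix F assume "finite F" "F \<subseteq> A"
    thus "(\<Sum>n\<in>F. ennreal (h n)) \<le> ennreal (suminf h)"
      using assms by (simp add: sum_ennreal ennreal_leI sum_le_suminf)
  qed simp
  thus ?thesis by (simp add: le_less_trans[OF _ ennreal_less_top])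
qed

text \<open>\<open>W'\<close> constrains the final edge; \<open>verts H\<close> in its place admits
  every final edge. At least three vertices means positive walk length.\<close>

definition mid_paths :: "'a ugraph \<Rightarrow> 'a set \<Rightarrow> 'a set \<Rightarrow> 'a list set" where
  "mid_paths H W W' = {p. mid_path H p \<and> length p \<ge> 3 \<and>
     hd (path_edges p) \<inter> W \<noteq> {} \<and> last (path_edges p) \<inter> W' \<noteq> {}}"

context qt_graph
begin

lemma finite_mid_paths_length:
  assumes "finite W"
  shows "finite {p \<in> mid_paths H W W'. length p \<le> n}"
proof -
  let ?U = "W \<union> (\<Union>w\<in>W. nbrs H w)"
  have "{p \<in> mid_paths H W W'. length p \<le> n} \<subseteq>
      (\<Union>v\<in>?U. \<Union>k\<le>n. {p. walk H p \<and> hd p = v \<and> length p = Suc k})"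
  proof
    fix p assume "p \<in> {p \<in> mid_paths H W W'. length p \<le> n}"
    hence p: "walk H p" "length p \<ge> 3" "length p \<le> n" "hd (path_edges p) \<inter> W \<noteq> {}"
      by (auto simp: mid_paths_def mid_path_def)
    obtain a b q where q: "p = a # b # q" using p(2) by (cases p rule: path_edges.cases) auto
    have "{b, a} \<in> edges H" using p(1) q by (auto simp: walk_Cons_iff insert_commute)
    hence "a \<in> ?U" using p(4) q by (auto simp: nbrs_def)
    moreover have "length p = Suc (length p - 1)" "length p - 1 \<le> n" using p by auto
    ultimately show "p \<in> (\<Union>v\<in>?U. \<Union>k\<le>n. {p. walk H p \<and> hd p = v \<and> length p = Suc k})"
      using p(1) q by (intro UN_I[of a] UN_I[of "length p - 1"]) auto
  qed
  thus ?thesis by (rule finite_subset) (use assms finite_nbrs finite_walks_from in auto)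
qed

text \<open>Degrees are dominated by the counts of one-step walks, whose maximum exists by
  quasi-transitivity.\<close>

lemma bounded_degree: "\<exists>D::nat. \<forall>v\<in>verts H. card (nbrs H v) \<le> D"
proof -
  have "real (card (nbrs H v)) \<le> max_saw_count 1" if v: "v \<in> verts H" for v
  proof -
    have "card (nbrs H v) \<le> card (saws_from H v 1)"
    proof (rule card_inj_on_le[of "\<lambda>u. [v, u]"])
      show "(\<lambda>u. [v, u]) ` nbrs H v \<subseteq> saws_from H v 1"
        using simple_graphD[OF simple] by (auto simp: nbrs_def saws_from_def walk_Cons_iff)
    qed (auto simp: inj_on_def finite_saws)
    thus ?thesis using saw_count_le_max[OF v, of 1] by (simp add: saw_count_def)
  qed
  hence "\<forall>v\<in>verts H. card (nbrs H v) \<le> nat \<lfloor>max_saw_count 1\<rfloor>" by (simp add: le_nat_floor)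
  thus ?thesis by blast
qed

text \<open>The vertex list of a self-avoiding walk satisfies more than is asked: even its outer
  vertices are distinct from all others.\<close>

lemma saws_subset_mid_paths:
  assumes "v \<in> W" and n: "n \<ge> 2"
  shows "saws_from H v n \<subseteq> mid_paths H W (verts H)"
proof
  fix p assume "p \<in> saws_from H v n"
  hence p: "walk H p" "distinct p" "hd p = v" "length p = Suc n" by (auto simp: saws_from_def)
  have "distinct (butlast (tl p))" using p(2) by (simp add: distinct_butlast distinct_tl)
  moreover have "length p \<ge> 2" using p n by simp
  moreover have "last (path_edges p) \<subseteq> set p" "last (path_edges p) \<noteq> {}"
  proof -
    have "last (path_edges p) \<in> set (path_edges p)" using p n by (intro last_in_set) auto
    thus "last (path_edges p) \<subseteq> set p" using Union_path_edges[of p] by auto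
    have "last (path_edges p) = hd (path_edges (rev p))" using p n by (simp add: path_edges_rev hd_rev)
    thus "last (path_edges p) \<noteq> {}" using hd_path_edges[of "rev p"] p n by auto
  qed
  ultimately show "p \<in> mid_paths H W (verts H)"
    using p n assms(1) distinct_path_edges_if_distinct[of p] hd_path_edges[of p]
    by (auto simp: mid_paths_def mid_path_def walk_def)
qed

text \<open>The self-avoiding walks from the single vertex \<open>v\<close> already make the sum
  exceed every bound.\<close>

lemma mid_paths_infsum_infinite:
  assumes "v \<in> W" "v \<in> verts H" and x: "x > 1 / connective_constant H"
  shows "infsum (\<lambda>p. ennreal (x ^ (length p - 2))) (mid_paths H W (verts H)) = \<infinity>"
proof -
  have "0 < 1 / connective_constant H" using connective_constant_ge_1 by simp
  hence "x > 0" using x by linarith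
  have ge: "ennreal b \<le> infsum (\<lambda>p. ennreal (x ^ (length p - 2))) (mid_paths H W (verts H))" for b
  proof -
    \<comment> \<open>A walk with \<open>n\<close> steps has \<open>n + 1\<close> vertices and hence
      mid-edge length \<open>n - 1\<close>; the additional factor \<open>x\<close> compensates for
      this.\<close>
    obtain n where n: "n \<ge> 2" "saw_count v n * x ^ n \<ge> b * x"
      using saw_count_unbounded_above_radius[OF assms(2) x] by blast
    have sub: "saws_from H v n \<subseteq> mid_paths H W (verts H)"
      by (rule saws_subset_mid_paths) (use assms n in auto)
    have "b \<le> saw_count v n * x ^ (n - 1)"
    proof -
      have "x ^ n = x ^ (n - 1) * x" using n(1) by (metis One_nat_def Suc_le_D Suc_1 diff_Suc_1 power_Suc2)
      thus ?thesis using n(2) \<open>x > 0\<close> by (simp add: mult.assoc[symmetric])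
    qed
    hence "ennreal b \<le> ennreal (\<Sum>p\<in>saws_from H v n. x ^ (length p - 2))"
      by (intro ennreal_leI) (simp add: saws_from_def saw_count_def)
    also have "\<dots> = (\<Sum>p\<in>saws_from H v n. ennreal (x ^ (length p - 2)))"
      using \<open>x > 0\<close> by (simp add: sum_ennreal)
    also have "\<dots> \<le> infsum (\<lambda>p. ennreal (x ^ (length p - 2))) (mid_paths H W (verts H))"
      by (rule sum_le_infsum_ennreal[OF finite_saws sub])
    finally show ?thesis .
  qed
  show ?thesis
  proof (cases "infsum (\<lambda>p. ennreal (x ^ (length p - 2))) (mid_paths H W (verts H))")
    case (real r)
    thus ?thesis using ge[of "r + 1"] by (simp add: ennreal_le_iff)
  qed simp
qed

text \<open>The inner vertices form a self-avoiding walk, and bounded degree leaves boundedly many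
  choices for each outer vertex. So the sum is dominated by the generating functions of walks from
  finitely many vertices.\<close>

lemma mid_paths_infsum_finite:
  assumes "finite W" "W \<subseteq> verts H" and x: "0 < x" "x < 1 / connective_constant H"
  shows "infsum (\<lambda>p. ennreal (x ^ (length p - 2))) (mid_paths H W W') < \<infinity>"
proof -
  \<comment> \<open>The first inner vertex may be either end of the initial edge, hence the
    neighbours of \<open>W\<close>.\<close>
  define U where "U = W \<union> (\<Union>w\<in>W. nbrs H w)"
  have U: "finite U" "U \<subseteq> verts H"
    using assms finite_nbrs simple_graphD[OF simple] by (auto simp: U_def nbrs_def)
  obtain D where D: "\<And>v. v \<in> verts H \<Longrightarrow> card (nbrs H v) \<le> D" using bounded_degree by blast
  define S where "S = (\<Union>v\<in>U. \<Union>n. saws_from H v n)"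
  have form: "\<exists>a b. p = a # butlast (tl p) @ [b] \<and> butlast (tl p) \<in> S \<and> a \<in> nbrs H (hd (butlast (tl p))) \<and>
      b \<in> nbrs H (last (butlast (tl p)))" if pW: "p \<in> mid_paths H W W'" for p
  proof -
    from pW have p: "walk H p" "length p \<ge> 3" "hd (path_edges p) \<inter> W \<noteq> {}" "distinct (butlast (tl p))"
      by (auto simp: mid_paths_def mid_path_def)
    obtain a s b where q: "p = a # s @ [b]" using exists_inner_form[of p] p(2) by auto
    have "s \<noteq> []" using p(2) q by auto
    have w: "walk H s" "{a, hd s} \<in> edges H" "{last s, b} \<in> edges H"
      using p(1) q \<open>s \<noteq> []\<close> by (auto simp: walk_Cons_iff walk_append_iff)
    have "hd s \<in> U" using p(3) q w(2) hd_path_edges[of p] \<open>s \<noteq> []\<close>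
      by (auto simp: U_def nbrs_def hd_append)
    moreover have "s \<in> saws_from H (hd s) (length s - 1)"
      using w p(4) q \<open>s \<noteq> []\<close> by (simp add: saws_from_def)
    ultimately have "s \<in> S" by (auto simp: S_def)
    thus ?thesis using q w by (auto simp: nbrs_def insert_commute)
  qed
  have "infsum (\<lambda>p. ennreal (x ^ (length p - 2))) (mid_paths H W W')
      \<le> ennreal (real D * real D) * infsum (\<lambda>s. ennreal (x ^ length s)) S"
  proof (rule infsum_le_fibrewise[where p = "\<lambda>p. butlast (tl p)"])
    show "(\<lambda>p. butlast (tl p)) ` mid_paths H W W' \<subseteq> S" using form by blast
  next
    fix s P assume s: "s \<in> S" and P: "finite P" "P \<subseteq> {p \<in> mid_paths H W W'. butlast (tl p) = s}"
    have sw: "walk H s" "s \<noteq> []" using s by (auto simp: S_def saws_from_def walk_def)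
    have "P \<subseteq> (\<lambda>(a, b). a # s @ [b]) ` (nbrs H (hd s) \<times> nbrs H (last s))"
    proof
      fix p assume "p \<in> P"
      hence "p \<in> mid_paths H W W'" "butlast (tl p) = s" using P by auto
      with form[of p] obtain a b where "p = a # s @ [b]" "a \<in> nbrs H (hd s)" "b \<in> nbrs H (last s)" by auto
      thus "p \<in> (\<lambda>(a, b). a # s @ [b]) ` (nbrs H (hd s) \<times> nbrs H (last s))" by auto
    qed
    hence "card P \<le> card (nbrs H (hd s) \<times> nbrs H (last s))"
      by (rule surj_card_le[rotated]) (simp add: finite_nbrs)
    also have "\<dots> \<le> D * D"
      using D[OF hd_in_verts[OF sw(1)]] D[OF last_in_verts[OF sw(1)]]
      by (simp add: card_cartesian_product mult_le_mono)
    finally have "real (card P) \<le> real D * real D" by (metis of_nat_le_iff of_nat_mult)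
    have "(\<Sum>p\<in>P. ennreal (x ^ (length p - 2))) = (\<Sum>p\<in>P. ennreal (x ^ length s))"
    proof (rule sum.cong)
      fix p assume "p \<in> P"
      hence "butlast (tl p) = s" using P by auto
      hence "length p - 2 = length s" by auto
      thus "ennreal (x ^ (length p - 2)) = ennreal (x ^ length s)" by simp
    qed simp
    also have "\<dots> = ennreal (real (card P)) * ennreal (x ^ length s)" by (simp add: ennreal_of_nat_eq_real_of_nat)
    also have "\<dots> \<le> ennreal (real D * real D) * ennreal (x ^ length s)"
      using \<open>real (card P) \<le> real D * real D\<close> by (intro mult_right_mono ennreal_leI) auto
    finally show "(\<Sum>p\<in>P. ennreal (x ^ (length p - 2))) \<le> ennreal (real D * real D) * ennreal (x ^ length s)" .
  qed
  also have "infsum (\<lambda>s. ennreal (x ^ length s)) S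
      \<le> 1 * infsum (\<lambda>n. ennreal (\<Sum>v\<in>U. saw_count v n * x ^ n * x)) (UNIV :: nat set)"
  proof (rule infsum_le_fibrewise[where p = "\<lambda>s. length s - 1"])
    fix n P assume P: "finite P" "P \<subseteq> {s \<in> S. length s - 1 = n}"
    have len: "length s = Suc n" if "s \<in> P" for s
      using P(2) that by (auto simp: S_def saws_from_def)
    have "P \<subseteq> (\<Union>v\<in>U. saws_from H v n)"
      using P(2) by (auto simp: S_def saws_from_def)
    hence "card P \<le> card (\<Union>v\<in>U. saws_from H v n)" using U finite_saws by (intro card_mono) auto
    also have "\<dots> \<le> (\<Sum>v\<in>U. card (saws_from H v n))" using U(1) by (rule card_UN_le)
    finally have c: "real (card P) \<le> (\<Sum>v\<in>U. saw_count v n)"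
      unfolding saw_count_def by (metis of_nat_le_iff of_nat_sum)
    have "(\<Sum>s\<in>P. ennreal (x ^ length s)) = ennreal (real (card P) * (x ^ n * x))"
      using x len by (simp add: ennreal_mult ennreal_of_nat_eq_real_of_nat mult.commute)
    also have "\<dots> \<le> ennreal ((\<Sum>v\<in>U. saw_count v n) * (x ^ n * x))"
      using c x by (intro ennreal_leI mult_right_mono) auto
    also have "(\<Sum>v\<in>U. saw_count v n) * (x ^ n * x) = (\<Sum>v\<in>U. saw_count v n * x ^ n * x)"
      by (simp add: sum_distrib_right mult.assoc)
    finally show "(\<Sum>s\<in>P. ennreal (x ^ length s)) \<le> 1 * ennreal (\<Sum>v\<in>U. saw_count v n * x ^ n * x)" by simp
  qed simp
  finally have le: "infsum (\<lambda>p. ennreal (x ^ (length p - 2))) (mid_paths H W W')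
      \<le> ennreal (real D * real D) * infsum (\<lambda>n. ennreal (\<Sum>v\<in>U. saw_count v n * x ^ n * x)) (UNIV :: nat set)"
    by (simp add: mult_left_mono)
  have "infsum (\<lambda>n. ennreal (\<Sum>v\<in>U. saw_count v n * x ^ n * x)) (UNIV :: nat set) < \<infinity>"
  proof (rule infsum_ennreal_summable_less_top)
    show "summable (\<lambda>n. \<Sum>v\<in>U. saw_count v n * x ^ n * x)"
      by (intro summable_sum summable_mult2 saw_count_summable_below_radius) (use U x in auto)
  qed (use x in \<open>auto intro!: sum_nonneg simp: saw_count_def\<close>)
  hence "ennreal (real D * real D) *
      infsum (\<lambda>n. ennreal (\<Sum>v\<in>U. saw_count v n * x ^ n * x)) (UNIV :: nat set) < \<infinity>"
    by (simp add: ennreal_mult_less_top)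
  with le show ?thesis by (rule le_less_trans)
qed

end

lemma base_map_fisher_vertex [simp]: "base (map_fisher_vertex \<phi> a) = \<phi> (base a)"
  by (cases a) auto

context fisher_setting
begin

section \<open>The Fisher graph as a quasi-transitive graph\<close>

lemma same_base_adjacent:
  assumes "a \<in> verts F" "b \<in> verts F" "base a = base b" "a \<noteq> b"
  shows "{a, b} \<in> edges F"
proof (cases "base a \<in> B")
  case True
  define v where "v = base b"
  have v: "base a = v" "base b = v" "v \<in> B" using True assms(3) by (auto simp: v_def)
  obtain s where s: "s \<in> nbrs G v" "a = Tri v s" using black_vertex[OF assms(1) v(1,3)] by auto
  obtain t where t: "t \<in> nbrs G v" "b = Tri v t" using black_vertex[OF assms(2) v(2,3)] by auto
  show ?thesis unfolding s(2) t(2) using assms(4) s t v(3) by (intro tri_edge) auto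
next
  case False
  have "a = Keep (base b)" by (rule white_vertex) (use assms False in auto)
  moreover have "b = Keep (base b)" by (rule white_vertex) (use assms False in auto)
  ultimately have "a = b" by (rule trans[OF _ sym])
  thus ?thesis using assms(4) by blast
qed

text \<open>At each vertex of \<open>p\<close>, one step inside its triangle is enough to reach the
  corner where the walk continues, whence the factor 2.\<close>

lemma lift_walk:
  "walk G p \<Longrightarrow> a \<in> verts F \<Longrightarrow> b \<in> verts F \<Longrightarrow> base a = hd p \<Longrightarrow> base b = last p \<Longrightarrow>
    \<exists>q. walk F q \<and> hd q = a \<and> last q = b \<and> length q \<le> 2 * length p"
proof (induction p arbitrary: a rule: path_edges.induct)
  case 1
  thus ?case by (simp add: walk_def)
next
  case (2 u)
  show ?case
  proof (cases "a = b")
    case True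
    thus ?thesis using 2 by (intro exI[of _ "[a]"]) (auto simp: walk_def)
  next
    case False
    thus ?thesis using 2 same_base_adjacent[of a b]
      by (intro exI[of _ "[a, b]"]) (auto simp: walk_Cons_iff)
  qed
next
  case (3 u w p)
  have e: "{u, w} \<in> edges G" "{w, u} \<in> edges G" "walk G (w # p)"
    using 3(2) by (auto simp: walk_Cons_iff insert_commute)
  obtain q where q: "walk F q" "hd q = edge_end w u" "last q = b" "length q \<le> 2 * length (w # p)"
    using 3(1)[OF e(3) edge_end_in_fisher[OF e(2)] 3(4)] 3(6) by auto
  have "q \<noteq> []" using q(1) by (auto simp: walk_def)
  have w1: "walk F (edge_end u w # q)"
    using q(1,2) orig_edge[OF e(1)] edge_end_in_fisher[OF e(1)] by (simp add: walk_Cons_iff)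
  show ?case
  proof (cases "a = edge_end u w")
    case True
    thus ?thesis using w1 q \<open>q \<noteq> []\<close> by (intro exI[of _ "edge_end u w # q"]) auto
  next
    case False
    hence "{a, edge_end u w} \<in> edges F"
      using 3(3,5) edge_end_in_fisher[OF e(1)] by (intro same_base_adjacent) auto
    hence "walk F (a # edge_end u w # q)" using w1 3(3) by (simp add: walk_Cons_iff)
    thus ?thesis using q \<open>q \<noteq> []\<close> by (intro exI[of _ "a # edge_end u w # q"]) auto
  qed
qed

lemma fisher_verts_iff:
  assumes "W \<subseteq> verts G"
  shows "a \<in> fisher_verts G B W \<longleftrightarrow> a \<in> verts F \<and> base a \<in> W"
  using assms by (cases a) (auto simp: fisher_verts_def nbrs_def)

lemma fisher_verts_lift:
  assumes "v \<in> W" "W \<subseteq> verts G"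
  obtains a where "a \<in> fisher_verts G B W" "base a = v"
proof (cases "v \<in> B")
  case True
  hence "nbrs G v \<noteq> {}" using card_nbrs_black by fastforce
  then obtain u where "u \<in> nbrs G v" by blast
  thus ?thesis using True assms by (intro that[of "Tri v u"]) (auto simp: fisher_verts_iff)
next
  case False
  thus ?thesis using assms by (intro that[of "Keep v"]) (auto simp: fisher_verts_iff)
qed

lemma fisher_connected: "graph_connected F"
  unfolding graph_connected_def
proof (intro ballI)
  fix a b assume ab: "a \<in> verts F" "b \<in> verts F"
  then obtain p where "walk G p" "hd p = base a" "last p = base b"
    using conn base_in_verts unfolding graph_connected_def by blast
  thus "\<exists>q. walk F q \<and> hd q = a \<and> last q = b" using lift_walk[of p a b] ab by auto
qed

lemma fisher_infinite: "infinite (verts F)"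
proof
  assume "finite (verts F)"
  hence "finite (base ` verts F)" by simp
  moreover have "verts G \<subseteq> base ` verts F"
  proof
    fix v assume "v \<in> verts G"
    then obtain a where "a \<in> fisher_verts G B (verts G)" "base a = v" using fisher_verts_lift by blast
    thus "v \<in> base ` verts F" by (auto simp: fisher_def)
  qed
  ultimately show False using inf finite_subset by blast
qed

lemma fisher_locally_finite: "locally_finite F"
  unfolding locally_finite_def
proof
  fix a
  have "nbrs F a \<subseteq> (\<lambda>v. edge_end v (base a)) ` nbrs G (base a) \<union> Tri (base a) ` nbrs G (base a)"
  proof
    fix b assume "b \<in> nbrs F a"
    hence "{a, b} \<in> edges F" by (simp add: nbrs_def)
    thus "b \<in> (\<lambda>v. edge_end v (base a)) ` nbrs G (base a) \<union> Tri (base a) ` nbrs G (base a)"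
      by (cases rule: fisher_edge_cases) (auto simp: nbrs_def)
  qed
  hence "finite (nbrs F a)" by (rule finite_subset) (simp add: finite_nbrs)
  thus "finite (incident_edges F {a})" by (simp add: incident_edges_singleton[OF simple_fisher])
qed

lemma coloured_automorphismsD:
  assumes "\<phi> \<in> coloured_automorphisms G B"
  shows "\<phi> \<in> automorphisms G" "v \<in> verts G \<Longrightarrow> \<phi> v \<in> B \<longleftrightarrow> v \<in> B"
  using assms by (auto simp: coloured_automorphisms_def)

lemma inv_coloured_automorphism:
  assumes "\<phi> \<in> coloured_automorphisms G B"
  shows "inv_into (verts G) \<phi> \<in> coloured_automorphisms G B"
proof -
  note \<phi> = coloured_automorphismsD[OF assms]
  have "inv_into (verts G) \<phi> v \<in> B \<longleftrightarrow> v \<in> B" if "v \<in> verts G" for v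
  proof -
    have "v \<in> \<phi> ` verts G" using that automorphismsD(2)[OF \<phi>(1)] by simp
    thus ?thesis using \<phi>(2)[of "inv_into (verts G) \<phi> v"] by (simp add: f_inv_into_f inv_into_into)
  qed
  thus ?thesis using inv_automorphism[OF \<phi>(1)] by (simp add: coloured_automorphisms_def)
qed

lemma map_fisher_vertex_verts:
  assumes "\<phi> \<in> coloured_automorphisms G B" "a \<in> verts F"
  shows "map_fisher_vertex \<phi> a \<in> verts F"
  using assms(2) automorphismsD[OF coloured_automorphismsD(1)[OF assms(1)]] B_verts
    coloured_automorphismsD(2)[OF assms(1)] simple_graphD[OF simple]
  by (cases a) (auto simp: nbrs_def)

lemma map_fisher_vertex_inverse:
  assumes "\<phi> \<in> coloured_automorphisms G B" "a \<in> verts F"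
  shows "map_fisher_vertex (inv_into (verts G) \<phi>) (map_fisher_vertex \<phi> a) = a"
    "map_fisher_vertex \<phi> (map_fisher_vertex (inv_into (verts G) \<phi>) a) = a"
proof -
  note au = automorphismsD[OF coloured_automorphismsD(1)[OF assms(1)]]
  have "inv_into (verts G) \<phi> (\<phi> v) = v" "\<phi> (inv_into (verts G) \<phi> v) = v" if "v \<in> verts G" for v
    using au(1,2) that by (auto simp: f_inv_into_f)
  thus "map_fisher_vertex (inv_into (verts G) \<phi>) (map_fisher_vertex \<phi> a) = a"
    "map_fisher_vertex \<phi> (map_fisher_vertex (inv_into (verts G) \<phi>) a) = a"
    using assms(2) B_verts simple_graphD[OF simple] by (cases a; auto simp: nbrs_def)+
qed

lemma map_fisher_vertex_edge:
  assumes \<phi>: "\<phi> \<in> coloured_automorphisms G B" and e: "{a, b} \<in> edges F"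
  shows "{map_fisher_vertex \<phi> a, map_fisher_vertex \<phi> b} \<in> edges F"
proof -
  note au = automorphismsD[OF coloured_automorphismsD(1)[OF \<phi>]] and col = coloured_automorphismsD(2)[OF \<phi>]
  note sg = simple_graphD[OF simple]
  have ee: "map_fisher_vertex \<phi> (edge_end v u) = edge_end (\<phi> v) (\<phi> u)" if "v \<in> verts G" for v u
    using col[OF that] by (simp add: edge_end_def)
  from e show ?thesis
  proof (cases rule: fisher_edge_cases)
    case orig
    have v: "base a \<in> verts G" "base b \<in> verts G" using sg(2,3)[OF orig(2)] by auto
    have "{\<phi> (base a), \<phi> (base b)} \<in> edges G" using au(4)[OF v] orig(2) by simp
    from orig_edge[OF this] show ?thesis using ee[OF v(1)] ee[OF v(2)] orig(3,4) by metis
  next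
    case (tri v s t)
    have v: "v \<in> verts G" "s \<in> verts G" "t \<in> verts G" using tri B_verts sg by (auto simp: nbrs_def)
    have "{Tri (\<phi> v) (\<phi> s), Tri (\<phi> v) (\<phi> t)} \<in> edges F"
      using tri v au(4)[OF v(1,2)] au(4)[OF v(1,3)] col[OF v(1)] au(1)
      by (intro tri_edge) (auto simp: nbrs_def inj_on_eq_iff)
    thus ?thesis using tri by simp
  qed
qed

text \<open>The inverse automorphism induces a two-sided inverse, so preservation of edges by both
  maps gives the equivalence. Preserved colours keep \<open>Keep\<close> over white and
  \<open>Tri\<close> over black vertices.\<close>

lemma map_fisher_vertex_automorphism:
  assumes \<phi>: "\<phi> \<in> coloured_automorphisms G B"
  shows "map_fisher_vertex \<phi> \<in> automorphisms F"
proof -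
  let ?\<psi> = "inv_into (verts G) \<phi>"
  note \<psi> = inv_coloured_automorphism[OF \<phi>] and inv = map_fisher_vertex_inverse[OF \<phi>]
  have "bij_betw (map_fisher_vertex \<phi>) (verts F) (verts F)"
    by (rule bij_betw_byWitness[where f' = "map_fisher_vertex ?\<psi>"])
      (use inv map_fisher_vertex_verts[OF \<phi>] map_fisher_vertex_verts[OF \<psi>] in auto)
  moreover have "{map_fisher_vertex \<phi> a, map_fisher_vertex \<phi> b} \<in> edges F \<longleftrightarrow> {a, b} \<in> edges F"
    if "a \<in> verts F" "b \<in> verts F" for a b
    using map_fisher_vertex_edge[OF \<phi>, of a b]
      map_fisher_vertex_edge[OF \<psi>, of "map_fisher_vertex \<phi> a" "map_fisher_vertex \<phi> b"] inv that by auto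
  ultimately show ?thesis by (simp add: automorphisms_def)
qed

lemma map_fisher_vertex_image:
  assumes \<phi>: "\<phi> \<in> coloured_automorphisms G B" and W: "W \<subseteq> verts G"
  shows "map_fisher_vertex \<phi> ` fisher_verts G B W = fisher_verts G B (\<phi> ` W)"
proof -
  note au = automorphismsD[OF coloured_automorphismsD(1)[OF \<phi>]]
  have W': "\<phi> ` W \<subseteq> verts G" using au(3) W by auto
  show ?thesis
  proof (intro set_eqI iffI)
    fix b assume b: "b \<in> fisher_verts G B (\<phi> ` W)"
    let ?a = "map_fisher_vertex (inv_into (verts G) \<phi>) b"
    from b have b': "b \<in> verts F" "base b \<in> \<phi> ` W" by (auto simp: fisher_verts_iff[OF W'])
    then obtain w where w: "w \<in> W" "base b = \<phi> w" by blast
    hence "inv_into (verts G) \<phi> (base b) = w" using au(1) W by auto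
    hence "?a \<in> fisher_verts G B W"
      using w(1) map_fisher_vertex_verts[OF inv_coloured_automorphism[OF \<phi>] b'(1)]
      by (simp add: fisher_verts_iff[OF W])
    thus "b \<in> map_fisher_vertex \<phi> ` fisher_verts G B W"
      using map_fisher_vertex_inverse(2)[OF \<phi> b'(1)] by (metis image_eqI)
  qed (use map_fisher_vertex_verts[OF \<phi>] in \<open>auto simp: fisher_verts_iff[OF W] fisher_verts_iff[OF W']\<close>)
qed

text \<open>The automorphisms induced from \<open>G\<close> suffice: one that moves
  \<open>base a\<close> into \<open>W\<close> induces one that moves \<open>a\<close> over
  \<open>W\<close>.\<close>

lemma fisher_fundamental_domain:
  assumes "fundamental_domain G (coloured_automorphisms G B) W"
  shows "fundamental_domain F (automorphisms F) (fisher_verts G B W)"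
proof -
  have W: "finite W" "W \<subseteq> verts G" "\<And>v. v \<in> verts G \<Longrightarrow> \<exists>\<phi>\<in>coloured_automorphisms G B. \<phi> v \<in> W"
    using assms by (auto simp: fundamental_domain_def)
  have "fisher_verts G B W \<subseteq> Keep ` W \<union> (\<Union>v\<in>W. Tri v ` nbrs G v)"
    by (auto simp: fisher_verts_def nbrs_def)
  hence "finite (fisher_verts G B W)" by (rule finite_subset) (use W finite_nbrs in auto)
  moreover have "\<exists>\<psi>\<in>automorphisms F. \<psi> a \<in> fisher_verts G B W" if a: "a \<in> verts F" for a
  proof -
    obtain \<phi> where \<phi>: "\<phi> \<in> coloured_automorphisms G B" "\<phi> (base a) \<in> W" using W(3) base_in_verts[OF a] by blast
    hence "map_fisher_vertex \<phi> a \<in> fisher_verts G B W"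
      using map_fisher_vertex_verts[OF \<phi>(1) a] by (simp add: fisher_verts_iff[OF W(2)])
    thus ?thesis using map_fisher_vertex_automorphism[OF \<phi>(1)] by blast
  qed
  ultimately show ?thesis using W(2) by (auto simp: fundamental_domain_def fisher_verts_iff)
qed

sublocale fisher: qt_graph F "automorphisms F"
proof
  show "quasi_transitive F (automorphisms F)"
    using qt fisher_fundamental_domain by (auto simp: quasi_transitive_def)
qed (use simple_fisher fisher_infinite fisher_connected fisher_locally_finite in auto)

lemma dist_base_le: "a \<in> verts F \<Longrightarrow> b \<in> verts F \<Longrightarrow> graph_dist G (base a) (base b) \<le> graph_dist F a b"
proof -
  assume ab: "a \<in> verts F" "b \<in> verts F"
  obtain q where q: "walk F q" "hd q = a" "last q = b" "length q = Suc (graph_dist F a b)"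
    using graph_dist_walk[OF fisher_connected ab] .
  have "q \<noteq> []" using q(1) by (auto simp: walk_def)
  hence "graph_dist G (base a) (base b) \<le> length (proj q) - 1"
    using q by (intro graph_dist_le walk_proj) (auto simp: hd_proj last_proj)
  thus ?thesis using length_proj_le[of q] q(4) by simp
qed

lemma dist_fisher_le:
  assumes "a \<in> verts F" "b \<in> verts F"
  shows "graph_dist F a b \<le> 2 * graph_dist G (base a) (base b) + 1"
proof -
  obtain p where p: "walk G p" "hd p = base a" "last p = base b" "length p = Suc (graph_dist G (base a) (base b))"
    using graph_dist_walk[OF conn] assms base_in_verts by blast
  obtain q where "walk F q" "hd q = a" "last q = b" "length q \<le> 2 * length p"
    using lift_walk[OF p(1) assms] p by auto
  thus ?thesis using graph_dist_le[of F q a b] p(4) by simp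
qed

end


section \<open>Independence of the fundamental domain\<close>

lemma last_path_edges: "length p \<ge> 2 \<Longrightarrow> last (path_edges p) = {last (butlast p), last p}"
proof -
  assume p: "length p \<ge> 2"
  obtain q z where q: "p = q @ [z]" using p by (cases p rule: rev_cases) auto
  hence "q \<noteq> []" using p by auto
  thus ?thesis using path_edges_append[of q "[z]"] q by simp
qed

lemma last_path_edges_Cons: "length p \<ge> 2 \<Longrightarrow> last (path_edges (a # p)) = last (path_edges p)"
  by (cases p rule: path_edges.cases) auto

lemma sum_UN_le_ennreal:
  fixes f :: "'b \<Rightarrow> ennreal"
  assumes "finite I" "\<And>i. i \<in> I \<Longrightarrow> finite (A i)"
  shows "sum f (\<Union>i\<in>I. A i) \<le> (\<Sum>i\<in>I. sum f (A i))"
  using assms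
proof (induction I rule: finite_induct)
  case (insert i I)
  have "sum f (A i \<union> (\<Union>i\<in>I. A i)) \<le> sum f (A i) + sum f (\<Union>i\<in>I. A i)"
    using sum.union_inter[of "A i" "\<Union>i\<in>I. A i" f] insert by (metis UnCI finite_UN insertI1 le_iff_add insertCI)
  also have "\<dots> \<le> sum f (A i) + (\<Sum>i\<in>I. sum f (A i))" using insert by (intro add_left_mono) auto
  finally show ?case using insert by simp
qed simp

text \<open>The second case of \<open>mid_dist\<close>, for different end edges, which is the
  relevant one for every walk of positive length.\<close>

definition path_disp :: "'a ugraph \<Rightarrow> 'a list \<Rightarrow> real" where
  "path_disp H p = 1 + real (graph_set_dist H (hd (path_edges p)) (last (path_edges p)))"

lemma mid_path_ends_distinct:
  assumes "mid_path H p" "length p \<ge> 3"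
  shows "hd (path_edges p) \<noteq> last (path_edges p)"
proof -
  obtain a b c q where p: "p = a # b # c # q"
    using assms(2) by (auto simp: numeral_3_eq_3 Suc_le_length_iff)
  have "hd (path_edges p) \<notin> set (path_edges (b # c # q))" using assms(1) p by (simp add: mid_path_def)
  moreover have "last (path_edges p) \<in> set (path_edges (b # c # q))"
    using p last_in_set[of "path_edges (b # c # q)"] by (simp del: path_edges.simps add: last_path_edges_Cons)
  ultimately show ?thesis by metis
qed

lemma mdisp_mid_walk_of:
  assumes "mid_path H p" "length p \<ge> 3"
  shows "real (mdisp H (mid_walk_of p)) = path_disp H p"
  using mid_path_ends_distinct[OF assms]
  by (simp add: mdisp_def mid_dist_def mstart_def mend_def mid_walk_of_def path_disp_def)

lemma mlength_mid_walk_of: "mlength (mid_walk_of p) = length p - 2"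
  by (simp add: mlength_def mid_walk_of_def)

context qt_graph
begin

lemma first_last_edge:
  assumes "mid_path H p"
  shows "hd (path_edges p) \<in> edges H" "last (path_edges p) \<in> edges H"
    "hd (path_edges p) \<subseteq> verts H" "last (path_edges p) \<subseteq> verts H"
    "hd (path_edges p) \<noteq> {}" "last (path_edges p) \<noteq> {}"
proof -
  have ne: "path_edges p \<noteq> []" using assms by (auto simp: mid_path_def)
  show *: "hd (path_edges p) \<in> edges H" "last (path_edges p) \<in> edges H"
    using mid_path_edges[OF assms] hd_in_set[OF ne] last_in_set[OF ne] by auto
  show "hd (path_edges p) \<subseteq> verts H" "last (path_edges p) \<subseteq> verts H"
    using * simple by (auto simp: simple_graph_def)
  show "hd (path_edges p) \<noteq> {}" "last (path_edges p) \<noteq> {}"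
    using * simple unfolding simple_graph_def by fastforce+
qed

lemma bij_betw_mid_paths:
  "bij_betw mid_walk_of (mid_paths H W W')
     {\<pi> \<in> mid_saws H W. mlength \<pi> \<ge> 1 \<and> mend \<pi> \<in> incident_edges H W'}"
proof -
  let ?A = "{p. mid_path H p \<and> length p \<ge> 3}"
  have b: "bij_betw mid_walk_of ?A {\<pi>. mid_saw H \<pi> \<and> mlength \<pi> \<ge> 1}" by (rule bij_betw_mid_walk_of[OF simple])
  have sub: "mid_paths H W W' \<subseteq> ?A" by (auto simp: mid_paths_def)
  have iff: "p \<in> mid_paths H W W' \<longleftrightarrow> mstart (mid_walk_of p) \<in> incident_edges H W \<and>
      mend (mid_walk_of p) \<in> incident_edges H W'" if "p \<in> ?A" for p
    using that first_last_edge[of p]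
    by (auto simp: mid_paths_def mstart_def mend_def mid_walk_of_def incident_edges_def)
  have "mid_walk_of ` mid_paths H W W' =
      {\<pi> \<in> mid_saws H W. mlength \<pi> \<ge> 1 \<and> mend \<pi> \<in> incident_edges H W'}"
  proof (intro set_eqI iffI)
    fix \<pi> assume "\<pi> \<in> mid_walk_of ` mid_paths H W W'"
    then obtain p where p: "p \<in> mid_paths H W W'" "\<pi> = mid_walk_of p" by blast
    hence "p \<in> ?A" using sub by blast
    thus "\<pi> \<in> {\<pi> \<in> mid_saws H W. mlength \<pi> \<ge> 1 \<and> mend \<pi> \<in> incident_edges H W'}"
      using iff p bij_betw_apply[OF b] by (auto simp: mid_saws_def)
  next
    fix \<pi> assume \<pi>: "\<pi> \<in> {\<pi> \<in> mid_saws H W. mlength \<pi> \<ge> 1 \<and> mend \<pi> \<in> incident_edges H W'}"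
    hence "\<pi> \<in> mid_walk_of ` ?A" using b by (auto simp: mid_saws_def bij_betw_def)
    then obtain p where p: "p \<in> ?A" "\<pi> = mid_walk_of p" by blast
    hence "p \<in> mid_paths H W W'" using iff[OF p(1)] \<pi> by (auto simp: mid_saws_def)
    thus "\<pi> \<in> mid_walk_of ` mid_paths H W W'" using p by blast
  qed
  moreover have "inj_on mid_walk_of (mid_paths H W W')"
    using inj_on_subset[OF bij_betw_imp_inj_on[OF b] sub] .
  ultimately show ?thesis by (simp add: bij_betw_def)
qed

lemma mend_incident_verts: "mid_saw H \<pi> \<Longrightarrow> mend \<pi> \<in> incident_edges H (verts H)"
proof -
  assume \<pi>: "mid_saw H \<pi>"
  obtain vs es where [simp]: "\<pi> = (vs, es)" by (cases \<pi>)
  have "es \<noteq> []" "set es \<subseteq> edges H" using \<pi> by (auto simp: mid_saw_def)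
  hence "last es \<in> edges H" using last_in_set by blast
  moreover from this have "last es \<subseteq> verts H" "last es \<noteq> {}"
    using simple unfolding simple_graph_def by fastforce+
  ultimately show ?thesis by (auto simp: mend_def incident_edges_def)
qed

lemma bij_betw_mid_paths_verts:
  "bij_betw mid_walk_of (mid_paths H W (verts H)) {\<pi> \<in> mid_saws H W. mlength \<pi> \<ge> 1}"
proof -
  have "{\<pi> \<in> mid_saws H W. mlength \<pi> \<ge> 1 \<and> mend \<pi> \<in> incident_edges H (verts H)} =
      {\<pi> \<in> mid_saws H W. mlength \<pi> \<ge> 1}"
    using mend_incident_verts by (auto simp: mid_saws_def)
  thus ?thesis using bij_betw_mid_paths[of W "verts H"] by simp
qed

definition mid_paths_n :: "'a set \<Rightarrow> nat \<Rightarrow> 'a list set" where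
  "mid_paths_n W n = {p \<in> mid_paths H W (verts H). length p = n + 2}"

lemma finite_mid_paths_n: "finite W \<Longrightarrow> finite (mid_paths_n W n)"
  by (rule finite_subset[OF _ finite_mid_paths_length[of W "verts H" "n + 2"]]) (auto simp: mid_paths_n_def)

lemma bij_betw_mid_paths_n:
  assumes "n \<ge> 1"
  shows "bij_betw mid_walk_of (mid_paths_n W n) (mid_saws_n H W n)"
proof -
  have "mid_walk_of ` mid_paths_n W n = mid_saws_n H W n"
  proof (intro set_eqI iffI)
    fix \<pi> assume "\<pi> \<in> mid_walk_of ` mid_paths_n W n"
    thus "\<pi> \<in> mid_saws_n H W n"
      using bij_betw_apply[OF bij_betw_mid_paths_verts[of W]]
      by (auto simp: mid_paths_n_def mid_saws_n_def mlength_mid_walk_of)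
  next
    fix \<pi> assume \<pi>: "\<pi> \<in> mid_saws_n H W n"
    hence "\<pi> \<in> mid_walk_of ` mid_paths H W (verts H)"
      using bij_betw_mid_paths_verts[of W] assms by (auto simp: bij_betw_def mid_saws_n_def)
    then obtain p where p: "p \<in> mid_paths H W (verts H)" "\<pi> = mid_walk_of p" by blast
    hence "length p = n + 2" using \<pi> assms by (auto simp: mid_saws_n_def mlength_mid_walk_of)
    thus "\<pi> \<in> mid_walk_of ` mid_paths_n W n" using p by (auto simp: mid_paths_n_def)
  qed
  moreover have "inj_on mid_walk_of (mid_paths_n W n)"
    by (rule inj_on_subset[OF bij_betw_imp_inj_on[OF bij_betw_mid_paths_verts[of W]]])
      (auto simp: mid_paths_n_def)
  ultimately show ?thesis by (simp add: bij_betw_def)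
qed

lemma card_mid_saws_n: "n \<ge> 1 \<Longrightarrow> card (mid_saws_n H W n) = card (mid_paths_n W n)"
  using bij_betw_same_card[OF bij_betw_mid_paths_n] by metis

lemma sum_mdisp_mid_saws_n:
  assumes "n \<ge> 1"
  shows "(\<Sum>\<pi>\<in>mid_saws_n H W n. (real (mdisp H \<pi>))\<^sup>2) = (\<Sum>p\<in>mid_paths_n W n. (path_disp H p)\<^sup>2)"
proof -
  have "(\<Sum>p\<in>mid_paths_n W n. (path_disp H p)\<^sup>2) = (\<Sum>p\<in>mid_paths_n W n. (real (mdisp H (mid_walk_of p)))\<^sup>2)"
    by (intro sum.cong refl) (auto simp: mid_paths_n_def mid_paths_def mdisp_mid_walk_of)
  also have "\<dots> = (\<Sum>\<pi>\<in>mid_saws_n H W n. (real (mdisp H \<pi>))\<^sup>2)"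
    by (rule sum.reindex_bij_betw[OF bij_betw_mid_paths_n[OF assms]])
  finally show ?thesis by simp
qed

text \<open>Only the finitely many walks of length 0 from \<open>W\<close> are missing on the right.
  The factor \<open>1\<close> stands in the place of the displacement weight, so that both exponents
  share one shape of sum.\<close>

lemma saw_Y_finite_iff:
  assumes W: "finite W" and x: "x > 0"
  shows "saw_Y H W x y < \<infinity> \<longleftrightarrow>
    infsum (\<lambda>p. ennreal (real (length p - 2) powr (- y) * x ^ (length p - 2) * 1)) (mid_paths H W (verts H)) < \<infinity>"
    (is "_ \<longleftrightarrow> ?R < \<infinity>")
proof -
  let ?f = "\<lambda>\<pi>. ennreal (x ^ mlength \<pi> / (if mlength \<pi> = 0 then 1 else real (mlength \<pi>) powr y))"
  let ?Z = "{\<pi> \<in> mid_saws H W. mlength \<pi> = 0}"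
  have "?R = infsum (\<lambda>p. ?f (mid_walk_of p)) (mid_paths H W (verts H))"
  proof (rule infsum_cong)
    fix p assume "p \<in> mid_paths H W (verts H)"
    hence "length p - 2 \<noteq> 0" by (auto simp: mid_paths_def)
    thus "ennreal (real (length p - 2) powr (- y) * x ^ (length p - 2) * 1) = ?f (mid_walk_of p)"
      unfolding mlength_mid_walk_of by (simp add: powr_minus divide_inverse mult.commute)
  qed
  also have "\<dots> = infsum ?f {\<pi> \<in> mid_saws H W. mlength \<pi> \<ge> 1}"
    by (rule infsum_reindex_bij_betw[OF bij_betw_mid_paths_verts])
  finally have R: "?R = infsum ?f {\<pi> \<in> mid_saws H W. mlength \<pi> \<ge> 1}" .
  have "?Z \<subseteq> (\<lambda>e. ([], [e])) ` incident_edges H W"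
    by (auto simp: mid_saws_def mid_saw_def mlength_def mstart_def length_Suc_conv)
  moreover have "finite (incident_edges H W)"
  proof -
    have "incident_edges H W \<subseteq> (\<Union>w\<in>W. incident_edges H {w})" by (auto simp: incident_edges_def)
    thus ?thesis by (rule finite_subset) (use W finite_nbrs in \<open>auto simp: incident_edges_singleton[OF simple]\<close>)
  qed
  ultimately have fin: "finite ?Z" using finite_subset by blast
  have eq: "{\<pi> \<in> mid_saws H W. mlength \<pi> \<ge> 1} = mid_saws H W - ?Z" by auto
  show ?thesis
  proof
    assume "saw_Y H W x y < \<infinity>"
    moreover have "infsum ?f (mid_saws H W - ?Z) \<le> saw_Y H W x y"
      unfolding saw_Y_def by (rule infsum_subset_le_ennreal) auto
    ultimately show "?R < \<infinity>" unfolding R eq by (rule le_less_trans[rotated])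
  next
    assume "?R < \<infinity>"
    hence "infsum ?f (mid_saws H W - ?Z) < \<infinity>" unfolding R eq .
    thus "saw_Y H W x y < \<infinity>" unfolding saw_Y_def
      by (rule infsum_less_top_finite_part[OF fin, rotated]) auto
  qed
qed

lemma mid_paths_map_automorphism:
  assumes \<phi>: "\<phi> \<in> automorphisms H" and p: "p \<in> mid_paths H {w} (verts H)" and w: "w \<in> verts H" "\<phi> w \<in> W"
  shows "map \<phi> p \<in> mid_paths H W (verts H)"
proof -
  from p have mp: "mid_path H p" "length p \<ge> 3" "w \<in> hd (path_edges p)" by (auto simp: mid_paths_def)
  note au = automorphismsD[OF \<phi>] and fl = first_last_edge[OF mp(1)]
  have pv: "set p \<subseteq> verts H" using mp(1) by (auto simp: mid_path_def walk_def)
  have "set (butlast (tl p)) \<subseteq> verts H" using pv by (cases p) (auto dest: in_set_butlastD)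
  hence "distinct (map \<phi> (butlast (tl p)))"
    using mp(1) inj_on_subset[OF au(1)] by (auto simp: distinct_map mid_path_def)
  hence "distinct (butlast (tl (map \<phi> p)))" by (simp add: map_tl map_butlast)
  moreover have "distinct (path_edges (map \<phi> p))"
  proof -
    have "\<Union> (set (path_edges p)) \<subseteq> verts H" using Union_path_edges[of p] pv by blast
    hence "inj_on ((`) \<phi>) (set (path_edges p))" by (intro inj_on_image inj_on_subset[OF au(1)])
    thus ?thesis using mp(1) by (simp add: path_edges_map distinct_map mid_path_def)
  qed
  moreover have "walk H (map \<phi> p)" using walk_map_automorphism[OF \<phi>] mp(1) by (simp add: mid_path_def)
  ultimately have mp': "mid_path H (map \<phi> p)" using mp(2) by (simp add: mid_path_def)
  have "path_edges p \<noteq> []" using mp by auto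
  hence "\<phi> w \<in> hd (path_edges (map \<phi> p))" using mp(3) by (simp add: path_edges_map hd_map)
  thus ?thesis using mp' mp(2) w first_last_edge[OF mp'] by (auto simp: mid_paths_def)
qed

text \<open>Split the walks from \<open>W'\<close> by a vertex of \<open>W'\<close> on the initial
  edge. An automorphism carrying that vertex into \<open>W\<close> maps the class injectively to
  walks from \<open>W\<close>.\<close>

lemma mid_paths_infsum_domain_le:
  fixes f :: "'a list \<Rightarrow> ennreal"
  assumes W: "fundamental_domain H \<Gamma> W" and W': "finite W'" "W' \<subseteq> verts H"
    and f: "\<And>\<phi> p. \<phi> \<in> automorphisms H \<Longrightarrow> mid_path H p \<Longrightarrow> f (map \<phi> p) = f p"
  shows "infsum f (mid_paths H W' (verts H)) \<le> of_nat (card W') * infsum f (mid_paths H W (verts H))"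
proof (rule infsum_le_finite_sums)
  fix P assume P: "finite P" "P \<subseteq> mid_paths H W' (verts H)"
  let ?Pw = "\<lambda>w. P \<inter> mid_paths H {w} (verts H)"
  have le: "sum f (?Pw w) \<le> infsum f (mid_paths H W (verts H))" if w: "w \<in> W'" for w
  proof -
    obtain \<phi> where \<phi>: "\<phi> \<in> automorphisms H" "\<phi> w \<in> W"
      using W W'(2) w \<Gamma> unfolding fundamental_domain_def by blast
    have inj: "inj_on (map \<phi>) (?Pw w)"
    proof (rule inj_on_mapI)
      have "\<Union> (set ` ?Pw w) \<subseteq> verts H" by (auto simp: mid_paths_def mid_path_def walk_def)
      thus "inj_on \<phi> (\<Union> (set ` ?Pw w))" using inj_on_subset[OF automorphismsD(1)[OF \<phi>(1)]] by blast
    qed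
    have "sum f (?Pw w) = sum (\<lambda>p. f (map \<phi> p)) (?Pw w)"
      by (intro sum.cong refl f[symmetric] \<phi>) (auto simp: mid_paths_def)
    also have "\<dots> = sum f (map \<phi> ` ?Pw w)" using sum.reindex[OF inj, of f] by (simp add: o_def)
    also have "\<dots> \<le> infsum f (mid_paths H W (verts H))"
      using P(1) mid_paths_map_automorphism[OF \<phi>(1) _ _ \<phi>(2)] w W'(2)
      by (intro sum_le_infsum_ennreal) auto
    finally show ?thesis .
  qed
  have "P \<subseteq> (\<Union>w\<in>W'. ?Pw w)"
  proof
    fix p assume "p \<in> P"
    moreover from this P(2) obtain w where "w \<in> W'" "w \<in> hd (path_edges p)" by (auto simp: mid_paths_def)
    ultimately show "p \<in> (\<Union>w\<in>W'. ?Pw w)" using P(2) by (auto simp: mid_paths_def)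
  qed
  hence "sum f P \<le> sum f (\<Union>w\<in>W'. ?Pw w)" using P(1) W'(1) by (intro sum_mono2) auto
  also have "\<dots> \<le> (\<Sum>w\<in>W'. sum f (?Pw w))"
    using W'(1) P(1) sum_UN_le_ennreal[of W' ?Pw f] by auto
  also have "\<dots> \<le> (\<Sum>w\<in>W'. infsum f (mid_paths H W (verts H)))" by (intro sum_mono le)
  finally show "sum f P \<le> of_nat (card W') * infsum f (mid_paths H W (verts H))" by simp
qed simp

text \<open>Obtained from the infinite sum by giving weight 0 to all other lengths.\<close>

lemma sum_mid_paths_n_domain_le:
  fixes h :: "'a list \<Rightarrow> real"
  assumes W: "fundamental_domain H \<Gamma> W" and W': "finite W'" "W' \<subseteq> verts H"
    and h: "\<And>\<phi> p. \<phi> \<in> automorphisms H \<Longrightarrow> mid_path H p \<Longrightarrow> h (map \<phi> p) = h p" "\<And>p. h p \<ge> 0"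
  shows "(\<Sum>p\<in>mid_paths_n W' n. h p) \<le> real (card W') * (\<Sum>p\<in>mid_paths_n W n. h p)"
proof -
  let ?f = "\<lambda>p. if length p = n + 2 then ennreal (h p) else 0"
  have eq: "infsum ?f (mid_paths H V (verts H)) = ennreal (\<Sum>p\<in>mid_paths_n V n. h p)" if "finite V" for V
  proof -
    have "infsum ?f (mid_paths H V (verts H)) = infsum (\<lambda>p. ennreal (h p)) (mid_paths_n V n)"
      by (rule infsum_cong_neutral) (auto simp: mid_paths_n_def)
    thus ?thesis using finite_mid_paths_n[OF that] h(2) by (simp add: sum_ennreal)
  qed
  have "infsum ?f (mid_paths H W' (verts H)) \<le> of_nat (card W') * infsum ?f (mid_paths H W (verts H))"
    by (rule mid_paths_infsum_domain_le[OF W W']) (simp add: h)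
  moreover have "finite W" using W by (simp add: fundamental_domain_def)
  ultimately have "ennreal (\<Sum>p\<in>mid_paths_n W' n. h p) \<le> ennreal (real (card W') * (\<Sum>p\<in>mid_paths_n W n. h p))"
    using eq W'(1) h(2) by (simp add: ennreal_mult sum_nonneg ennreal_of_nat_eq_real_of_nat)
  thus ?thesis using h(2) by (subst (asm) ennreal_le_iff) (auto intro!: sum_nonneg mult_nonneg_nonneg)
qed

lemma path_disp_automorphism:
  assumes "\<phi> \<in> automorphisms H" "mid_path H p"
  shows "path_disp H (map \<phi> p) = path_disp H p"
proof -
  note fl = first_last_edge[OF assms(2)]
  have "path_edges p \<noteq> []" using assms(2) by (auto simp: mid_path_def)
  hence e: "hd (path_edges (map \<phi> p)) = \<phi> ` hd (path_edges p)" "last (path_edges (map \<phi> p)) = \<phi> ` last (path_edges p)"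
    by (simp_all add: path_edges_map hd_map last_map)
  have "(\<exists>a\<in>\<phi> ` hd (path_edges p). \<exists>b\<in>\<phi> ` last (path_edges p). graph_dist H a b = n) \<longleftrightarrow>
      (\<exists>a\<in>hd (path_edges p). \<exists>b\<in>last (path_edges p). graph_dist H a b = n)" for n
  proof -
    have "graph_dist H (\<phi> a) (\<phi> b) = graph_dist H a b" if "a \<in> hd (path_edges p)" "b \<in> last (path_edges p)" for a b
      using graph_dist_automorphism[OF conn assms(1)] fl that by blast
    thus ?thesis by auto
  qed
  thus ?thesis unfolding path_disp_def e graph_set_dist_def by simp
qed

lemma saw_Y_domain_finite:
  assumes "fundamental_domain H \<Gamma> W" "fundamental_domain H \<Gamma> W'" "x > 0" "saw_Y H W x y < \<infinity>"
  shows "saw_Y H W' x y < \<infinity>"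
proof -
  have fin: "finite W" "finite W'" "W' \<subseteq> verts H" using assms by (auto simp: fundamental_domain_def)
  let ?f = "\<lambda>p :: 'a list. ennreal (real (length p - 2) powr (- y) * x ^ (length p - 2) * 1)"
  have "infsum ?f (mid_paths H W' (verts H)) \<le> of_nat (card W') * infsum ?f (mid_paths H W (verts H))"
    by (rule mid_paths_infsum_domain_le[OF assms(1) fin(2,3)]) simp
  also have "\<dots> < \<infinity>"
    using assms(4) saw_Y_finite_iff[OF fin(1) assms(3)] by (simp add: ennreal_mult_less_top of_nat_less_top)
  finally show ?thesis using saw_Y_finite_iff[OF fin(2) assms(3)] by simp
qed

lemma mid_paths_n_nonempty:
  assumes "fundamental_domain H \<Gamma> W" "n \<ge> 1"
  shows "mid_paths_n W n \<noteq> {}"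
proof -
  obtain w where w: "w \<in> W" "w \<in> verts H"
    using assms(1) verts_nonempty unfolding fundamental_domain_def by blast
  obtain p where p: "p \<in> saws_from H w (n + 1)" using saws_nonempty[OF w(2)] by blast
  hence "p \<in> mid_paths H W (verts H)" using saws_subset_mid_paths[OF w(1), of "n + 1"] assms(2) by auto
  thus ?thesis using p by (auto simp: mid_paths_n_def saws_from_def)
qed

lemma card_mid_paths_n_pos: "fundamental_domain H \<Gamma> W \<Longrightarrow> n \<ge> 1 \<Longrightarrow> card (mid_paths_n W n) > 0"
  using mid_paths_n_nonempty finite_mid_paths_n by (simp add: card_gt_0_iff fundamental_domain_def)

lemma saw_V_eq:
  "saw_V H W z = (\<Sum>\<^sub>\<infinity>n\<in>{1::nat..}. ennreal (real n powr (- (2 * z + 1)) *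
     ((\<Sum>p\<in>mid_paths_n W n. (path_disp H p)\<^sup>2) / real (card (mid_paths_n W n)))))"
  unfolding saw_V_def by (rule infsum_cong) (simp add: sum_mdisp_mid_saws_n card_mid_saws_n)

text \<open>In each average, changing the domain costs a factor \<open>card W'\<close> in the
  numerator and a factor \<open>card W\<close> in the denominator.\<close>

lemma saw_V_domain_finite:
  assumes W: "fundamental_domain H \<Gamma> W" and W': "fundamental_domain H \<Gamma> W'" and fin: "saw_V H W z < \<infinity>"
  shows "saw_V H W' z < \<infinity>"
proof -
  have f: "finite W" "W \<subseteq> verts H" "finite W'" "W' \<subseteq> verts H" using assms by (auto simp: fundamental_domain_def)
  let ?D = "\<lambda>V n. \<Sum>p\<in>mid_paths_n V n. (path_disp H p)\<^sup>2" and ?N = "\<lambda>V n. real (card (mid_paths_n V n))"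
  have "saw_V H W' z \<le> ennreal (real (card W') * real (card W)) * saw_V H W z"
    unfolding saw_V_eq
  proof (rule infsum_mult_left_le_ennreal)
    fix n :: nat assume "n \<in> {1..}"
    hence n: "n \<ge> 1" by simp
    have D: "?D W' n \<le> real (card W') * ?D W n"
      by (rule sum_mid_paths_n_domain_le[OF W f(3,4)]) (simp_all add: path_disp_automorphism)
    have N: "?N W n \<le> real (card W) * ?N W' n"
      using sum_mid_paths_n_domain_le[OF W' f(1,2), of "\<lambda>_. 1" n] by simp
    have pos: "?N W n > 0" "?N W' n > 0"
      using card_mid_paths_n_pos[OF W n] card_mid_paths_n_pos[OF W' n] by simp_all
    have "?D W' n / ?N W' n \<le> (real (card W') * ?D W n) / (?N W n / real (card W))"
    proof (rule frac_le)
      have "card W \<noteq> 0" using N pos by (metis mult_zero_left of_nat_0 not_less)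
      thus "?N W n / real (card W) \<le> ?N W' n" "0 < ?N W n / real (card W)" using N pos by (auto simp: field_simps)
    qed (use D in \<open>auto intro!: mult_nonneg_nonneg sum_nonneg\<close>)
    also have "\<dots> = real (card W') * real (card W) * (?D W n / ?N W n)" by simp
    finally have "real n powr (- (2 * z + 1)) * (?D W' n / ?N W' n)
        \<le> real n powr (- (2 * z + 1)) * (real (card W') * real (card W) * (?D W n / ?N W n))"
      by (intro mult_left_mono) auto
    hence "ennreal (real n powr (- (2 * z + 1)) * (?D W' n / ?N W' n))
        \<le> ennreal ((real (card W') * real (card W)) * (real n powr (- (2 * z + 1)) * (?D W n / ?N W n)))"
      by (intro ennreal_leI) (simp add: mult_ac)
    also have "\<dots> = ennreal (real (card W') * real (card W)) * ennreal (real n powr (- (2 * z + 1)) * (?D W n / ?N W n))"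
      by (intro ennreal_mult) (auto intro!: mult_nonneg_nonneg divide_nonneg_nonneg sum_nonneg)
    finally show "ennreal (real n powr (- (2 * z + 1)) * (?D W' n / ?N W' n))
        \<le> ennreal (real (card W') * real (card W)) * ennreal (real n powr (- (2 * z + 1)) * (?D W n / ?N W n))" .
  qed
  also have "\<dots> < \<infinity>" using fin by (simp add: ennreal_mult_less_top)
  finally show ?thesis .
qed

text \<open>The assumed asymptotics replace division by the number of walks of length
  \<open>n\<close> by a weight \<open>x ^ n / l n\<close> on each of them, which turns a sum of
  averages into a weighted sum over walks.\<close>

lemma saw_V_finite_iff:
  assumes W: "fundamental_domain H \<Gamma> W" and C: "C1 > 0" "C2 > 0" and x: "x > 0"
    and l: "\<And>n. n \<ge> 1 \<Longrightarrow> l n > (0::real)"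
    and lower: "\<And>n. n \<ge> 1 \<Longrightarrow> C1 * l n / x ^ n \<le> real (card (mid_saws_n H W n))"
    and upper: "\<And>n. n \<ge> 1 \<Longrightarrow> real (card (mid_saws_n H W n)) \<le> C2 * l n / x ^ n"
  shows "saw_V H W z < \<infinity> \<longleftrightarrow>
    infsum (\<lambda>p. ennreal (real (length p - 2) powr (- (2 * z + 1)) / l (length p - 2) * x ^ (length p - 2) * (path_disp H p)\<^sup>2))
      (mid_paths H W (verts H)) < \<infinity>" (is "_ \<longleftrightarrow> infsum ?f ?P < \<infinity>")
proof -
  let ?D = "\<lambda>n. \<Sum>p\<in>mid_paths_n W n. (path_disp H p)\<^sup>2" and ?N = "\<lambda>n. real (card (mid_paths_n W n))"
  let ?g = "\<lambda>n. ennreal (real n powr (- (2 * z + 1)) * (?D n / ?N n))"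
  let ?k = "\<lambda>n. real n powr (- (2 * z + 1)) / l n * x ^ n"
  have finW: "finite W" using W by (simp add: fundamental_domain_def)
  have N: "?N n > 0" "C1 * (l n / x ^ n) \<le> ?N n" "?N n \<le> C2 * (l n / x ^ n)" if "n \<ge> 1" for n
    using card_mid_paths_n_pos[OF W that] lower[OF that] upper[OF that] card_mid_saws_n[OF that] by simp_all
  have D0: "?D n \<ge> 0" for n by (rule sum_nonneg) simp
  have fsum: "sum ?f Q = ennreal (?k n * (\<Sum>p\<in>Q. (path_disp H p)\<^sup>2))" if "n \<ge> 1" "Q \<subseteq> mid_paths_n W n" for n Q
  proof -
    have "sum ?f Q = (\<Sum>p\<in>Q. ennreal (?k n * (path_disp H p)\<^sup>2))"
      using that by (intro sum.cong refl) (auto simp: mid_paths_n_def)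
    also have "\<dots> = ennreal (\<Sum>p\<in>Q. ?k n * (path_disp H p)\<^sup>2)"
      using x l[OF that(1)] by (intro sum_ennreal mult_nonneg_nonneg divide_nonneg_nonneg) auto
    finally show ?thesis by (simp add: sum_distrib_left)
  qed
  have fg: "infsum ?f ?P \<le> ennreal C2 * infsum ?g {1..}"
  proof (rule infsum_le_fibrewise[where p = "\<lambda>p. length p - 2"])
    show "(\<lambda>p. length p - 2) ` ?P \<subseteq> {1..}" by (auto simp: mid_paths_def)
    fix n :: nat and Q assume "n \<in> {1..}" and Q: "finite Q" "Q \<subseteq> {p \<in> ?P. length p - 2 = n}"
    hence n: "n \<ge> 1" by simp
    have Q': "Q \<subseteq> mid_paths_n W n" using Q(2) n by (auto simp: mid_paths_n_def)
    have "sum ?f Q = ennreal (?k n * (\<Sum>p\<in>Q. (path_disp H p)\<^sup>2))" by (rule fsum[OF n Q'])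
    also have "\<dots> \<le> ennreal (?k n * ?D n)"
      using x l[OF n] Q' finite_mid_paths_n[OF finW]
      by (intro ennreal_leI mult_left_mono sum_mono2 mult_nonneg_nonneg divide_nonneg_nonneg) auto
    also have "\<dots> \<le> ennreal (C2 * (real n powr (- (2 * z + 1)) * (?D n / ?N n)))"
    proof (rule ennreal_leI)
      have "x ^ n / l n \<le> C2 / ?N n" using N[OF n] l[OF n] x C by (simp add: field_simps)
      hence "(real n powr (- (2 * z + 1)) * ?D n) * (x ^ n / l n) \<le> (real n powr (- (2 * z + 1)) * ?D n) * (C2 / ?N n)"
        using D0[of n] by (intro mult_left_mono mult_nonneg_nonneg) auto
      thus "?k n * ?D n \<le> C2 * (real n powr (- (2 * z + 1)) * (?D n / ?N n))" by (simp add: mult_ac)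
    qed
    also have "\<dots> = ennreal C2 * ?g n" using C D0[of n] N[OF n] by (intro ennreal_mult) auto
    finally show "sum ?f Q \<le> ennreal C2 * ?g n" .
  qed
  have gf: "infsum ?g {1..} \<le> ennreal (1 / C1) * infsum ?f ?P"
  proof (rule infsum_ge_fibrewise[where p = "\<lambda>p. length p - 2" and S = "mid_paths_n W"])
    fix n :: nat assume "n \<in> {1..}"
    hence n: "n \<ge> 1" by simp
    show "finite (mid_paths_n W n)" by (rule finite_mid_paths_n[OF finW])
    show "mid_paths_n W n \<subseteq> {p \<in> ?P. length p - 2 = n}" by (auto simp: mid_paths_n_def)
    have "real n powr (- (2 * z + 1)) * (?D n / ?N n) \<le> 1 / C1 * (?k n * ?D n)"
    proof -
      have "1 / ?N n \<le> 1 / C1 * (x ^ n / l n)" using N[OF n] l[OF n] x C by (simp add: field_simps)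
      hence "(real n powr (- (2 * z + 1)) * ?D n) * (1 / ?N n) \<le> (real n powr (- (2 * z + 1)) * ?D n) * (1 / C1 * (x ^ n / l n))"
        using D0[of n] by (intro mult_left_mono mult_nonneg_nonneg) auto
      thus ?thesis by (simp add: mult_ac)
    qed
    hence "?g n \<le> ennreal (1 / C1 * (?k n * ?D n))" by (rule ennreal_leI)
    also have "\<dots> = ennreal (1 / C1) * ennreal (?k n * ?D n)"
      using C x l[OF n] D0[of n] by (intro ennreal_mult mult_nonneg_nonneg divide_nonneg_nonneg) auto
    also have "ennreal (?k n * ?D n) = sum ?f (mid_paths_n W n)" using fsum[OF n subset_refl] by simp
    finally show "?g n \<le> ennreal (1 / C1) * sum ?f (mid_paths_n W n)" .
  qed
  show ?thesis
    unfolding saw_V_eq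
  proof
    assume "infsum ?g {1..} < \<infinity>"
    hence "ennreal C2 * infsum ?g {1..} < \<infinity>" by (simp add: ennreal_mult_less_top)
    with fg show "infsum ?f ?P < \<infinity>" by (rule le_less_trans)
  next
    assume "infsum ?f ?P < \<infinity>"
    hence "ennreal (1 / C1) * infsum ?f ?P < \<infinity>" by (simp add: ennreal_mult_less_top)
    with gf show "infsum ?g {1..} < \<infinity>" by (rule le_less_trans)
  qed
qed

end


section \<open>Comparison of the two graphs\<close>

text \<open>The quotient \<open>t = m / n\<close> lies between 1 and \<open>c\<close>, so
  \<open>t powr a\<close> and \<open>t powr (- a)\<close> are both at most
  \<open>c powr \<bar>a\<bar>\<close>.\<close>

lemma powr_comparable:
  fixes m n c a :: real
  assumes "0 < n" "n \<le> m" "m \<le> c * n"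
  shows "m powr a \<le> c powr \<bar>a\<bar> * n powr a" "n powr a \<le> c powr \<bar>a\<bar> * m powr a"
proof -
  define t where "t = m / n"
  have t: "1 \<le> t" "t \<le> c" "m = t * n" using assms by (auto simp: t_def field_simps)
  have "t powr b \<le> c powr \<bar>a\<bar>" if "b \<le> \<bar>a\<bar>" for b
    using t that by (intro order_trans[OF powr_mono[of b "\<bar>a\<bar>" t] powr_mono2]) auto
  from this[of a] this[of "- a"] have p: "t powr a \<le> c powr \<bar>a\<bar>" "t powr (- a) \<le> c powr \<bar>a\<bar>" by auto
  show "m powr a \<le> c powr \<bar>a\<bar> * n powr a"
    using p(1) t assms by (simp add: powr_mult mult_right_mono)
  have "n powr a = t powr (- a) * m powr a" using t assms by (simp add: powr_mult powr_minus field_simps)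
  also have "\<dots> \<le> c powr \<bar>a\<bar> * m powr a" using p(2) by (intro mult_right_mono) auto
  finally show "n powr a \<le> c powr \<bar>a\<bar> * m powr a" .
qed

context qt_graph
begin

lemma graph_dist_short_walk:
  assumes "walk H p" "length p \<le> 2" "u \<in> set p" "v \<in> set p"
  shows "graph_dist H u v \<le> 1"
proof (cases "u = v")
  case True
  have "walk H [u]" using assms(1,3) by (auto simp: walk_def)
  thus ?thesis using graph_dist_le[of H "[u]" u v] True by simp
next
  case False
  then obtain a b where "p = [a, b]" using assms by (cases p rule: path_edges.cases) auto
  hence "p = [u, v] \<or> rev p = [u, v]" using assms(3,4) False by auto
  hence "walk H [u, v]" using assms(1) walk_rev[of H p] by auto
  from graph_dist_le[OF this, of u v] show ?thesis by simp
qed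

lemma graph_dist_edge:
  assumes "e \<in> edges H" "u \<in> e" "v \<in> e"
  shows "graph_dist H u v \<le> 1"
proof -
  obtain w where e: "e = {u, w}" using simple_graph_other_end[OF simple assms(1,2)] by blast
  hence "walk H [u, w]" using assms(1) simple_graphD[OF simple, of u w] by (simp add: walk_Cons_iff)
  thus ?thesis using graph_dist_short_walk[of "[u, w]" u v] assms(3) e by auto
qed

lemma incident_edges_image:
  assumes \<alpha>: "\<alpha> \<in> automorphisms H" and W: "W \<subseteq> verts H"
  shows "(\<lambda>e. \<alpha> ` e) ` incident_edges H W = incident_edges H (\<alpha> ` W)"
proof (intro set_eqI iffI)
  note au = automorphismsD[OF \<alpha>]
  fix f
  {
    assume "f \<in> (\<lambda>e. \<alpha> ` e) ` incident_edges H W"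
    then obtain e w where e: "e \<in> edges H" "w \<in> e" "w \<in> W" "f = \<alpha> ` e" by (auto simp: incident_edges_def)
    obtain u where u: "e = {w, u}" using simple_graph_other_end[OF simple e(1,2)] by blast
    have "w \<in> verts H" "u \<in> verts H" using simple_graphD[OF simple, of w u] e(1) u by auto
    hence "{\<alpha> w, \<alpha> u} \<in> edges H" using au(4) e(1) u by simp
    thus "f \<in> incident_edges H (\<alpha> ` W)" using e u by (auto simp: incident_edges_def)
  next
    assume "f \<in> incident_edges H (\<alpha> ` W)"
    then obtain w where f: "f \<in> edges H" "w \<in> W" "\<alpha> w \<in> f" by (auto simp: incident_edges_def)
    obtain c where c: "f = {\<alpha> w, c}" using simple_graph_other_end[OF simple f(1,3)] by blast
    have "c \<in> \<alpha> ` verts H" using simple_graphD(3)[OF simple, of "\<alpha> w" c] f(1) c au(2) by auto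
    then obtain u where u: "u \<in> verts H" "c = \<alpha> u" by blast
    hence "{w, u} \<in> edges H" using au(4)[of w u] W f c by auto
    hence "{w, u} \<in> incident_edges H W" using f(2) by (auto simp: incident_edges_def)
    moreover have "f = \<alpha> ` {w, u}" using c u by simp
    ultimately show "f \<in> (\<lambda>e. \<alpha> ` e) ` incident_edges H W" by blast
  }
qed

text \<open>A walk of length 0 would have a single edge meeting both \<open>W\<close> and its image,
  which the distance excludes.\<close>

lemma saw_Z_eq:
  assumes \<alpha>: "\<alpha> \<in> automorphisms H" and W: "W \<subseteq> verts H" and far: "graph_set_dist H W (\<alpha> ` W) \<ge> 2"
  shows "saw_Z H W \<alpha> x = infsum (\<lambda>p. ennreal (x ^ (length p - 2))) (mid_paths H W (\<alpha> ` W))"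
proof -
  have "mlength \<pi> \<ge> 1" if \<pi>: "\<pi> \<in> mid_saws H W" "mend \<pi> \<in> incident_edges H (\<alpha> ` W)" for \<pi>
  proof (rule ccontr)
    assume "\<not> ?thesis"
    hence "fst \<pi> = []" by (simp add: mlength_def not_le)
    hence "mstart \<pi> = mend \<pi>"
      using \<pi>(1) by (cases \<pi>) (auto simp: mid_saws_def mid_saw_def mstart_def mend_def length_Suc_conv)
    with \<pi> obtain a b where "mend \<pi> \<in> edges H" "a \<in> mend \<pi>" "a \<in> W" "b \<in> mend \<pi>" "b \<in> \<alpha> ` W"
      by (auto simp: mid_saws_def incident_edges_def)
    hence "graph_set_dist H W (\<alpha> ` W) \<le> 1"
      using graph_dist_edge[of "mend \<pi>" a b] graph_set_dist_le[of a W b "\<alpha> ` W" H] by simp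
    thus False using far by simp
  qed
  hence "{\<pi> \<in> mid_saws H W. mend \<pi> \<in> (\<lambda>e. \<alpha> ` e) ` incident_edges H W} =
      {\<pi> \<in> mid_saws H W. mlength \<pi> \<ge> 1 \<and> mend \<pi> \<in> incident_edges H (\<alpha> ` W)}"
    unfolding incident_edges_image[OF \<alpha> W] by blast
  hence "saw_Z H W \<alpha> x = infsum (\<lambda>\<pi>. ennreal (x ^ mlength \<pi>))
      {\<pi> \<in> mid_saws H W. mlength \<pi> \<ge> 1 \<and> mend \<pi> \<in> incident_edges H (\<alpha> ` W)}"
    by (simp add: saw_Z_def)
  also have "\<dots> = infsum (\<lambda>p. ennreal (x ^ mlength (mid_walk_of p))) (mid_paths H W (\<alpha> ` W))"
    by (rule infsum_reindex_bij_betw[OF bij_betw_mid_paths, symmetric])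
  finally show ?thesis by (simp add: mlength_mid_walk_of)
qed

end

context fisher_setting
begin

section \<open>End edges of lifts and projections\<close>

lemma lifts_first_edge:
  assumes "m \<in> lifts p" "length p \<ge> 2"
  shows "hd (path_edges m) = {edge_end (hd p) (hd (tl p)), edge_end (hd (tl p)) (hd p)}"
proof (cases p rule: lifts.cases)
  case (4 a v b q)
  from assms(1)[unfolded 4] show ?thesis
  proof (cases rule: lifts_cases)
    case (white m')
    obtain z m'' where "m' = edge_end v b # z # m''" using lifts_form[OF white(2)] by blast
    moreover have "edge_end v b = edge_end v a" using white(1) by (simp add: edge_end_def)
    ultimately show ?thesis using white(3) 4 by simp
  qed (use 4 in simp_all)
qed (use assms in auto)

lemma lifts_last_edge:
  "m \<in> lifts p \<Longrightarrow> length p \<ge> 2 \<Longrightarrow>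
    last (path_edges m) = {edge_end (last (butlast p)) (last p), edge_end (last p) (last (butlast p))}"
proof (induction p arbitrary: m rule: path_induct)
  case (4 a v b p)
  from 4(2) obtain m' s where m': "m' \<in> lifts (v # b # p)" "m = s @ m'"
    by (cases rule: lifts_cases) (metis append_Cons append_Nil)+
  obtain z m'' where f: "m' = edge_end v b # z # m''" using lifts_form[OF m'(1)] by blast
  have "last (path_edges (s @ m')) = last (path_edges m')" for s
    by (induction s) (simp_all add: last_path_edges_Cons f)
  thus ?case using 4(1)[OF m'(1)] m'(2) by simp
qed auto

lemma edge_ends_meet_fisher_verts:
  assumes "{a, b} \<in> edges G" "{a, b} \<inter> W \<noteq> {}" "W \<subseteq> verts G"
  shows "{edge_end a b, edge_end b a} \<inter> fisher_verts G B W \<noteq> {}"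
proof -
  have "edge_end a b \<in> verts F" "edge_end b a \<in> verts F"
    using edge_end_in_fisher[of a b] edge_end_in_fisher[of b a] assms(1) by (auto simp: insert_commute)
  thus ?thesis using assms(2) by (auto simp: fisher_verts_iff[OF assms(3)])
qed

lemma lifts_mid_paths:
  assumes p: "p \<in> mid_paths G W W'" and m: "m \<in> lifts p" and W: "W \<subseteq> verts G" "W' \<subseteq> verts G"
  shows "m \<in> mid_paths F (fisher_verts G B W) (fisher_verts G B W')"
proof -
  have mp: "mid_path G p" "length p \<ge> 3" "hd (path_edges p) \<inter> W \<noteq> {}" "last (path_edges p) \<inter> W' \<noteq> {}"
    using p by (auto simp: mid_paths_def)
  have l2: "length p \<ge> 2" using mp(2) by simp
  have "hd (path_edges m) \<inter> fisher_verts G B W \<noteq> {}"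
    unfolding lifts_first_edge[OF m l2] using mp(3) first_last_edge(1)[OF mp(1)]
    by (intro edge_ends_meet_fisher_verts W(1)) (simp_all add: hd_path_edges[OF l2])
  moreover have "last (path_edges m) \<inter> fisher_verts G B W' \<noteq> {}"
    unfolding lifts_last_edge[OF m l2] using mp(4) first_last_edge(2)[OF mp(1)]
    by (intro edge_ends_meet_fisher_verts W(2)) (simp_all add: last_path_edges[OF l2])
  moreover have "length m \<ge> 3" using length_proj_le[of m] mid_path_lifts(2)[OF mp(1) m] mp(2) by simp
  ultimately show ?thesis using mid_path_lifts(1)[OF mp(1) m] by (simp add: mid_paths_def)
qed

lemma proj_mid_paths:
  assumes q: "q \<in> mid_paths F (fisher_verts G B W) (fisher_verts G B W')"
    and l: "length (proj q) \<ge> 3" and W: "W \<subseteq> verts G" "W' \<subseteq> verts G"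
  shows "proj q \<in> mid_paths G W W'"
proof -
  have mq: "mid_path F q" "length q \<ge> 3" "hd (path_edges q) \<inter> fisher_verts G B W \<noteq> {}"
    "last (path_edges q) \<inter> fisher_verts G B W' \<noteq> {}"
    using q by (auto simp: mid_paths_def)
  have l2: "length q \<ge> 2" "length (proj q) \<ge> 2" using mq(2) l by auto
  have "hd (path_edges (proj q)) \<inter> W \<noteq> {}"
    using base_first_edge[OF l2] mq(3) fisher_verts_iff[OF W(1)] by blast
  moreover have "last (path_edges (proj q)) \<inter> W' \<noteq> {}"
    using base_last_edge[OF l2] mq(4) fisher_verts_iff[OF W(2)] by blast
  ultimately show ?thesis using mid_path_proj[OF mq(1) l2(2)] l by (simp add: mid_paths_def)
qed

lemma fisher_verts_all: "fisher_verts G B (verts G) = verts F"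
  by (simp add: fisher_def)

text \<open>The comparison behind the connective constants, \<gamma> and \<nu> alike:
  \<open>\<kappa>\<close> is a weight in the length, \<open>h\<close> a weight in the displacement.
  A walk on the Fisher graph over one of length \<open>n \<ge> 1\<close> has length between
  \<open>n\<close> and \<open>3 * n + 10 \<le> 13 * n\<close>, so it is on this range that
  \<open>\<kappa>\<close> has to be controlled up to a factor; this is the origin of 13.\<close>

lemma weighted_sum_finite_iff:
  fixes \<kappa> :: "nat \<Rightarrow> real" and h :: "'a list \<Rightarrow> real" and h' :: "'a fisher_vertex list \<Rightarrow> real"
  assumes x: "x > 0" and W: "finite W" "W \<subseteq> verts G" and K: "K \<ge> 0" "L \<ge> 0"
    and \<kappa>: "\<And>n. \<kappa> n \<ge> 0" "\<And>n m. 1 \<le> n \<Longrightarrow> n \<le> m \<Longrightarrow> m \<le> 13 * n \<Longrightarrow> \<kappa> m \<le> K * \<kappa> n \<and> \<kappa> n \<le> K * \<kappa> m"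
    and h: "\<And>p. h p \<ge> 0" "\<And>q. h' q \<ge> 0"
      "\<And>q. mid_path F q \<Longrightarrow> length (proj q) \<ge> 3 \<Longrightarrow> h' q \<le> L * h (proj q) \<and> h (proj q) \<le> L * h' q"
  shows "infsum (\<lambda>q. ennreal (\<kappa> (length q - 2) * x ^ (length q - 2) * h' q))
      (mid_paths F (fisher_verts G B W) (verts F)) < \<infinity> \<longleftrightarrow>
    infsum (\<lambda>p. ennreal (\<kappa> (length p - 2) * rate x ^ (length p - 2) * h p))
      (mid_paths G W (verts G)) < \<infinity>" (is "infsum ?f ?A' < \<infinity> \<longleftrightarrow> infsum ?g ?A < \<infinity>")
proof -
  note r = rate_pos[OF x]
  have finF: "finite (fisher_verts G B W)"
  proof -
    have "fisher_verts G B W \<subseteq> Keep ` W \<union> (\<Union>v\<in>W. Tri v ` nbrs G v)"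
      by (auto simp: fisher_verts_def nbrs_def)
    thus ?thesis by (rule finite_subset) (use W finite_nbrs in auto)
  qed
  have compare: "\<kappa> (length q - 2) \<le> K * \<kappa> (length (proj q) - 2) \<and> \<kappa> (length (proj q) - 2) \<le> K * \<kappa> (length q - 2)"
    if q: "mid_path F q" "length (proj q) \<ge> 3" for q
    using length_fibre_le[OF q(1)] length_proj_le[of q] q(2) by (intro \<kappa>(2)) auto
  let ?k = "\<lambda>p. ennreal (K * L * \<kappa> (length p - 2) * h p)"
  have split: "ennreal (rate x ^ (length p - 2)) * ?k p = ennreal (K * L) * ?g p" for p
    using K \<kappa>(1) h(1) r by (simp add: ennreal_mult'[symmetric] mult_ac)
  show ?thesis
  proof
    assume fin: "infsum ?f ?A' < \<infinity>"
    obtain C where C: "C > 0" "\<forall>A A' f g.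
      (\<forall>p\<in>A. mid_path G p \<and> (\<forall>m\<in>lifts p. m \<in> A' \<and> ennreal (x ^ (length m - 2)) * g p \<le> f m)) \<longrightarrow>
      infsum (\<lambda>p. ennreal (rate x ^ (length p - 2)) * g p) A \<le> ennreal C * infsum f A'"
      using lifts_infsum_ge[OF x] by blast
    have "infsum (\<lambda>p. ennreal (rate x ^ (length p - 2)) * ennreal (\<kappa> (length p - 2) * h p)) ?A
        \<le> ennreal C * infsum (\<lambda>q. ennreal (K * L) * ?f q) ?A'"
    proof (rule C(2)[rule_format], intro conjI ballI)
      fix p m assume p: "p \<in> ?A" and m: "m \<in> lifts p"
      show "m \<in> ?A'" using lifts_mid_paths[OF p m W(2) subset_refl] by (simp add: fisher_verts_all)
      have mp: "mid_path F m" "proj m = p" "length p \<ge> 3" using mid_path_lifts[of p m] p m by (auto simp: mid_paths_def)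
      have "\<kappa> (length p - 2) * h p \<le> (K * \<kappa> (length m - 2)) * (L * h' m)"
        using compare[of m] h(3)[of m] mp \<kappa>(1) h K by (intro mult_mono mult_nonneg_nonneg) auto
      hence "x ^ (length m - 2) * (\<kappa> (length p - 2) * h p) \<le> x ^ (length m - 2) * ((K * \<kappa> (length m - 2)) * (L * h' m))"
        using x by (intro mult_left_mono) auto
      hence "ennreal (x ^ (length m - 2) * (\<kappa> (length p - 2) * h p)) \<le> ennreal ((K * L) * (\<kappa> (length m - 2) * x ^ (length m - 2) * h' m))"
        by (intro ennreal_leI) (simp add: mult_ac)
      thus "ennreal (x ^ (length m - 2)) * ennreal (\<kappa> (length p - 2) * h p) \<le> ennreal (K * L) * ?f m"
        using x K \<kappa>(1) h by (simp add: ennreal_mult)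
    qed (auto simp: mid_paths_def)
    also have "infsum (\<lambda>q. ennreal (K * L) * ?f q) ?A' \<le> ennreal (K * L) * infsum ?f ?A'"
      by (rule infsum_mult_left_le_ennreal) simp
    finally have le: "infsum (\<lambda>p. ennreal (rate x ^ (length p - 2)) * ennreal (\<kappa> (length p - 2) * h p)) ?A
        \<le> ennreal C * (ennreal (K * L) * infsum ?f ?A')" by (simp add: mult_left_mono)
    have "ennreal (rate x ^ (length p - 2)) * ennreal (\<kappa> (length p - 2) * h p) = ?g p" for p
      using r \<kappa>(1) h(1) by (simp add: ennreal_mult'[symmetric] mult_ac)
    with le have "infsum ?g ?A \<le> ennreal C * (ennreal (K * L) * infsum ?f ?A')" by simp
    also have "\<dots> < \<infinity>" using fin by (simp add: ennreal_mult_less_top)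
    finally show "infsum ?g ?A < \<infinity>" .
  next
    assume fin: "infsum ?g ?A < \<infinity>"
    obtain C where C: "C > 0" "\<forall>A A' f g.
      (\<forall>q\<in>A'. mid_path F q \<and> length (proj q) \<ge> 2 \<and> proj q \<in> A \<and>
        f q \<le> ennreal (x ^ (length q - 2)) * g (proj q)) \<longrightarrow>
      infsum f A' \<le> ennreal C * infsum (\<lambda>p. ennreal (rate x ^ (length p - 2)) * g p) A"
      using proj_infsum_le[OF x] by blast
    \<comment> \<open>A list whose projection has at most two vertices has length at most
      \<open>3 * 2 + 6 = 12\<close>; only finitely many walks from a finite set are that
      short.\<close>
    let ?E = "{q \<in> ?A'. length q \<le> 12}"
    have long: "length (proj q) \<ge> 3" "mid_path F q" if "q \<in> ?A' - ?E" for q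
      using that length_fibre_le[of q] by (auto simp: mid_paths_def)
    have "infsum ?f (?A' - ?E) \<le> ennreal C * infsum (\<lambda>p. ennreal (rate x ^ (length p - 2)) * ?k p) ?A"
    proof (rule C(2)[rule_format], intro conjI)
      fix q assume q: "q \<in> ?A' - ?E"
      show "proj q \<in> ?A" using proj_mid_paths[of q W "verts G"] q long[OF q] W by (simp add: fisher_verts_all)
      show "mid_path F q" "length (proj q) \<ge> 2" using long[OF q] by simp_all
      have "\<kappa> (length q - 2) * h' q \<le> (K * \<kappa> (length (proj q) - 2)) * (L * h (proj q))"
        using compare[OF long(2,1)[OF q]] h(3)[OF long(2,1)[OF q]] \<kappa>(1) h K by (intro mult_mono mult_nonneg_nonneg) auto
      hence "x ^ (length q - 2) * (\<kappa> (length q - 2) * h' q) \<le> x ^ (length q - 2) * ((K * \<kappa> (length (proj q) - 2)) * (L * h (proj q)))"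
        using x by (intro mult_left_mono) auto
      hence "?f q \<le> ennreal (x ^ (length q - 2) * (K * L * \<kappa> (length (proj q) - 2) * h (proj q)))"
        by (intro ennreal_leI) (simp add: mult_ac)
      also have "\<dots> = ennreal (x ^ (length q - 2)) * ?k (proj q)" using x K \<kappa>(1) h(1) by (intro ennreal_mult) auto
      finally show "?f q \<le> ennreal (x ^ (length q - 2)) * ?k (proj q)" .
    qed
    also have "infsum (\<lambda>p. ennreal (rate x ^ (length p - 2)) * ?k p) ?A \<le> ennreal (K * L) * infsum ?g ?A"
      by (rule infsum_mult_left_le_ennreal) (simp only: split order_refl)
    finally have "infsum ?f (?A' - ?E) \<le> ennreal C * (ennreal (K * L) * infsum ?g ?A)" by (simp add: mult_left_mono)
    also have "\<dots> < \<infinity>" using fin by (simp add: ennreal_mult_less_top)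
    finally have long_part: "infsum ?f (?A' - ?E) < \<infinity>" .
    have "finite ?E" by (rule fisher.finite_mid_paths_length[OF finF])
    thus "infsum ?f ?A' < \<infinity>" by (rule infsum_less_top_finite_part[OF _ _ long_part]) simp
  qed
qed

text \<open>Below the critical point of the Fisher graph both sums converge, which bounds
  \<open>rate x\<close> from above; beyond it both diverge, which bounds it from below. Continuity
  of \<open>rate\<close> closes the gap without any information at the critical point
  itself.\<close>

theorem rate_connective_constant: "rate (1 / connective_constant F) = 1 / connective_constant G"
proof -
  obtain W where W: "fundamental_domain G (coloured_automorphisms G B) W" using qt by (auto simp: quasi_transitive_def)
  have fW: "finite W" "W \<subseteq> verts G" using W by (auto simp: fundamental_domain_def)
  have fF: "finite (fisher_verts G B W)" "fisher_verts G B W \<subseteq> verts F"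
    using fisher_fundamental_domain[OF W] by (auto simp: fundamental_domain_def)
  obtain w where w: "w \<in> W" "w \<in> verts G" using W verts_nonempty unfolding fundamental_domain_def by blast
  obtain a where a: "a \<in> fisher_verts G B W" using fisher_verts_lift[OF w(1) fW(2)] by blast
  define x0 where "x0 = 1 / connective_constant F"
  have x0: "x0 > 0" using fisher.connective_constant_ge_1 by (simp add: x0_def)
  have iff: "infsum (\<lambda>q. ennreal (x ^ (length q - 2))) (mid_paths F (fisher_verts G B W) (verts F)) < \<infinity> \<longleftrightarrow>
      infsum (\<lambda>p. ennreal (rate x ^ (length p - 2))) (mid_paths G W (verts G)) < \<infinity>" if "x > 0" for x
    using weighted_sum_finite_iff[OF that fW, of 1 1 "\<lambda>_. 1" "\<lambda>_. 1" "\<lambda>_. 1"] by simp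
  have le: "rate x \<le> 1 / connective_constant G" if x: "0 < x" "x < x0" for x
  proof (rule ccontr)
    assume "\<not> ?thesis"
    hence "infsum (\<lambda>p. ennreal (rate x ^ (length p - 2))) (mid_paths G W (verts G)) = \<infinity>"
      by (intro mid_paths_infsum_infinite[OF w]) simp
    moreover have "infsum (\<lambda>q. ennreal (x ^ (length q - 2))) (mid_paths F (fisher_verts G B W) (verts F)) < \<infinity>"
      by (rule fisher.mid_paths_infsum_finite[OF fF]) (use x x0_def in auto)
    ultimately show False using iff[OF x(1)] by simp
  qed
  have ge: "1 / connective_constant G \<le> rate x" if x: "x0 < x" for x
  proof (rule ccontr)
    assume n: "\<not> ?thesis"
    have "x > 0" using x x0 by simp
    hence "infsum (\<lambda>p. ennreal (rate x ^ (length p - 2))) (mid_paths G W (verts G)) < \<infinity>"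
      using n rate_pos by (intro mid_paths_infsum_finite[OF fW]) auto
    moreover have "infsum (\<lambda>q. ennreal (x ^ (length q - 2))) (mid_paths F (fisher_verts G B W) (verts F)) = \<infinity>"
      by (rule fisher.mid_paths_infsum_infinite[OF a]) (use x x0_def a fF in auto)
    ultimately show False using iff[OF \<open>x > 0\<close>] by simp
  qed
  have cont: "(rate \<longlongrightarrow> rate x0) (at x0)" unfolding rate_def by (intro tendsto_intros)
  have "rate x0 \<le> 1 / connective_constant G"
  proof (rule tendsto_upperbound)
    show "(rate \<longlongrightarrow> rate x0) (at_left x0)" using cont by (rule tendsto_within_subset) auto
    show "eventually (\<lambda>x. rate x \<le> 1 / connective_constant G) (at_left x0)"
      using eventually_at_left_real[OF x0] by eventually_elim (use le in auto)
  qed simp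
  moreover have "1 / connective_constant G \<le> rate x0"
  proof (rule tendsto_lowerbound)
    show "(rate \<longlongrightarrow> rate x0) (at_right x0)" using cont by (rule tendsto_within_subset) auto
    show "eventually (\<lambda>x. 1 / connective_constant G \<le> rate x) (at_right x0)"
      using eventually_at_right_less[of x0] by eventually_elim (use ge in auto)
  qed simp
  ultimately show ?thesis by (simp add: x0_def)
qed

lemma connective_constant_fisher_eq:
  "1 / (connective_constant G)\<^sup>2 = (1 / connective_constant F) ^ 3 + (1 / connective_constant F) ^ 4"
proof -
  have "1 / connective_constant F > 0" using fisher.connective_constant_ge_1 by simp
  from rate_power2[OF this] show ?thesis unfolding rate_connective_constant by (simp add: power_divide)
qed

text \<open>At the two critical points the weights are related by \<open>rate\<close> exactly, so
  the comparison applies with \<open>n powr (- y)\<close> as the weight in the length. Independence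
  of the domain reduces all fundamental domains to \<open>W\<close> and the set over it.\<close>

lemma is_gamma_fisher_iff: "is_gamma G (coloured_automorphisms G B) g \<longleftrightarrow> is_gamma F (automorphisms F) g"
proof -
  let ?x = "1 / connective_constant G" and ?x' = "1 / connective_constant F"
  have x: "?x > 0" "?x' > 0" using connective_constant_ge_1 fisher.connective_constant_ge_1 by simp_all
  obtain W where W: "fundamental_domain G (coloured_automorphisms G B) W" using qt by (auto simp: quasi_transitive_def)
  note W' = fisher_fundamental_domain[OF W]
  have fW: "finite W" "W \<subseteq> verts G" "finite (fisher_verts G B W)"
    using W W' by (auto simp: fundamental_domain_def)
  have GF: "saw_Y G W ?x y < \<infinity> \<longleftrightarrow> saw_Y F (fisher_verts G B W) ?x' y < \<infinity>" for y
  proof -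
    have "infsum (\<lambda>q. ennreal (real (length q - 2) powr (- y) * ?x' ^ (length q - 2) * 1))
        (mid_paths F (fisher_verts G B W) (verts F)) < \<infinity> \<longleftrightarrow>
      infsum (\<lambda>p. ennreal (real (length p - 2) powr (- y) * rate ?x' ^ (length p - 2) * 1))
        (mid_paths G W (verts G)) < \<infinity>"
    proof (rule weighted_sum_finite_iff[OF x(2) fW(1,2), where K = "13 powr \<bar>- y\<bar>" and L = 1])
      fix n m :: nat assume "1 \<le> n" "n \<le> m" "m \<le> 13 * n"
      hence nm: "0 < real n" "real n \<le> real m" "real m \<le> 13 * real n" by auto
      from powr_comparable[OF nm, of "- y"] show "real m powr (- y) \<le> 13 powr \<bar>- y\<bar> * real n powr (- y) \<and>
        real n powr (- y) \<le> 13 powr \<bar>- y\<bar> * real m powr (- y)" by blast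
    qed auto
    thus ?thesis
      unfolding saw_Y_finite_iff[OF fW(1) x(1)] fisher.saw_Y_finite_iff[OF fW(3) x(2)] rate_connective_constant
      by blast
  qed
  have dom: "saw_Y G V ?x y < \<infinity> \<longleftrightarrow> saw_Y G W ?x y < \<infinity>"
    if "fundamental_domain G (coloured_automorphisms G B) V" for V y
    using saw_Y_domain_finite[OF W that x(1)] saw_Y_domain_finite[OF that W x(1)] by blast
  have domF: "saw_Y F V ?x' y < \<infinity> \<longleftrightarrow> saw_Y F (fisher_verts G B W) ?x' y < \<infinity>"
    if "fundamental_domain F (automorphisms F) V" for V y
    using fisher.saw_Y_domain_finite[OF W' that x(2)] fisher.saw_Y_domain_finite[OF that W' x(2)] by blast
  have top: "t = \<infinity> \<longleftrightarrow> \<not> t < \<infinity>" for t :: ennreal by (simp flip: less_top)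
  have "is_gamma G (coloured_automorphisms G B) g \<longleftrightarrow>
      (\<forall>y::real. (ereal y < g \<longrightarrow> \<not> saw_Y G W ?x y < \<infinity>) \<and> (g < ereal y \<longrightarrow> saw_Y G W ?x y < \<infinity>))"
    unfolding is_gamma_def top using W dom by blast
  moreover have "is_gamma F (automorphisms F) g \<longleftrightarrow>
      (\<forall>y::real. (ereal y < g \<longrightarrow> \<not> saw_Y F (fisher_verts G B W) ?x' y < \<infinity>) \<and>
        (g < ereal y \<longrightarrow> saw_Y F (fisher_verts G B W) ?x' y < \<infinity>))"
    unfolding is_gamma_def top using W' domF by blast
  ultimately show ?thesis using GF by simp
qed

text \<open>Projection does not increase distances. Conversely distances at most double up to 1, and
  passing to the outer ends of the end edges adds at most 2 before doubling, so \<open>1 + d\<close>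
  becomes at most \<open>2 * d + 6 \<le> 6 * (1 + d)\<close>.\<close>

lemma path_disp_comparable:
  assumes q: "mid_path F q" and l: "length (proj q) \<ge> 3"
  shows "path_disp G (proj q) \<le> path_disp F q" "path_disp F q \<le> 6 * path_disp G (proj q)"
proof -
  let ?p = "proj q"
  have l2: "length q \<ge> 2" "length ?p \<ge> 2" "q \<noteq> []" using q l by (auto simp: mid_path_def)
  have p: "mid_path G ?p" by (rule mid_path_proj[OF q l2(2)])
  note fp = first_last_edge[OF p] and fq = fisher.first_last_edge[OF q]
  obtain a b where ab: "a \<in> hd (path_edges q)" "b \<in> last (path_edges q)"
    "graph_dist F a b = graph_set_dist F (hd (path_edges q)) (last (path_edges q))"
    using graph_set_dist_attained[OF fq(5,6)] by blast
  have "graph_set_dist G (hd (path_edges ?p)) (last (path_edges ?p)) \<le> graph_dist G (base a) (base b)"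
    using base_first_edge[OF l2(1,2)] base_last_edge[OF l2(1,2)] ab by (intro graph_set_dist_le) auto
  also have "\<dots> \<le> graph_dist F a b" using fq ab by (intro dist_base_le) auto
  finally show "path_disp G ?p \<le> path_disp F q" using ab(3) by (simp add: path_disp_def)
  obtain u v where uv: "u \<in> hd (path_edges ?p)" "v \<in> last (path_edges ?p)"
    "graph_dist G u v = graph_set_dist G (hd (path_edges ?p)) (last (path_edges ?p))"
    using graph_set_dist_attained[OF fp(5,6)] by blast
  have hl: "hd ?p \<in> hd (path_edges ?p)" "last ?p \<in> last (path_edges ?p)"
    by (simp_all add: hd_path_edges[OF l2(2)] last_path_edges[OF l2(2)])
  have vs: "hd ?p \<in> verts G" "last ?p \<in> verts G" "u \<in> verts G" "v \<in> verts G" using fp hl uv by auto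
  have "graph_dist G (hd ?p) (last ?p) \<le> graph_dist G (hd ?p) u + (graph_dist G u v + graph_dist G v (last ?p))"
    using graph_dist_triangle[OF conn vs(1,3,2)] graph_dist_triangle[OF conn vs(3,4,2)] by linarith
  also have "\<dots> \<le> graph_dist G u v + 2"
    using graph_dist_edge[OF fp(1) hl(1) uv(1)] graph_dist_edge[OF fp(2) uv(2) hl(2)] by linarith
  finally have d: "graph_dist G (hd ?p) (last ?p) \<le> graph_dist G u v + 2" .
  have hq: "hd q \<in> hd (path_edges q)" "last q \<in> last (path_edges q)"
    by (simp_all add: hd_path_edges[OF l2(1)] last_path_edges[OF l2(1)])
  have "graph_set_dist F (hd (path_edges q)) (last (path_edges q)) \<le> graph_dist F (hd q) (last q)"
    using hq by (rule graph_set_dist_le)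
  also have "\<dots> \<le> 2 * graph_dist G (base (hd q)) (base (last q)) + 1" using hq fq by (intro dist_fisher_le) auto
  also have "\<dots> \<le> 2 * (graph_dist G u v + 2) + 1" using d hd_proj[OF l2(3)] last_proj[OF l2(3)] by simp
  finally show "path_disp F q \<le> 6 * path_disp G ?p" using uv(3) by (simp add: path_disp_def)
qed

text \<open>Both graphs share the sequence \<open>l\<close>, so both sums of averages become
  weighted sums with the same weight in the length. The constant 36 in the comparison is the square
  of the factor 6 for displacements.\<close>

lemma is_nu_fisher_iff:
  assumes W: "fundamental_domain G (coloured_automorphisms G B) W"
    and C: "C1 > 0" "C2 > 0" "D1 > 0" "D2 > 0"
    and l: "\<And>n. n \<ge> 1 \<Longrightarrow> l n > (0::real)" "K \<ge> 0"
      "\<And>n m. 1 \<le> n \<Longrightarrow> n \<le> m \<Longrightarrow> m \<le> 13 * n \<Longrightarrow> l m \<le> K * l n \<and> l n \<le> K * l m"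
    and G: "\<And>n. n \<ge> 1 \<Longrightarrow> C1 * l n * connective_constant G ^ n \<le> real (card (mid_saws_n G W n))"
      "\<And>n. n \<ge> 1 \<Longrightarrow> real (card (mid_saws_n G W n)) \<le> C2 * l n * connective_constant G ^ n"
    and F: "\<And>n. n \<ge> 1 \<Longrightarrow> D1 * l n * connective_constant F ^ n \<le> real (card (mid_saws_n F (fisher_verts G B W) n))"
      "\<And>n. n \<ge> 1 \<Longrightarrow> real (card (mid_saws_n F (fisher_verts G B W) n)) \<le> D2 * l n * connective_constant F ^ n"
  shows "is_nu G (coloured_automorphisms G B) v \<longleftrightarrow> is_nu F (automorphisms F) v"
proof -
  let ?x = "1 / connective_constant G" and ?x' = "1 / connective_constant F"
  have x: "?x > 0" "?x' > 0" using connective_constant_ge_1 fisher.connective_constant_ge_1 by simp_all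
  note W' = fisher_fundamental_domain[OF W]
  have fW: "finite W" "W \<subseteq> verts G" using W by (auto simp: fundamental_domain_def)
  \<comment> \<open>\<open>l\<close> is assumed positive from 1 on. The value 0 at 0 makes the
    weight nonnegative everywhere, and no list in \<open>mid_paths\<close> has walk length
    0.\<close>
  let ?\<kappa> = "\<lambda>z n. if n = 0 then 0 else real n powr (- (2 * z + 1)) / l n"
  have GF: "saw_V G W z < \<infinity> \<longleftrightarrow> saw_V F (fisher_verts G B W) z < \<infinity>" for z
  proof -
    have "infsum (\<lambda>q. ennreal (?\<kappa> z (length q - 2) * ?x' ^ (length q - 2) * (path_disp F q)\<^sup>2))
        (mid_paths F (fisher_verts G B W) (verts F)) < \<infinity> \<longleftrightarrow>
      infsum (\<lambda>p. ennreal (?\<kappa> z (length p - 2) * rate ?x' ^ (length p - 2) * (path_disp G p)\<^sup>2))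
        (mid_paths G W (verts G)) < \<infinity>"
    proof (rule weighted_sum_finite_iff[OF x(2) fW, where K = "13 powr \<bar>- (2 * z + 1)\<bar> * K" and L = 36])
      show "?\<kappa> z n \<ge> 0" for n using l(1)[of n] by auto
    next
      fix n m :: nat assume nm: "1 \<le> n" "n \<le> m" "m \<le> 13 * n"
      hence rnm: "0 < real n" "real n \<le> real m" "real m \<le> 13 * real n" by auto
      note pc = powr_comparable[OF rnm, of "- (2 * z + 1)"] and lc = l(3)[OF nm]
      have lp: "l n > 0" "l m > 0" using l(1) nm by auto
      let ?P = "13 powr \<bar>- (2 * z + 1)\<bar>"
      have inv: "1 / l m \<le> K / l n" "1 / l n \<le> K / l m" using lc lp by (auto simp: field_simps)
      have "real m powr (- (2 * z + 1)) * (1 / l m) \<le> (?P * real n powr (- (2 * z + 1))) * (K / l n)"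
        using pc(1) inv lp by (intro mult_mono) auto
      moreover have "real n powr (- (2 * z + 1)) * (1 / l n) \<le> (?P * real m powr (- (2 * z + 1))) * (K / l m)"
        using pc(2) inv lp by (intro mult_mono) auto
      ultimately show "?\<kappa> z m \<le> ?P * K * ?\<kappa> z n \<and> ?\<kappa> z n \<le> ?P * K * ?\<kappa> z m"
        using nm by (simp add: mult_ac)
    next
      fix q assume q: "mid_path F q" "length (proj q) \<ge> 3"
      have pos: "0 \<le> path_disp G (proj q)" "0 \<le> path_disp F q" by (auto simp: path_disp_def)
      have "(path_disp F q)\<^sup>2 \<le> (6 * path_disp G (proj q))\<^sup>2"
        using path_disp_comparable(2)[OF q] pos by (intro power_mono) auto
      moreover have "(path_disp G (proj q))\<^sup>2 \<le> (path_disp F q)\<^sup>2"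
        using path_disp_comparable(1)[OF q] pos by (intro power_mono) auto
      ultimately show "(path_disp F q)\<^sup>2 \<le> 36 * (path_disp G (proj q))\<^sup>2 \<and> (path_disp G (proj q))\<^sup>2 \<le> 36 * (path_disp F q)\<^sup>2"
        by (simp add: power_mult_distrib)
    qed (use l(2) in auto)
    moreover have "saw_V G W z < \<infinity> \<longleftrightarrow>
      infsum (\<lambda>p. ennreal (?\<kappa> z (length p - 2) * ?x ^ (length p - 2) * (path_disp G p)\<^sup>2)) (mid_paths G W (verts G)) < \<infinity>"
    proof -
      have "saw_V G W z < \<infinity> \<longleftrightarrow>
        infsum (\<lambda>p. ennreal (real (length p - 2) powr (- (2 * z + 1)) / l (length p - 2) * ?x ^ (length p - 2) *
          (path_disp G p)\<^sup>2)) (mid_paths G W (verts G)) < \<infinity>"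
        by (rule saw_V_finite_iff[OF W C(1,2) x(1) l(1)]) (use G in \<open>auto simp: power_divide\<close>)
      also have "infsum (\<lambda>p. ennreal (real (length p - 2) powr (- (2 * z + 1)) / l (length p - 2) * ?x ^ (length p - 2) *
          (path_disp G p)\<^sup>2)) (mid_paths G W (verts G)) =
        infsum (\<lambda>p. ennreal (?\<kappa> z (length p - 2) * ?x ^ (length p - 2) * (path_disp G p)\<^sup>2)) (mid_paths G W (verts G))"
        by (rule infsum_cong) (auto simp: mid_paths_def)
      finally show ?thesis .
    qed
    moreover have "saw_V F (fisher_verts G B W) z < \<infinity> \<longleftrightarrow>
      infsum (\<lambda>p. ennreal (?\<kappa> z (length p - 2) * ?x' ^ (length p - 2) * (path_disp F p)\<^sup>2))
        (mid_paths F (fisher_verts G B W) (verts F)) < \<infinity>"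
    proof -
      have "saw_V F (fisher_verts G B W) z < \<infinity> \<longleftrightarrow>
        infsum (\<lambda>p. ennreal (real (length p - 2) powr (- (2 * z + 1)) / l (length p - 2) * ?x' ^ (length p - 2) *
          (path_disp F p)\<^sup>2)) (mid_paths F (fisher_verts G B W) (verts F)) < \<infinity>"
        by (rule fisher.saw_V_finite_iff[OF W' C(3,4) x(2) l(1)]) (use F in \<open>auto simp: power_divide\<close>)
      also have "infsum (\<lambda>p. ennreal (real (length p - 2) powr (- (2 * z + 1)) / l (length p - 2) * ?x' ^ (length p - 2) *
          (path_disp F p)\<^sup>2)) (mid_paths F (fisher_verts G B W) (verts F)) =
        infsum (\<lambda>p. ennreal (?\<kappa> z (length p - 2) * ?x' ^ (length p - 2) * (path_disp F p)\<^sup>2))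
          (mid_paths F (fisher_verts G B W) (verts F))"
        by (rule infsum_cong) (auto simp: mid_paths_def)
      finally show ?thesis .
    qed
    ultimately show ?thesis unfolding rate_connective_constant by blast
  qed
  have dom: "saw_V G V z < \<infinity> \<longleftrightarrow> saw_V G W z < \<infinity>"
    if "fundamental_domain G (coloured_automorphisms G B) V" for V z
    using saw_V_domain_finite[OF W that] saw_V_domain_finite[OF that W] by blast
  have domF: "saw_V F V z < \<infinity> \<longleftrightarrow> saw_V F (fisher_verts G B W) z < \<infinity>"
    if "fundamental_domain F (automorphisms F) V" for V z
    using fisher.saw_V_domain_finite[OF W' that] fisher.saw_V_domain_finite[OF that W'] by blast
  have top: "t = \<infinity> \<longleftrightarrow> \<not> t < \<infinity>" for t :: ennreal by (simp flip: less_top)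
  have "is_nu G (coloured_automorphisms G B) v \<longleftrightarrow>
      (\<forall>z::real. (ereal z < v \<longrightarrow> \<not> saw_V G W z < \<infinity>) \<and> (v < ereal z \<longrightarrow> saw_V G W z < \<infinity>))"
    unfolding is_nu_def top using W dom by blast
  moreover have "is_nu F (automorphisms F) v \<longleftrightarrow>
      (\<forall>z::real. (ereal z < v \<longrightarrow> \<not> saw_V F (fisher_verts G B W) z < \<infinity>) \<and>
        (v < ereal z \<longrightarrow> saw_V F (fisher_verts G B W) z < \<infinity>))"
    unfolding is_nu_def top using W' domF by blast
  ultimately show ?thesis using GF by simp
qed

section \<open>Two-point sums and the exponent \<eta>\<close>

lemma set_dist_comparable:
  assumes W: "W \<subseteq> verts G" "W \<noteq> {}" and W': "W' \<subseteq> verts G" "W' \<noteq> {}"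
  shows "graph_set_dist G W W' \<le> graph_set_dist F (fisher_verts G B W) (fisher_verts G B W')"
    "graph_set_dist F (fisher_verts G B W) (fisher_verts G B W') \<le> 2 * graph_set_dist G W W' + 1"
proof -
  obtain u v where uv: "u \<in> W" "v \<in> W'" "graph_dist G u v = graph_set_dist G W W'"
    using graph_set_dist_attained[OF W(2) W'(2)] by blast
  obtain a where a: "a \<in> fisher_verts G B W" "base a = u" using fisher_verts_lift[OF uv(1) W(1)] .
  obtain b where b: "b \<in> fisher_verts G B W'" "base b = v" using fisher_verts_lift[OF uv(2) W'(1)] .
  have "a \<in> verts F" "b \<in> verts F" using a b fisher_verts_iff W(1) W'(1) by blast+
  from dist_fisher_le[OF this] show "graph_set_dist F (fisher_verts G B W) (fisher_verts G B W') \<le> 2 * graph_set_dist G W W' + 1"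
    using graph_set_dist_le[OF a(1) b(1), of F] a(2) b(2) uv(3) by simp
  obtain c d where cd: "c \<in> fisher_verts G B W" "d \<in> fisher_verts G B W'"
    "graph_dist F c d = graph_set_dist F (fisher_verts G B W) (fisher_verts G B W')"
    using graph_set_dist_attained[of "fisher_verts G B W" "fisher_verts G B W'"] a(1) b(1) by blast
  have v: "c \<in> verts F" "base c \<in> W" "d \<in> verts F" "base d \<in> W'"
    using cd fisher_verts_iff[OF W(1)] fisher_verts_iff[OF W'(1)] by auto
  show "graph_set_dist G W W' \<le> graph_set_dist F (fisher_verts G B W) (fisher_verts G B W')"
    using graph_set_dist_le[OF v(2,4), of G] dist_base_le[OF v(1,3)] cd(3) by simp
qed

text \<open>A projection with at most two vertices would put a vertex of \<open>W\<close> within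
  distance 1 of one of \<open>W'\<close>.\<close>

lemma far_proj_length:
  assumes q: "q \<in> mid_paths F (fisher_verts G B W) (fisher_verts G B W')"
    and W: "W \<subseteq> verts G" "W' \<subseteq> verts G" and far: "graph_set_dist G W W' \<ge> 2"
  shows "length (proj q) \<ge> 3"
proof (rule ccontr)
  assume n: "\<not> ?thesis"
  have mq: "mid_path F q" using q by (simp add: mid_paths_def)
  obtain a b where ab: "a \<in> hd (path_edges q)" "a \<in> fisher_verts G B W"
    "b \<in> last (path_edges q)" "b \<in> fisher_verts G B W'"
    using q by (auto simp: mid_paths_def)
  have ne: "path_edges q \<noteq> []" using mq by (auto simp: mid_path_def)
  have "a \<in> set q" "b \<in> set q"
    using Union_path_edges[of q] hd_in_set[OF ne] last_in_set[OF ne] ab by blast+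
  hence "base a \<in> set (proj q)" "base b \<in> set (proj q)" by (simp_all add: set_proj)
  moreover have "walk G (proj q)" using mq by (intro walk_proj) (simp add: mid_path_def)
  ultimately have "graph_dist G (base a) (base b) \<le> 1" using n by (intro graph_dist_short_walk) auto
  moreover have "base a \<in> W" "base b \<in> W'" using ab fisher_verts_iff[OF W(1)] fisher_verts_iff[OF W(2)] by auto
  ultimately show False using graph_set_dist_le[of "base a" W "base b" W' G] far by simp
qed

text \<open>The constant is chosen before \<open>W\<close> and \<open>W'\<close>, so it applies to
  all images of a domain under a sequence of automorphisms at once.\<close>

lemma far_sums_comparable:
  assumes x: "x > 0"
  shows "\<exists>C::real>0. \<forall>W W'. W \<subseteq> verts G \<longrightarrow> W' \<subseteq> verts G \<longrightarrow> graph_set_dist G W W' \<ge> 2 \<longrightarrow>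
      infsum (\<lambda>q. ennreal (x ^ (length q - 2))) (mid_paths F (fisher_verts G B W) (fisher_verts G B W'))
        \<le> ennreal C * infsum (\<lambda>p. ennreal (rate x ^ (length p - 2))) (mid_paths G W W') \<and>
      infsum (\<lambda>p. ennreal (rate x ^ (length p - 2))) (mid_paths G W W')
        \<le> ennreal C * infsum (\<lambda>q. ennreal (x ^ (length q - 2))) (mid_paths F (fisher_verts G B W) (fisher_verts G B W'))"
proof -
  obtain C where C: "C > 0" "\<forall>A A' f g.
      (\<forall>p\<in>A. mid_path G p \<and> (\<forall>m\<in>lifts p. m \<in> A' \<and> ennreal (x ^ (length m - 2)) * g p \<le> f m)) \<longrightarrow>
      infsum (\<lambda>p. ennreal (rate x ^ (length p - 2)) * g p) A \<le> ennreal C * infsum f A'"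
      using lifts_infsum_ge[OF x] by blast
  obtain D where D: "D > 0" "\<forall>A A' f g.
      (\<forall>q\<in>A'. mid_path F q \<and> length (proj q) \<ge> 2 \<and> proj q \<in> A \<and>
        f q \<le> ennreal (x ^ (length q - 2)) * g (proj q)) \<longrightarrow>
      infsum f A' \<le> ennreal D * infsum (\<lambda>p. ennreal (rate x ^ (length p - 2)) * g p) A"
      using proj_infsum_le[OF x] by blast
  have "infsum (\<lambda>q. ennreal (x ^ (length q - 2))) (mid_paths F (fisher_verts G B W) (fisher_verts G B W'))
        \<le> ennreal (C + D) * infsum (\<lambda>p. ennreal (rate x ^ (length p - 2))) (mid_paths G W W') \<and>
      infsum (\<lambda>p. ennreal (rate x ^ (length p - 2))) (mid_paths G W W')
        \<le> ennreal (C + D) * infsum (\<lambda>q. ennreal (x ^ (length q - 2))) (mid_paths F (fisher_verts G B W) (fisher_verts G B W'))"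
    (is "?f \<le> _ * ?g \<and> _") if W: "W \<subseteq> verts G" "W' \<subseteq> verts G" and far: "graph_set_dist G W W' \<ge> 2" for W W'
  proof
    have "?f \<le> ennreal D * infsum (\<lambda>p. ennreal (rate x ^ (length p - 2)) * 1) (mid_paths G W W')"
    proof (rule D(2)[rule_format], intro conjI)
      fix q assume q: "q \<in> mid_paths F (fisher_verts G B W) (fisher_verts G B W')"
      show "mid_path F q" "length (proj q) \<ge> 2" "proj q \<in> mid_paths G W W'"
        using far_proj_length[OF q W far] proj_mid_paths[OF q _ W] q by (auto simp: mid_paths_def)
    qed simp
    also have "\<dots> \<le> ennreal (C + D) * ?g" using C(1) by (auto intro!: mult_right_mono ennreal_leI)
    finally show "?f \<le> ennreal (C + D) * ?g" .
    have "infsum (\<lambda>p. ennreal (rate x ^ (length p - 2)) * 1) (mid_paths G W W') \<le> ennreal C * ?f"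
    proof (rule C(2)[rule_format], intro conjI ballI)
      show "m \<in> mid_paths F (fisher_verts G B W) (fisher_verts G B W')"
        if "p \<in> mid_paths G W W'" "m \<in> lifts p" for p m using lifts_mid_paths[OF that W] .
    qed (auto simp: mid_paths_def)
    also have "\<dots> \<le> ennreal (C + D) * ?f" using D(1) by (auto intro!: mult_right_mono ennreal_leI)
    finally show "?g \<le> ennreal (C + D) * ?f" by simp
  qed
  thus ?thesis using C(1) D(1) by (intro exI[of _ "C + D"]) auto
qed

text \<open>A coloured automorphism of \<open>G\<close> induces one of the Fisher graph, and the
  distance from the domain to its image and the two-point sum change by bounded factors only, so
  both limits carry over.\<close>

lemma is_eta_of_fisher:
  assumes eta: "is_eta F (automorphisms F) h"
  shows "is_eta G (coloured_automorphisms G B) h"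
  unfolding is_eta_def
proof (intro allI impI)
  fix W \<alpha> w
  assume W: "fundamental_domain G (coloured_automorphisms G B) W"
    and \<alpha>: "\<forall>k. \<alpha> k \<in> coloured_automorphisms G B"
    and lim: "filterlim (\<lambda>k. graph_set_dist G W (\<alpha> k ` W)) at_top sequentially"
  let ?x = "1 / connective_constant G" and ?x' = "1 / connective_constant F"
  let ?d = "\<lambda>k. graph_set_dist G W (\<alpha> k ` W)" and ?W = "fisher_verts G B W"
  let ?\<beta> = "\<lambda>k. map_fisher_vertex (\<alpha> k)"
  let ?d' = "\<lambda>k. graph_set_dist F ?W (?\<beta> k ` ?W)"
  let ?z = "\<lambda>k. saw_Z G W (\<alpha> k) ?x * ennreal (real (?d k) powr w)"
  let ?z' = "\<lambda>k. saw_Z F ?W (?\<beta> k) ?x' * ennreal (real (?d' k) powr w)"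
  have W1: "W \<subseteq> verts G" using W by (simp add: fundamental_domain_def)
  have W2: "W \<noteq> {}" using W verts_nonempty unfolding fundamental_domain_def by blast
  have W3: "\<alpha> k ` W \<subseteq> verts G" "\<alpha> k ` W \<noteq> {}" for k
  proof -
    have "\<alpha> k \<in> automorphisms G" using \<alpha> coloured_automorphismsD(1) by blast
    thus "\<alpha> k ` W \<subseteq> verts G" using W1 automorphismsD(3)[of "\<alpha> k" G] by auto
  qed (use W2 in auto)
  have im: "?\<beta> k ` ?W = fisher_verts G B (\<alpha> k ` W)" for k using map_fisher_vertex_image \<alpha> W1 by blast
  note W' = fisher_fundamental_domain[OF W]
  have x': "?x' > 0" using fisher.connective_constant_ge_1 by simp
  have dd: "?d k \<le> ?d' k" "?d' k \<le> 2 * ?d k + 1" for k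
    unfolding im using set_dist_comparable[OF W1 W2 W3] by auto
  have "filterlim ?d' at_top sequentially" by (rule filterlim_at_top_mono[OF lim]) (use dd in auto)
  moreover have "?\<beta> k \<in> automorphisms F" for k using map_fisher_vertex_automorphism \<alpha> by blast
  ultimately have etaF: "ereal w < h \<Longrightarrow> ?z' \<longlonglongrightarrow> 0" "h < ereal w \<Longrightarrow> ?z' \<longlonglongrightarrow> \<infinity>"
    using eta[unfolded is_eta_def, rule_format, OF W', of "?\<beta>" w] by auto
  obtain C where C: "C > 0" and cmp: "\<forall>W W'. W \<subseteq> verts G \<longrightarrow> W' \<subseteq> verts G \<longrightarrow> graph_set_dist G W W' \<ge> 2 \<longrightarrow>
      infsum (\<lambda>q. ennreal (?x' ^ (length q - 2))) (mid_paths F (fisher_verts G B W) (fisher_verts G B W'))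
        \<le> ennreal C * infsum (\<lambda>p. ennreal (rate ?x' ^ (length p - 2))) (mid_paths G W W') \<and>
      infsum (\<lambda>p. ennreal (rate ?x' ^ (length p - 2))) (mid_paths G W W')
        \<le> ennreal C * infsum (\<lambda>q. ennreal (?x' ^ (length q - 2))) (mid_paths F (fisher_verts G B W) (fisher_verts G B W'))"
    using far_sums_comparable[OF x'] by blast
  \<comment> \<open>The base 3 comes from \<open>2 * d + 1 \<le> 3 * d\<close> for
    \<open>d \<ge> 1\<close>.\<close>
  define M where "M = C * 3 powr \<bar>w\<bar>"
  have M: "M > 0" using C by (simp add: M_def)
  have "eventually (\<lambda>k. ?d k \<ge> 2) sequentially" using lim by (simp add: filterlim_at_top)
  hence ev: "eventually (\<lambda>k. ?z k \<le> ennreal M * ?z' k \<and> ?z' k \<le> ennreal M * ?z k) sequentially"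
  proof eventually_elim
    case (elim k)
    have d: "0 < real (?d k)" "real (?d k) \<le> real (?d' k)" "real (?d' k) \<le> 3 * real (?d k)"
      using elim dd[of k] by auto
    have Z: "saw_Z G W (\<alpha> k) ?x = infsum (\<lambda>p. ennreal (rate ?x' ^ (length p - 2))) (mid_paths G W (\<alpha> k ` W))"
      unfolding rate_connective_constant using coloured_automorphismsD(1) \<alpha> W1 elim by (intro saw_Z_eq) auto
    have Z': "saw_Z F ?W (?\<beta> k) ?x' = infsum (\<lambda>q. ennreal (?x' ^ (length q - 2))) (mid_paths F ?W (fisher_verts G B (\<alpha> k ` W)))"
      unfolding im[symmetric]
    proof (rule fisher.saw_Z_eq)
      show "?W \<subseteq> verts F" using W' by (simp add: fundamental_domain_def)
      show "2 \<le> ?d' k" using elim dd(1)[of k] by simp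
    qed (use map_fisher_vertex_automorphism \<alpha> in auto)
    have c: "saw_Z F ?W (?\<beta> k) ?x' \<le> ennreal C * saw_Z G W (\<alpha> k) ?x"
      "saw_Z G W (\<alpha> k) ?x \<le> ennreal C * saw_Z F ?W (?\<beta> k) ?x'"
      unfolding Z Z' using cmp[rule_format, OF W1 W3(1) elim] by auto
    have p: "ennreal (real (?d' k) powr w) \<le> ennreal (3 powr \<bar>w\<bar>) * ennreal (real (?d k) powr w)"
      "ennreal (real (?d k) powr w) \<le> ennreal (3 powr \<bar>w\<bar>) * ennreal (real (?d' k) powr w)"
      using powr_comparable[OF d, of w] by (simp_all add: ennreal_mult[symmetric] ennreal_leI)
    have MM: "ennreal M = ennreal C * ennreal (3 powr \<bar>w\<bar>)" unfolding M_def using C by (intro ennreal_mult) auto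
    have "?z k \<le> (ennreal C * saw_Z F ?W (?\<beta> k) ?x') * (ennreal (3 powr \<bar>w\<bar>) * ennreal (real (?d' k) powr w))"
      by (intro mult_mono c p) auto
    moreover have "?z' k \<le> (ennreal C * saw_Z G W (\<alpha> k) ?x) * (ennreal (3 powr \<bar>w\<bar>) * ennreal (real (?d k) powr w))"
      by (intro mult_mono c p) auto
    ultimately show ?case unfolding MM by (simp add: mult_ac)
  qed
  show "(ereal w < h \<longrightarrow> ?z \<longlonglongrightarrow> 0) \<and> (h < ereal w \<longrightarrow> ?z \<longlonglongrightarrow> \<infinity>)"
  proof (intro conjI impI)
    assume "ereal w < h"
    hence "(\<lambda>k. ennreal M * ?z' k) \<longlonglongrightarrow> ennreal M * 0" by (intro ennreal_tendsto_cmult etaF) auto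
    hence up: "(\<lambda>k. ennreal M * ?z' k) \<longlonglongrightarrow> 0" by simp
    show "?z \<longlonglongrightarrow> 0"
      by (rule tendsto_sandwich[OF _ _ tendsto_const up]) (use ev in \<open>auto elim: eventually_mono\<close>)
  next
    assume "h < ereal w"
    hence "(\<lambda>k. ennreal (1 / M) * ?z' k) \<longlonglongrightarrow> ennreal (1 / M) * \<infinity>" by (intro ennreal_tendsto_cmult etaF) auto
    moreover have "ennreal (1 / M) * \<infinity> = \<infinity>" using M by (simp add: ennreal_mult_top)
    ultimately have lo: "(\<lambda>k. ennreal (1 / M) * ?z' k) \<longlonglongrightarrow> \<infinity>" by simp
    have "eventually (\<lambda>k. ennreal (1 / M) * ?z' k \<le> ?z k) sequentially"
      using ev
    proof eventually_elim
      case (elim k)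
      hence "ennreal (1 / M) * ?z' k \<le> ennreal (1 / M) * (ennreal M * ?z k)" by (intro mult_left_mono) auto
      also have "\<dots> = ennreal (1 / M * M) * ?z k" using M by (simp only: ennreal_mult mult.assoc less_imp_le divide_nonneg_pos zero_le_one)
      also have "\<dots> = ?z k" using M by simp
      finally show ?case .
    qed
    thus "?z \<longlonglongrightarrow> \<infinity>" by (rule tendsto_sandwich[OF _ _ lo tendsto_const]) auto
  qed
qed

text \<open>Take a vertex far from \<open>W\<close> and an automorphism moving it into
  \<open>W\<close>; the inverse moves \<open>W\<close> to a set containing that vertex. This image
  has the same diameter as \<open>W\<close>, so all of it is far away.\<close>

lemma exists_far_automorphism:
  assumes W: "fundamental_domain G (coloured_automorphisms G B) W"
  shows "\<exists>\<alpha>\<in>coloured_automorphisms G B. graph_set_dist G W (\<alpha> ` W) \<ge> k"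
proof -
  have fW: "finite W" "W \<subseteq> verts G" using W by (auto simp: fundamental_domain_def)
  have ne: "W \<noteq> {}" using W verts_nonempty unfolding fundamental_domain_def by blast
  define R where "R = Max ((\<lambda>(a, b). graph_dist G a b) ` (W \<times> W))"
  have R: "graph_dist G a b \<le> R" if "a \<in> W" "b \<in> W" for a b
    unfolding R_def using that fW by (intro Max_ge) auto
  obtain v where v: "v \<in> verts G" "\<And>w. w \<in> W \<Longrightarrow> graph_dist G w v > k + R" using exists_far[OF fW] by blast
  obtain \<phi> where \<phi>: "\<phi> \<in> coloured_automorphisms G B" "\<phi> v \<in> W"
    using W v(1) by (auto simp: fundamental_domain_def)
  define \<alpha> where "\<alpha> = inv_into (verts G) \<phi>"
  have \<alpha>: "\<alpha> \<in> coloured_automorphisms G B" using inv_coloured_automorphism[OF \<phi>(1)] by (simp add: \<alpha>_def)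
  note au = coloured_automorphismsD(1)[OF \<alpha>]
  have \<alpha>v: "\<alpha> (\<phi> v) = v"
    using automorphismsD(1)[OF coloured_automorphismsD(1)[OF \<phi>(1)]] v(1) by (simp add: \<alpha>_def)
  obtain a b where ab: "a \<in> W" "b \<in> \<alpha> ` W" "graph_dist G a b = graph_set_dist G W (\<alpha> ` W)"
    using graph_set_dist_attained[of W "\<alpha> ` W"] ne by blast
  obtain c where c: "c \<in> W" "b = \<alpha> c" using ab(2) by blast
  have vs: "a \<in> verts G" "b \<in> verts G" "c \<in> verts G" "\<phi> v \<in> verts G"
    using ab c fW \<phi>(2) automorphismsD(3)[OF au] by auto
  have "graph_dist G b v = graph_dist G c (\<phi> v)"
    using graph_dist_automorphism[OF conn au vs(3,4)] c(2) \<alpha>v by simp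
  hence "graph_dist G b v \<le> R" using R[OF c(1) \<phi>(2)] by simp
  moreover have "graph_dist G a v \<le> graph_dist G a b + graph_dist G b v"
    by (rule graph_dist_triangle[OF conn vs(1,2) v(1)])
  ultimately have "k \<le> graph_set_dist G W (\<alpha> ` W)" using v(2)[OF ab(1)] ab(3) by simp
  thus ?thesis using \<alpha> by blast
qed

text \<open>The defining property is not vacuous, as images of a domain can recede to infinity. A
  real number strictly between two candidate exponents would make one sequence tend both to 0 and to
  infinity.\<close>

lemma is_eta_unique:
  assumes "is_eta G (coloured_automorphisms G B) h" "is_eta G (coloured_automorphisms G B) h'"
  shows "h = h'"
proof -
  obtain W where W: "fundamental_domain G (coloured_automorphisms G B) W" using qt by (auto simp: quasi_transitive_def)
  obtain \<alpha> where \<alpha>: "\<And>k. \<alpha> k \<in> coloured_automorphisms G B" "\<And>k. graph_set_dist G W (\<alpha> k ` W) \<ge> k"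
    using exists_far_automorphism[OF W] by metis
  have lim: "filterlim (\<lambda>k. graph_set_dist G W (\<alpha> k ` W)) at_top sequentially"
    by (rule filterlim_at_top_mono[OF filterlim_ident]) (use \<alpha>(2) in auto)
  let ?z = "\<lambda>w k. saw_Z G W (\<alpha> k) (1 / connective_constant G) * ennreal (real (graph_set_dist G W (\<alpha> k ` W)) powr w)"
  have le: "\<not> h1 < h2" if "is_eta G (coloured_automorphisms G B) h1" "is_eta G (coloured_automorphisms G B) h2" for h1 h2
  proof
    assume "h1 < h2"
    then obtain w where w: "h1 < ereal w" "ereal w < h2" using ereal_dense2 by blast
    have "?z w \<longlonglongrightarrow> \<infinity>"
      using that(1)[unfolded is_eta_def, rule_format, OF W, of \<alpha> w] \<alpha>(1) lim w(1) by blast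
    moreover have "?z w \<longlonglongrightarrow> 0"
      using that(2)[unfolded is_eta_def, rule_format, OF W, of \<alpha> w] \<alpha>(1) lim w(2) by blast
    ultimately have "(\<infinity>::ennreal) = 0" by (rule LIMSEQ_unique)
    thus False by simp
  qed
  show ?thesis using le[OF assms] le[OF assms(2,1)] by (simp add: not_less)
qed

lemma saw_eta_fisher:
  assumes "eta_exists F (automorphisms F)"
  shows "eta_exists G (coloured_automorphisms G B)"
    "saw_eta G (coloured_automorphisms G B) = saw_eta F (automorphisms F)"
proof -
  obtain h where h: "is_eta F (automorphisms F) h" using assms by (auto simp: eta_exists_def)
  note hG = is_eta_of_fisher[OF h]
  show "eta_exists G (coloured_automorphisms G B)" using hG by (auto simp: eta_exists_def)
  \<comment> \<open>Every exponent of the Fisher graph is one of \<open>G\<close>, so uniqueness on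
    \<open>G\<close> settles uniqueness here as well.\<close>
  have "saw_eta F (automorphisms F) = h" unfolding saw_eta_def
    by (rule the_equality) (use h is_eta_unique[OF is_eta_of_fisher hG] in blast)+
  moreover have "saw_eta G (coloured_automorphisms G B) = h" unfolding saw_eta_def
    by (rule the_equality) (use hG is_eta_unique[OF _ hG] in blast)+
  ultimately show "saw_eta G (coloured_automorphisms G B) = saw_eta F (automorphisms F)" by simp
qed

end


section \<open>Slowly varying functions\<close>

text \<open>With \<open>f t = ln (L (exp t))\<close>, an increment \<open>\<bar>f (t + u) - f t\<bar> > 1\<close> forces
  \<open>\<bar>f (t + s) - f t\<bar>\<close> and \<open>\<bar>f (t + s) - f (t + u)\<bar>\<close> to add up to at least \<open>1\<close> for every \<open>s\<close>, whereas
  the integrals of both over \<open>s\<close>, cut off at \<open>1\<close>, tend to \<open>0\<close> by dominated convergence.\<close>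

lemma slowly_varying_uniformly_bounded:
  assumes L: "slowly_varying L"
  shows "\<exists>X. \<forall>x\<ge>X. \<forall>c\<in>{1..13}. 0 < L x \<and> L (c * x) \<le> exp 1 * L x \<and> L x \<le> exp 1 * L (c * x)"
proof -
  obtain a where a: "a > 0" "\<And>x. x \<ge> a \<Longrightarrow> L x > 0" "L \<in> borel_measurable (restrict_space borel {a..})"
    using L unfolding slowly_varying_def by blast
  have ratio: "((\<lambda>x. L (c * x) / L x) \<longlongrightarrow> 1) at_top" if "c > 0" for c
    using L that unfolding slowly_varying_def by blast
  \<comment> \<open>The indicator makes \<open>f\<close> measurable on the whole line, since
    \<open>L\<close> is assumed measurable from \<open>a\<close> on.\<close>
  define f where "f t = ln (indicator {a..} (exp t) * L (exp t))" for t
  have f_eq: "f t = ln (L (exp t))" if "t \<ge> ln a" for t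
  proof -
    have "exp t \<ge> a" using that a(1) by (metis exp_le_cancel_iff exp_ln)
    thus ?thesis by (simp add: f_def)
  qed
  have [measurable]: "f \<in> borel_measurable borel"
  proof -
    have L1: "(\<lambda>x. indicator {a..} x * L x) \<in> borel_measurable borel"
      using a(3) by (subst (asm) borel_measurable_restrict_space_iff) auto
    have "(\<lambda>t. indicator {a..} (exp t) * L (exp t)) \<in> borel_measurable borel"
      using measurable_compose[OF borel_measurable_exp L1] by simp
    thus ?thesis unfolding f_def by simp
  qed
  \<comment> \<open>Multiplication by a factor between 1 and 13 becomes translation by at most
    \<open>T\<close>.\<close>
  define T :: real where "T = ln 13"
  have T: "T > 0" by (simp add: T_def)
  have conv: "(\<lambda>n. f (t n + s) - f (t n)) \<longlonglongrightarrow> 0" if t: "filterlim t at_top sequentially" and "s \<ge> 0" for t s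
  proof -
    have "filterlim (\<lambda>n. exp (t n)) at_top sequentially" using filterlim_compose[OF exp_at_top t] .
    from filterlim_compose[OF ratio[of "exp s"] this]
    have "(\<lambda>n. L (exp s * exp (t n)) / L (exp (t n))) \<longlonglongrightarrow> 1" by simp
    from tendsto_ln[OF this] have "(\<lambda>n. ln (L (exp s * exp (t n)) / L (exp (t n)))) \<longlonglongrightarrow> 0" by simp
    moreover have "eventually (\<lambda>n. ln (L (exp s * exp (t n)) / L (exp (t n))) = f (t n + s) - f (t n)) sequentially"
    proof -
      have "eventually (\<lambda>n. t n \<ge> ln a) sequentially" using t by (simp add: filterlim_at_top)
      thus ?thesis
      proof eventually_elim
        case (elim n)
        have "exp (ln a) \<le> exp (t n)" "exp (ln a) \<le> exp (t n + s)" using elim \<open>s \<ge> 0\<close> by simp_all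
        hence "exp (t n) \<ge> a" "exp (t n + s) \<ge> a" using a(1) by simp_all
        hence "L (exp (t n)) > 0" "L (exp (t n + s)) > 0" using a(2) by auto
        thus ?case using f_eq[of "t n"] f_eq[of "t n + s"] elim \<open>s \<ge> 0\<close>
          by (simp add: ln_div exp_add mult.commute)
      qed
    qed
    ultimately show ?thesis by (rule Lim_transform_eventually)
  qed
  \<comment> \<open>The window has length \<open>2 * T\<close> so that, for every shift
    \<open>u\<close> in \<open>{0..T}\<close>, the windows starting at \<open>t\<close> and at
    \<open>t + u\<close> both contain the points \<open>t + s\<close> with \<open>s\<close> in
    \<open>{T..2 * T}\<close>.\<close>
  define J where "J t = (\<integral>\<^sup>+s. ennreal (min 1 \<bar>f (t + s) - f t\<bar>) * indicator {0..2 * T} s \<partial>lborel)" for t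
  have J: "(\<lambda>n. J (t n)) \<longlonglongrightarrow> 0" if t: "filterlim t at_top sequentially" for t
  proof -
    have "(\<lambda>n. J (t n)) \<longlonglongrightarrow> (\<integral>\<^sup>+(s::real). 0 \<partial>lborel)"
      unfolding J_def
    proof (rule nn_integral_dominated_convergence[where w = "\<lambda>s. indicator {0..2 * T} s"])
      show "AE s in lborel. ennreal (min 1 \<bar>f (t n + s) - f (t n)\<bar>) * indicator {0..2 * T} s \<le> indicator {0..2 * T} s" for n
        by (auto simp: indicator_def)
      show "AE s in lborel. (\<lambda>n. ennreal (min 1 \<bar>f (t n + s) - f (t n)\<bar>) * indicator {0..2 * T} s) \<longlonglongrightarrow> 0"
      proof (intro AE_I2)
        fix s
        show "(\<lambda>n. ennreal (min 1 \<bar>f (t n + s) - f (t n)\<bar>) * indicator {0..2 * T} s) \<longlonglongrightarrow> 0"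
        proof (cases "s \<in> {0..2 * T}")
          case True
          have "(\<lambda>n. min 1 \<bar>f (t n + s) - f (t n)\<bar>) \<longlonglongrightarrow> min 1 \<bar>0\<bar>"
            using True by (intro tendsto_min tendsto_const tendsto_rabs conv[OF t]) simp
          hence "(\<lambda>n. ennreal (min 1 \<bar>f (t n + s) - f (t n)\<bar>)) \<longlonglongrightarrow> ennreal 0"
            by (intro tendsto_ennrealI) simp
          thus ?thesis using True by simp
        qed simp
      qed
    qed (use T in auto)
    thus ?thesis by simp
  qed
  have key: "\<exists>X. \<forall>t\<ge>X. \<forall>u\<in>{0..T}. \<bar>f (t + u) - f t\<bar> \<le> 1"
  proof (rule ccontr)
    assume "\<not> ?thesis"
    hence "\<forall>n::nat. \<exists>t u. t \<ge> real n \<and> u \<in> {0..T} \<and> \<bar>f (t + u) - f t\<bar> > 1" by (meson not_le)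
    then obtain t u where tu: "\<And>n::nat. t n \<ge> real n" "\<And>n. u n \<in> {0..T}" "\<And>n. \<bar>f (t n + u n) - f (t n)\<bar> > 1"
      by metis
    have t: "filterlim t at_top sequentially"
      by (rule filterlim_at_top_mono[OF filterlim_real_sequentially]) (use tu(1) in auto)
    have t': "filterlim (\<lambda>n. t n + u n) at_top sequentially"
      by (rule filterlim_at_top_mono[OF t]) (use tu(2) in auto)
    have "ennreal T \<le> J (t n) + J (t n + u n)" for n
    proof -
      let ?g = "\<lambda>s. ennreal (min 1 \<bar>f (t n + s) - f (t n)\<bar>)"
      let ?k = "\<lambda>s. ennreal (min 1 \<bar>f (t n + s) - f (t n + u n)\<bar>)"
      have "ennreal T = (\<integral>\<^sup>+s. indicator {T..2 * T} s \<partial>lborel)" using T by simp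
      also have "\<dots> \<le> (\<integral>\<^sup>+s. ?g s * indicator {0..2 * T} s + ?k s * indicator {T..2 * T} s \<partial>lborel)"
      proof (rule nn_integral_mono)
        fix s
        have "1 \<le> min 1 \<bar>f (t n + s) - f (t n)\<bar> + min 1 \<bar>f (t n + s) - f (t n + u n)\<bar>"
          using tu(3)[of n] by linarith
        hence "ennreal 1 \<le> ennreal (min 1 \<bar>f (t n + s) - f (t n)\<bar> + min 1 \<bar>f (t n + s) - f (t n + u n)\<bar>)"
          by (rule ennreal_leI)
        also have "\<dots> = ?g s + ?k s" by (intro ennreal_plus) auto
        finally have "ennreal 1 \<le> ?g s + ?k s" .
        thus "indicator {T..2 * T} s \<le> ?g s * indicator {0..2 * T} s + ?k s * indicator {T..2 * T} s"
          using T by (auto simp: indicator_def)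
      qed
      also have "\<dots> = J (t n) + (\<integral>\<^sup>+s. ?k s * indicator {T..2 * T} s \<partial>lborel)"
        unfolding J_def by (rule nn_integral_add) auto
      also have "(\<integral>\<^sup>+s. ?k s * indicator {T..2 * T} s \<partial>lborel) =
          (\<integral>\<^sup>+s. ?k (u n + s) * indicator {T..2 * T} (u n + s) \<partial>lborel)"
        using nn_integral_real_affine[of "\<lambda>s. ?k s * indicator {T..2 * T} s" 1 "u n"] by simp
      also have "\<dots> \<le> J (t n + u n)"
        unfolding J_def using tu(2)[of n] by (intro nn_integral_mono) (auto simp: indicator_def add.assoc)
      finally show ?thesis by (simp add: add_left_mono)
    qed
    moreover have "(\<lambda>n. J (t n) + J (t n + u n)) \<longlonglongrightarrow> 0 + 0" by (intro tendsto_add J t t')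
    ultimately have "ennreal T \<le> 0 + 0" by (intro LIMSEQ_le_const) auto
    thus False using T by simp
  qed
  then obtain X where X: "\<And>t u. t \<ge> X \<Longrightarrow> u \<in> {0..T} \<Longrightarrow> \<bar>f (t + u) - f t\<bar> \<le> 1" by blast
  have "0 < L x \<and> L (c * x) \<le> exp 1 * L x \<and> L x \<le> exp 1 * L (c * x)"
    if x: "x \<ge> max a (exp X)" and c: "c \<in> {1..13}" for x c
  proof -
    have pos: "x > 0" "x \<ge> a" "c > 0" using x c a(1) by auto
    have "x \<le> c * x" using mult_right_mono[of 1 c x] c pos by simp
    hence cx: "c * x \<ge> a" "c * x > 0" using pos by linarith+
    have Lp: "L x > 0" "L (c * x) > 0" using a(2) pos cx by auto
    have "ln x \<ge> X" using x pos by (simp add: ln_ge_iff)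
    moreover have "ln c \<in> {0..T}" using c by (auto simp: T_def)
    ultimately have "\<bar>f (ln x + ln c) - f (ln x)\<bar> \<le> 1" by (rule X)
    moreover have "ln x + ln c = ln (c * x)" using pos by (simp add: ln_mult)
    moreover have "f (ln x) = ln (L x)" "f (ln (c * x)) = ln (L (c * x))"
      using f_eq[of "ln x"] f_eq[of "ln (c * x)"] pos cx a(1) by simp_all
    ultimately have "ln (L (c * x)) \<le> 1 + ln (L x)" "ln (L x) \<le> 1 + ln (L (c * x))" by auto
    hence "ln (L (c * x)) \<le> ln (exp 1 * L x)" "ln (L x) \<le> ln (exp 1 * L (c * x))"
      using Lp by (simp_all add: ln_mult)
    thus ?thesis using Lp by (simp add: ln_le_cancel_iff)
  qed
  thus ?thesis by blast
qed

text \<open>The uniform bound covers all \<open>n\<close> beyond \<open>N\<close>. The finitely many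
  other pairs are handled by the sum of all their ratios, which dominates each of them by
  positivity.\<close>

lemma slowly_varying_comparable:
  assumes L: "slowly_varying L" and pos: "\<And>n::nat. n \<ge> 1 \<Longrightarrow> L (real n) > 0"
  shows "\<exists>K\<ge>0. \<forall>n m. 1 \<le> n \<longrightarrow> n \<le> m \<longrightarrow> m \<le> 13 * n \<longrightarrow>
    L (real m) \<le> K * L (real n) \<and> L (real n) \<le> K * L (real m)"
proof -
  obtain X where X: "\<And>x c. x \<ge> X \<Longrightarrow> c \<in> {1..13} \<Longrightarrow> L (c * x) \<le> exp 1 * L x \<and> L x \<le> exp 1 * L (c * x)"
    using slowly_varying_uniformly_bounded[OF L] by blast
  define N where "N = nat \<lceil>X\<rceil>"
  define R where "R = (\<Sum>(i, j)\<in>{1..13 * N} \<times> {1..13 * N}. L (real i) / L (real j))"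
  have R: "L (real i) \<le> R * L (real j)" if ij: "i \<in> {1..13 * N}" "j \<in> {1..13 * N}" for i j
  proof -
    have "(case (i, j) of (i, j) \<Rightarrow> L (real i) / L (real j)) \<le> R"
      unfolding R_def by (rule member_le_sum) (use ij in \<open>auto intro!: divide_nonneg_nonneg less_imp_le[OF pos]\<close>)
    thus ?thesis using pos[of j] ij by (simp add: field_simps)
  qed
  have R0: "R \<ge> 0" unfolding R_def by (rule sum_nonneg) (auto intro!: divide_nonneg_nonneg less_imp_le[OF pos])
  have "L (real m) \<le> (exp 1 + R) * L (real n) \<and> L (real n) \<le> (exp 1 + R) * L (real m)"
    if nm: "1 \<le> n" "n \<le> m" "m \<le> 13 * n" for n m
  proof -
    have p: "L (real n) > 0" "L (real m) > 0" using pos nm by auto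
    have "L (real m) \<le> exp 1 * L (real n) \<and> L (real n) \<le> exp 1 * L (real m) \<or>
        L (real m) \<le> R * L (real n) \<and> L (real n) \<le> R * L (real m)"
    proof (cases "n \<le> N")
      case True
      thus ?thesis using R[of m n] R[of n m] nm by auto
    next
      case False
      hence "real n \<ge> X" unfolding N_def by linarith
      moreover have "real m / real n \<in> {1..13}" using nm by (auto simp: field_simps)
      ultimately show ?thesis using X[of "real n" "real m / real n"] nm by simp
    qed
    thus ?thesis using p R0 by (auto simp: distrib_right intro: add_increasing2 add_increasing)
  qed
  thus ?thesis using R0 by (intro exI[of _ "exp 1 + R"]) auto
qed

theorem theorem3p3:
  fixes G :: "'a ugraph" and B :: "'a set"
  assumes "simple_graph G" and "infinite (verts G)" and "graph_connected G"
    and "locally_finite G"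
    and "bipartite_colouring G B"
    and "quasi_transitive G (coloured_automorphisms G B)"
    and "\<forall>v\<in>B. vertex_degree G v = 3"
  shows "1 / (connective_constant G)\<^sup>2 =
           (1 / connective_constant (fisher G B)) ^ 3 + (1 / connective_constant (fisher G B)) ^ 4
    \<and> (\<bar>saw_gamma G (coloured_automorphisms G B)\<bar> < \<infinity> \<and>
         eta_exists (fisher G B) (automorphisms (fisher G B)) \<longrightarrow>
       saw_gamma G (coloured_automorphisms G B) =
         saw_gamma (fisher G B) (automorphisms (fisher G B)) \<and>
       eta_exists G (coloured_automorphisms G B) \<and>
       saw_eta G (coloured_automorphisms G B) =
         saw_eta (fisher G B) (automorphisms (fisher G B)) \<and>
       (\<forall>W. fundamental_domain G (coloured_automorphisms G B) W \<longrightarrow>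
          (\<exists>C1>0. \<exists>C2>0. \<exists>D1>0. \<exists>D2>0. \<exists>L. slowly_varying L \<and>
             (\<forall>n::nat. n \<ge> 1 \<longrightarrow>
               (let g = real_of_ereal (saw_gamma G (coloured_automorphisms G B));
                    \<mu> = connective_constant G;
                    \<mu>' = connective_constant (fisher G B);
                    \<sigma> = real (card (mid_saws_n G W n));
                    \<sigma>' = real (card (mid_saws_n (fisher G B) (fisher_verts G B W) n))
                in C1 * L (real n) * real n powr (g - 1) * \<mu> ^ n \<le> \<sigma> \<and>
                   \<sigma> \<le> C2 * L (real n) * real n powr (g - 1) * \<mu> ^ n \<and>
                   D1 * L (real n) * real n powr (g - 1) * \<mu>' ^ n \<le> \<sigma>' \<and>
                   \<sigma>' \<le> D2 * L (real n) * real n powr (g - 1) * \<mu>' ^ n))) \<longrightarrow>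
          saw_nu G (coloured_automorphisms G B) =
            saw_nu (fisher G B) (automorphisms (fisher G B))))"
proof -
  interpret fisher_setting G B
    by unfold_locales (use assms in \<open>auto simp: coloured_automorphisms_def\<close>)
  \<comment> \<open>The predicates agree for every candidate value, so the two definite descriptions
    denote the same number.\<close>
  have gamma: "saw_gamma G (coloured_automorphisms G B) = saw_gamma F (automorphisms F)"
  proof -
    have "is_gamma G (coloured_automorphisms G B) = is_gamma F (automorphisms F)"
      by (rule ext) (rule is_gamma_fisher_iff)
    thus ?thesis by (simp add: saw_gamma_def)
  qed
  have nu: "saw_nu G (coloured_automorphisms G B) = saw_nu F (automorphisms F)"
    if W: "fundamental_domain G (coloured_automorphisms G B) W"
      and C: "C1 > 0" "C2 > 0" "D1 > 0" "D2 > 0" and L: "slowly_varying L"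
      and bounds: "\<And>n::nat. n \<ge> 1 \<Longrightarrow>
        C1 * L (real n) * real n powr (g - 1) * connective_constant G ^ n \<le> real (card (mid_saws_n G W n)) \<and>
        real (card (mid_saws_n G W n)) \<le> C2 * L (real n) * real n powr (g - 1) * connective_constant G ^ n \<and>
        D1 * L (real n) * real n powr (g - 1) * connective_constant F ^ n
          \<le> real (card (mid_saws_n F (fisher_verts G B W) n)) \<and>
        real (card (mid_saws_n F (fisher_verts G B W) n))
          \<le> D2 * L (real n) * real n powr (g - 1) * connective_constant F ^ n" for W C1 C2 D1 D2 L g
  proof -
    define l where "l n = L (real n) * real n powr (g - 1)" for n :: nat
    \<comment> \<open>Slow variation gives positivity near infinity only. At every
      \<open>n \<ge> 1\<close> it follows from the assumed upper bound, because walks of each length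
      exist and their number is positive.\<close>
    have Lpos: "L (real n) > 0" if n: "n \<ge> 1" for n :: nat
    proof (rule ccontr)
      assume "\<not> L (real n) > 0"
      hence "C2 * L (real n) * real n powr (g - 1) * connective_constant G ^ n \<le> 0"
        using C(2) connective_constant_ge_1 by (intro mult_nonpos_nonneg mult_nonneg_nonpos) auto
      moreover have "0 < real (card (mid_saws_n G W n))"
        using card_mid_paths_n_pos[OF W n] card_mid_saws_n[OF n] by simp
      ultimately show False using bounds[OF n] by linarith
    qed
    obtain K where K: "K \<ge> 0" "\<And>n m. 1 \<le> n \<Longrightarrow> n \<le> m \<Longrightarrow> m \<le> 13 * n \<Longrightarrow>
        L (real m) \<le> K * L (real n) \<and> L (real n) \<le> K * L (real m)"
      using slowly_varying_comparable[OF L Lpos] by blast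
    have "is_nu G (coloured_automorphisms G B) v \<longleftrightarrow> is_nu F (automorphisms F) v" for v
    proof (rule is_nu_fisher_iff[OF W C, where l = l and K = "K * 13 powr \<bar>g - 1\<bar>"])
      show "l n > 0" if "n \<ge> 1" for n using Lpos[OF that] that by (simp add: l_def)
    next
      fix n m :: nat assume nm: "1 \<le> n" "n \<le> m" "m \<le> 13 * n"
      hence rnm: "0 < real n" "real n \<le> real m" "real m \<le> 13 * real n" by auto
      note pc = powr_comparable[OF rnm, of "g - 1"] and Lc = K(2)[OF nm]
      have p: "L (real n) > 0" "L (real m) > 0" using Lpos nm by auto
      have "l m \<le> (K * L (real n)) * (13 powr \<bar>g - 1\<bar> * real n powr (g - 1))"
        unfolding l_def using pc Lc p K(1) by (intro mult_mono) auto
      moreover have "l n \<le> (K * L (real m)) * (13 powr \<bar>g - 1\<bar> * real m powr (g - 1))"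
        unfolding l_def using pc Lc p K(1) by (intro mult_mono) auto
      ultimately show "l m \<le> K * 13 powr \<bar>g - 1\<bar> * l n \<and> l n \<le> K * 13 powr \<bar>g - 1\<bar> * l m"
        by (simp add: l_def mult_ac)
    qed (use bounds K(1) in \<open>auto simp: l_def mult.assoc\<close>)
    hence "is_nu G (coloured_automorphisms G B) = is_nu F (automorphisms F)" by (rule ext)
    thus ?thesis by (simp add: saw_nu_def)
  qed
  have "\<forall>W. fundamental_domain G (coloured_automorphisms G B) W \<longrightarrow>
      (\<exists>C1>0. \<exists>C2>0. \<exists>D1>0. \<exists>D2>0. \<exists>L. slowly_varying L \<and>
         (\<forall>n::nat. n \<ge> 1 \<longrightarrow>
           (let g = real_of_ereal (saw_gamma G (coloured_automorphisms G B));
                \<mu> = connective_constant G;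
                \<mu>' = connective_constant F;
                \<sigma> = real (card (mid_saws_n G W n));
                \<sigma>' = real (card (mid_saws_n F (fisher_verts G B W) n))
            in C1 * L (real n) * real n powr (g - 1) * \<mu> ^ n \<le> \<sigma> \<and>
               \<sigma> \<le> C2 * L (real n) * real n powr (g - 1) * \<mu> ^ n \<and>
               D1 * L (real n) * real n powr (g - 1) * \<mu>' ^ n \<le> \<sigma>' \<and>
               \<sigma>' \<le> D2 * L (real n) * real n powr (g - 1) * \<mu>' ^ n))) \<longrightarrow>
      saw_nu G (coloured_automorphisms G B) = saw_nu F (automorphisms F)"
    unfolding Let_def
  proof (intro allI impI, elim exE conjE)
    fix W and C1 C2 D1 D2 :: real and L
    let ?e = "\<lambda>n::nat. real n powr (real_of_ereal (saw_gamma G (coloured_automorphisms G B)) - 1)"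
    assume *: "fundamental_domain G (coloured_automorphisms G B) W" "0 < C1" "0 < C2" "0 < D1" "0 < D2"
      "slowly_varying L"
    assume "\<forall>n\<ge>1. C1 * L (real n) * ?e n * connective_constant G ^ n \<le> real (card (mid_saws_n G W n)) \<and>
      real (card (mid_saws_n G W n)) \<le> C2 * L (real n) * ?e n * connective_constant G ^ n \<and>
      D1 * L (real n) * ?e n * connective_constant F ^ n \<le> real (card (mid_saws_n F (fisher_verts G B W) n)) \<and>
      real (card (mid_saws_n F (fisher_verts G B W) n)) \<le> D2 * L (real n) * ?e n * connective_constant F ^ n"
    from nu[OF * this[rule_format]] show "saw_nu G (coloured_automorphisms G B) = saw_nu F (automorphisms F)" .
  qed
  thus ?thesis using connective_constant_fisher_eq gamma saw_eta_fisher by blast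
qed

end
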